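(* Let $n$ and $r$ be positive integers. (1) Suppose $n$ is even and one of the following holds: (a) $n\ge 8$ and $r\ge 3$; (b) $n=6$ and $r\ge 4$; (c) $n=4$ and $r\ge 5$. Then a generic matrix in $\mathbb{C}^{n\times n}$ is a product of $r$ skew symmetric matrices in $\mathbb{C}^{n\times n}$. (2) Suppose $n$ is odd and one of the following holds: (a) $n\ge 5$ and $r\ge 3$; (b) $n=3$ and $r\ge 4$. Then a generic matrix in $\mathrm{DET}_n$ (that is, a generic $n\times n$ complex matrix with zero determinant) is a product of $r$ skew symmetric matrices in $\mathbb{C}^{n\times n}$.
   Context: A matrix $A\in\mathbb{C}^{n\times n}$ is skew symmetric if $A=-A^{\mathsf T}$. $\mathrm{DET}_n=\{A\in\mathbb{C}^{n\times n}:\det A=0\}$ is the determinant hypersurface. An algebraic subvariety of $\mathbb{C}^N$ is the zero set of finitely many polynomials. For an algebraic subvariety $X$, a property holds for a generic point of $X$ if there is an algebraic subvariety $Z\subsetneq X$ such that every point of $X$ not having the property lies in $Z$. *)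

theory Defs
  imports "HOL-Library.Poly_Mapping" "Jordan_Normal_Form.Determinant"
begin

(* Complex polynomials in variables from 'v are finitely supported functions from
   monomials to coefficients, a monomial being a finitely supported exponent map. *)
type_synonym 'v cpoly = "('v \<Rightarrow>\<^sub>0 nat) \<Rightarrow>\<^sub>0 complex"

definition cpoly_vars :: "'v cpoly \<Rightarrow> 'v set" where
  "cpoly_vars p = (\<Union>m\<in>Poly_Mapping.keys p. Poly_Mapping.keys m)"

definition cpoly_eval :: "('v \<Rightarrow> complex) \<Rightarrow> 'v cpoly \<Rightarrow> complex" where
  "cpoly_eval x p =
     (\<Sum>m\<in>Poly_Mapping.keys p. Poly_Mapping.lookup p m *
        (\<Prod>v\<in>Poly_Mapping.keys m. x v ^ Poly_Mapping.lookup m v))"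

(* C^(n x n) is affine space of dimension n^2; its coordinates are the matrix entries,
   so the polynomials use the variables (i, j) with i, j < n. *)
definition algebraic_subvariety :: "nat \<Rightarrow> complex mat set \<Rightarrow> bool" where
  "algebraic_subvariety n X \<longleftrightarrow>
     (\<exists>P :: (nat \<times> nat) cpoly set. finite P \<and>
        (\<forall>p\<in>P. cpoly_vars p \<subseteq> {..<n} \<times> {..<n}) \<and>
        X = {A \<in> carrier_mat n n. \<forall>p\<in>P. cpoly_eval (\<lambda>ij. A $$ ij) p = 0})"

(* Only meaningful when X is itself an algebraic subvariety of the n x n matrices. *)
definition holds_generically :: "nat \<Rightarrow> complex mat set \<Rightarrow> (complex mat \<Rightarrow> bool) \<Rightarrow> bool" where
  "holds_generically n X Q \<longleftrightarrow>
     (\<exists>Z. algebraic_subvariety n Z \<and> Z \<subset> X \<and> (\<forall>A\<in>X. \<not> Q A \<longrightarrow> A \<in> Z))"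

definition DET :: "nat \<Rightarrow> complex mat set" where
  "DET n = {A \<in> carrier_mat n n. det A = 0}"

definition skew_symmetric_mat :: "nat \<Rightarrow> complex mat \<Rightarrow> bool" where
  "skew_symmetric_mat n A \<longleftrightarrow> A \<in> carrier_mat n n \<and> A = - transpose_mat A"

definition product_of_skew_symmetric :: "nat \<Rightarrow> nat \<Rightarrow> complex mat \<Rightarrow> bool" where
  "product_of_skew_symmetric n r A \<longleftrightarrow>
     (\<exists>Ss. length Ss = r \<and> (\<forall>S\<in>set Ss. skew_symmetric_mat n S) \<and>
           A = foldr (*) Ss (1\<^sub>m n))"

end

theory Submission
  imports Defs "Jordan_Normal_Form.Schur_Decomposition"
begin

text \<open>
  The idea is to reduce generic matrices to a normal form that is visibly a product of skew symmetric
  matrices. A congruence \<open>A \<mapsto> P A P\<^sup>T\<close> turns a product of an odd number of skew symmetric matrices into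
  another one, and so does a similarity for an even number (\<open>product_of_skew_transform\<close>). Over the complex numbers
  an invertible matrix is determined up to congruence by the roots of \<open>det (A - t A\<^sup>T)\<close>, and any matrix
  up to similarity by its eigenvalues, if these are distinct (\<open>congruent_if_common_cosquare_spectrum\<close> and
  \<open>similar_if_common_eigenvalues\<close>); this is a polynomial condition, a discriminant. It thus suffices to find,
  for every admissible set of roots, one product of \<open>r\<close> skew symmetric matrices that has these roots.

  Products of two skew symmetric matrices are easy to produce: a diagonalizable matrix whose eigenvalues
  can be paired off is one. If \<open>diag(X\<^sup>T, Y)\<close> is of this kind then
  \<open>J diag(X\<^sup>T, Y)\<close>, with \<open>J\<close> symplectic, is a product of three, and the roots
  of its pencil are those of \<open>det (Y - t X)\<close>, up to sign, together with their reciprocals. In dimension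
  \<open>2m\<close> with \<open>m \<ge> 4\<close> one can let \<open>X\<close> and \<open>Y\<close> share \<open>m - 2\<close> eigenvalues and give each of them a double
  eigenvalue of its own, and still prescribe all roots of \<open>det (Y - t X)\<close>: for \<open>m = 4\<close> by an explicit
  \<open>4\<times>4\<close> pencil, and from \<open>m\<close> to \<open>m + 1\<close> by bordering (\<open>skew_pencil_four\<close>, \<open>skew_pencil_Suc\<close>).
  In dimensions 4 and 6 there is not enough room for this, and similar explicit pencils use five
  and four factors.

  In odd dimension a singular \<open>A\<close> with invertible leading block \<open>L\<close> of size \<open>n - 1\<close> is
  \<open>(I g\<^sup>T)\<^sup>T L (I c)\<close>, and a factorization of \<open>L\<close> into three factors extends to one of \<open>A\<close>
  (\<open>three_skew_from_leading_block\<close>). This settles \<open>n \<ge> 9\<close>. For \<open>n = 5\<close> and \<open>n = 7\<close> the leading block is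
  not generic, but arrow-shaped matrices with a suitable leading block still realize all roots. For \<open>n = 3\<close> a
  generic singular matrix is similar to a diagonal one, which is written as a product of four
  cross product matrices.

  Finally, the number of factors grows by one when \<open>A\<close> is multiplied by the inverse of a fixed
  invertible skew symmetric matrix, or by a substitute for it in odd dimension (\<open>certified_Suc\<close>,
  \<open>certified_det_Suc\<close>).
\<close>

section \<open>Polynomial functions of the matrix entries\<close>

lemma cpoly_eval_superset:
  assumes "finite S" "Poly_Mapping.keys p \<subseteq> S"
  shows "cpoly_eval x p = (\<Sum>m\<in>S. Poly_Mapping.lookup p m *
           (\<Prod>v\<in>Poly_Mapping.keys m. x v ^ Poly_Mapping.lookup m v))"
  unfolding cpoly_eval_def
  by (rule sum.mono_neutral_left) (use assms in \<open>auto simp: in_keys_iff\<close>)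

lemma cpoly_eval_add: "cpoly_eval x (p + q) = cpoly_eval x p + cpoly_eval x q"
proof -
  let ?S = "Poly_Mapping.keys p \<union> Poly_Mapping.keys q"
  show ?thesis
    by (subst (1 2 3) cpoly_eval_superset[of ?S])
       (auto simp: Poly_Mapping.keys_add lookup_add sum.distrib algebra_simps
             intro!: keys_add[THEN subsetD])
qed

lemma cpoly_eval_0 [simp]: "cpoly_eval x 0 = 0"
  by (simp add: cpoly_eval_def)

lemma cpoly_eval_sum: "cpoly_eval x (sum p I) = (\<Sum>i\<in>I. cpoly_eval x (p i))"
  by (induction I rule: infinite_finite_induct) (auto simp: cpoly_eval_add)

lemma cpoly_eval_single:
  "cpoly_eval x (Poly_Mapping.single m c) =
     c * (\<Prod>v\<in>Poly_Mapping.keys m. x v ^ Poly_Mapping.lookup m v)"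
  by (subst cpoly_eval_superset[of "{m}"]) auto

lemma monomial_eval_add:
  fixes m m' :: "'v \<Rightarrow>\<^sub>0 nat" and x :: "'v \<Rightarrow> complex"
  shows "(\<Prod>v\<in>Poly_Mapping.keys (m + m'). x v ^ Poly_Mapping.lookup (m + m') v) =
         (\<Prod>v\<in>Poly_Mapping.keys m. x v ^ Poly_Mapping.lookup m v) *
         (\<Prod>v\<in>Poly_Mapping.keys m'. x v ^ Poly_Mapping.lookup m' v)"
proof -
  let ?S = "Poly_Mapping.keys m \<union> Poly_Mapping.keys m'"
  have *: "(\<Prod>v\<in>Poly_Mapping.keys k. x v ^ Poly_Mapping.lookup k v) =
           (\<Prod>v\<in>?S. x v ^ Poly_Mapping.lookup k v)"
    if "Poly_Mapping.keys k \<subseteq> ?S" for k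
    by (rule prod.mono_neutral_left) (use that in \<open>auto simp: in_keys_iff\<close>)
  show ?thesis
    using *[of m] *[of m'] *[of "m + m'"] keys_add[of m m']
    by (auto simp: lookup_add power_add prod.distrib)
qed

lemma cpoly_eval_mult: "cpoly_eval x (p * q) = cpoly_eval x p * cpoly_eval x q"
proof -
  have "p = (\<Sum>m\<in>Poly_Mapping.keys p. Poly_Mapping.single m (Poly_Mapping.lookup p m))" for p :: "'a cpoly"
    by (rule poly_mapping_eqI)
       (auto simp: lookup_sum lookup_single when_def sum.delta in_keys_iff)
  note expand = this
  have "p * q = (\<Sum>m\<in>Poly_Mapping.keys p. Poly_Mapping.single m (Poly_Mapping.lookup p m)) *
      (\<Sum>k\<in>Poly_Mapping.keys q. Poly_Mapping.single k (Poly_Mapping.lookup q k))"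
    by (rule arg_cong2[OF expand expand])
  also have "\<dots> = (\<Sum>m\<in>Poly_Mapping.keys p. \<Sum>k\<in>Poly_Mapping.keys q.
        Poly_Mapping.single (m + k) (Poly_Mapping.lookup p m * Poly_Mapping.lookup q k))"
    by (simp only: sum_product mult_single)
  finally have "p * q = \<dots>" .
  then have "cpoly_eval x (p * q) = (\<Sum>m\<in>Poly_Mapping.keys p. \<Sum>k\<in>Poly_Mapping.keys q.
        cpoly_eval x (Poly_Mapping.single (m + k) (Poly_Mapping.lookup p m * Poly_Mapping.lookup q k)))"
    by (simp only: cpoly_eval_sum)
  also have "\<dots> = cpoly_eval x p * cpoly_eval x q"
    unfolding cpoly_eval_single monomial_eval_add
    unfolding cpoly_eval_def sum_product
    by (intro sum.cong refl) (simp only: mult_ac)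
  finally show ?thesis .
qed

lemma cpoly_vars_add: "cpoly_vars (p + q) \<subseteq> cpoly_vars p \<union> cpoly_vars q"
  using keys_add[of p q] unfolding cpoly_vars_def by blast

lemma cpoly_vars_mult: "cpoly_vars (p * q) \<subseteq> cpoly_vars p \<union> cpoly_vars q"
proof
  fix v assume "v \<in> cpoly_vars (p * q)"
  then obtain m where m: "m \<in> Poly_Mapping.keys (p * q)" "v \<in> Poly_Mapping.keys m"
    by (auto simp: cpoly_vars_def)
  from m(1) keys_mult[of p q] obtain a b where
    "a \<in> Poly_Mapping.keys p" "b \<in> Poly_Mapping.keys q" "m = a + b" by blast
  with m(2) keys_add[of a b] show "v \<in> cpoly_vars p \<union> cpoly_vars q"
    unfolding cpoly_vars_def by blast
qed

text \<open>Genericity needs a polynomial in the matrix entries. The polynomials used here are built from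
  determinants, traces and adjugates; polynomial functions have closure properties that make this a
  routine composition, while the coefficients never matter.\<close>

definition polyfun :: "nat \<Rightarrow> (complex mat \<Rightarrow> complex) \<Rightarrow> bool" where
  "polyfun n f \<longleftrightarrow> (\<exists>p :: (nat \<times> nat) cpoly. cpoly_vars p \<subseteq> {..<n} \<times> {..<n} \<and>
     (\<forall>A\<in>carrier_mat n n. cpoly_eval (\<lambda>ij. A $$ ij) p = f A))"

lemma polyfun_const: "polyfun n (\<lambda>A. c)"
  unfolding polyfun_def
  by (rule exI[of _ "Poly_Mapping.single 0 c"]) (auto simp: cpoly_eval_single cpoly_vars_def)

lemma polyfun_coord: "i < n \<Longrightarrow> j < n \<Longrightarrow> polyfun n (\<lambda>A. A $$ (i, j))"
  unfolding polyfun_def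
  by (rule exI[of _ "Poly_Mapping.single (Poly_Mapping.single (i, j) 1) 1"])
     (auto simp: cpoly_eval_single cpoly_vars_def)

lemma polyfun_add: "polyfun n f \<Longrightarrow> polyfun n g \<Longrightarrow> polyfun n (\<lambda>A. f A + g A)"
proof -
  assume "polyfun n f" "polyfun n g"
  then obtain p q where "cpoly_vars p \<subseteq> {..<n} \<times> {..<n}" "cpoly_vars q \<subseteq> {..<n} \<times> {..<n}"
    "\<forall>A\<in>carrier_mat n n. cpoly_eval (\<lambda>ij. A $$ ij) p = f A"
    "\<forall>A\<in>carrier_mat n n. cpoly_eval (\<lambda>ij. A $$ ij) q = g A"
    unfolding polyfun_def by blast
  then show ?thesis
    unfolding polyfun_def using cpoly_vars_add[of p q]
    by (intro exI[of _ "p + q"]) (auto simp: cpoly_eval_add)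
qed

lemma polyfun_mult: "polyfun n f \<Longrightarrow> polyfun n g \<Longrightarrow> polyfun n (\<lambda>A. f A * g A)"
proof -
  assume "polyfun n f" "polyfun n g"
  then obtain p q where "cpoly_vars p \<subseteq> {..<n} \<times> {..<n}" "cpoly_vars q \<subseteq> {..<n} \<times> {..<n}"
    "\<forall>A\<in>carrier_mat n n. cpoly_eval (\<lambda>ij. A $$ ij) p = f A"
    "\<forall>A\<in>carrier_mat n n. cpoly_eval (\<lambda>ij. A $$ ij) q = g A"
    unfolding polyfun_def by blast
  then show ?thesis
    unfolding polyfun_def using cpoly_vars_mult[of p q]
    by (intro exI[of _ "p * q"]) (auto simp: cpoly_eval_mult)
qed

lemma polyfun_sum: "(\<And>i. i \<in> I \<Longrightarrow> polyfun n (f i)) \<Longrightarrow> polyfun n (\<lambda>A. \<Sum>i\<in>I. f i A)"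
  by (induction I rule: infinite_finite_induct) (simp_all add: polyfun_const polyfun_add)

lemma polyfun_prod: "(\<And>i. i \<in> I \<Longrightarrow> polyfun n (f i)) \<Longrightarrow> polyfun n (\<lambda>A. \<Prod>i\<in>I. f i A)"
  by (induction I rule: infinite_finite_induct) (simp_all add: polyfun_const polyfun_mult)

lemma polyfun_cong:
  "(\<And>A. A \<in> carrier_mat n n \<Longrightarrow> f A = g A) \<Longrightarrow> polyfun n f \<Longrightarrow> polyfun n g"
  unfolding polyfun_def by metis

definition polymat :: "nat \<Rightarrow> nat \<Rightarrow> (complex mat \<Rightarrow> complex mat) \<Rightarrow> bool" where
  "polymat n k M \<longleftrightarrow> (\<forall>A\<in>carrier_mat n n. M A \<in> carrier_mat k k) \<and>
     (\<forall>i<k. \<forall>j<k. polyfun n (\<lambda>A. M A $$ (i, j)))"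

lemma polymat_id: "polymat n n (\<lambda>A. A)"
  by (auto simp: polymat_def intro: polyfun_coord)

lemma polymat_const: "B \<in> carrier_mat k k \<Longrightarrow> polymat n k (\<lambda>A. B)"
  by (auto simp: polymat_def intro: polyfun_const)

lemma polymat_mat:
  assumes "\<And>i j. i < k \<Longrightarrow> j < k \<Longrightarrow> polyfun n (\<lambda>A. e i j A)"
  shows "polymat n k (\<lambda>A. mat k k (\<lambda>(i, j). e i j A))"
  using assms by (auto simp: polymat_def)

lemma polymat_cong:
  assumes "\<And>A. A \<in> carrier_mat n n \<Longrightarrow> M A = N A" "polymat n k M"
  shows "polymat n k N"
  unfolding polymat_def
proof (intro conjI ballI allI impI)
  show "N A \<in> carrier_mat k k" if "A \<in> carrier_mat n n" for A
    using assms that by (metis polymat_def)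
  fix i j assume "i < k" "j < k"
  with assms(2) have "polyfun n (\<lambda>A. M A $$ (i, j))" by (simp add: polymat_def)
  then show "polyfun n (\<lambda>A. N A $$ (i, j))" by (rule polyfun_cong[rotated]) (simp add: assms(1))
qed

lemma polymat_mult:
  assumes "polymat n k M" "polymat n k N" shows "polymat n k (\<lambda>A. M A * N A)"
proof (rule polymat_cong)
  show "polymat n k (\<lambda>A. mat k k (\<lambda>(i, j). \<Sum>l\<in>{0..<k}. M A $$ (i, l) * N A $$ (l, j)))"
    using assms unfolding polymat_def[of n k M] polymat_def[of n k N]
    by (intro polymat_mat polyfun_sum polyfun_mult) auto
  fix A :: "complex mat" assume "A \<in> carrier_mat n n"
  with assms have "M A \<in> carrier_mat k k" "N A \<in> carrier_mat k k" by (auto simp: polymat_def)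
  then show "mat k k (\<lambda>(i, j). \<Sum>l\<in>{0..<k}. M A $$ (i, l) * N A $$ (l, j)) = M A * N A"
    by (intro eq_matI) (auto simp: scalar_prod_def)
qed

lemma polymat_add:
  assumes "polymat n k M" "polymat n k N" shows "polymat n k (\<lambda>A. M A + N A)"
proof (rule polymat_cong)
  show "polymat n k (\<lambda>A. mat k k (\<lambda>(i, j). M A $$ (i, j) + N A $$ (i, j)))"
    using assms unfolding polymat_def[of n k M] polymat_def[of n k N]
    by (intro polymat_mat polyfun_add) auto
qed (use assms in \<open>auto simp: polymat_def intro!: eq_matI\<close>)

lemma polymat_smult:
  assumes "polymat n k M" shows "polymat n k (\<lambda>A. c \<cdot>\<^sub>m M A)"
proof (rule polymat_cong)
  show "polymat n k (\<lambda>A. mat k k (\<lambda>(i, j). c * M A $$ (i, j)))"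
    using assms unfolding polymat_def[of n k M]
    by (intro polymat_mat polyfun_mult polyfun_const) auto
qed (use assms in \<open>auto simp: polymat_def intro!: eq_matI\<close>)

lemma polymat_transpose:
  assumes "polymat n k M" shows "polymat n k (\<lambda>A. transpose_mat (M A))"
proof (rule polymat_cong)
  show "polymat n k (\<lambda>A. mat k k (\<lambda>(i, j). M A $$ (j, i)))"
    using assms by (intro polymat_mat) (auto simp: polymat_def)
qed (use assms in \<open>auto simp: polymat_def intro!: eq_matI\<close>)

lemma polymat_pow:
  assumes "polymat n k M" shows "polymat n k (\<lambda>A. M A ^\<^sub>m e)"
proof (induction e)
  case 0
  show ?case
    by (rule polymat_cong[OF _ polymat_const[of "1\<^sub>m k"]]) (use assms in \<open>auto simp: polymat_def\<close>)
next
  case (Suc e)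
  then show ?case using polymat_mult[OF Suc assms] by simp
qed

lemma polyfun_det:
  assumes "polymat n k M" shows "polyfun n (\<lambda>A. det (M A))"
proof (rule polyfun_cong)
  show "polyfun n (\<lambda>A. \<Sum>p\<in>{p. p permutes {0..<k}}. signof p * (\<Prod>i = 0..<k. M A $$ (i, p i)))"
    using assms unfolding polymat_def
    by (intro polyfun_sum polyfun_mult polyfun_prod polyfun_const) (auto simp: permutes_in_image)
  fix A :: "complex mat" assume "A \<in> carrier_mat n n"
  with assms show "(\<Sum>p\<in>{p. p permutes {0..<k}}. signof p * (\<Prod>i = 0..<k. M A $$ (i, p i))) = det (M A)"
    by (auto simp: polymat_def det_def)
qed

lemma polymat_adj:
  assumes "polymat n k M" shows "polymat n k (\<lambda>A. adj_mat (M A))"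
proof (rule polymat_cong)
  have *: "polymat n (k - 1) (\<lambda>A. mat_delete (M A) j i)" if "i < k" "j < k" for i j
  proof (rule polymat_cong)
    show "polymat n (k - 1) (\<lambda>A. mat (k - 1) (k - 1) (\<lambda>(i', j').
        M A $$ (if i' < j then i' else Suc i', if j' < i then j' else Suc j')))"
      using assms that by (intro polymat_mat) (auto simp: polymat_def)
    fix A :: "complex mat" assume "A \<in> carrier_mat n n"
    then have "M A \<in> carrier_mat k k" using assms by (auto simp: polymat_def)
    then show "mat (k - 1) (k - 1) (\<lambda>(i', j').
        M A $$ (if i' < j then i' else Suc i', if j' < i then j' else Suc j')) = mat_delete (M A) j i"
      by (auto simp: mat_delete_def)
  qed
  show "polymat n k (\<lambda>A. mat k k (\<lambda>(i, j). (-1) ^ (j + i) * det (mat_delete (M A) j i)))"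
    by (rule polymat_mat, rule polyfun_mult[OF polyfun_const polyfun_det[OF *]]) auto
  fix A :: "complex mat" assume "A \<in> carrier_mat n n"
  then have "M A \<in> carrier_mat k k" using assms by (auto simp: polymat_def)
  then show "mat k k (\<lambda>(i, j). (-1) ^ (j + i) * det (mat_delete (M A) j i)) = adj_mat (M A)"
    by (auto simp: adj_mat_def cofactor_def)
qed

definition mtrace :: "complex mat \<Rightarrow> complex" where
  "mtrace A = (\<Sum>i<dim_row A. A $$ (i, i))"

lemma polyfun_trace:
  assumes "polymat n k M" shows "polyfun n (\<lambda>A. mtrace (M A))"
proof (rule polyfun_cong)
  show "polyfun n (\<lambda>A. \<Sum>i<k. M A $$ (i, i))"
    using assms by (intro polyfun_sum) (auto simp: polymat_def)
qed (use assms in \<open>auto simp: polymat_def mtrace_def\<close>)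

text \<open>Composition with a polynomial map sends polynomial functions to polynomial functions.\<close>

lemma polyfun_eval:
  assumes "polyfun k f" "polymat n k M" shows "polyfun n (\<lambda>A. f (M A))"
proof -
  from assms(1) obtain p :: "(nat \<times> nat) cpoly" where
    p: "cpoly_vars p \<subseteq> {..<k} \<times> {..<k}" "\<forall>A\<in>carrier_mat k k. cpoly_eval (\<lambda>ij. A $$ ij) p = f A"
    by (auto simp: polyfun_def)
  have pow: "polyfun n (\<lambda>A. (M A $$ v) ^ e)" if "v \<in> {..<k} \<times> {..<k}" for v e
    using assms(2) that by (induction e) (auto simp: polymat_def polyfun_const polyfun_mult)
  have "polyfun n (\<lambda>A. cpoly_eval (\<lambda>ij. M A $$ ij) p)"
    unfolding cpoly_eval_def using p(1)
    by (intro polyfun_sum polyfun_mult polyfun_prod polyfun_const pow) (auto simp: cpoly_vars_def)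
  then show ?thesis
    by (rule polyfun_cong[rotated]) (use p(2) assms(2) in \<open>auto simp: polymat_def\<close>)
qed

section \<open>Genericity\<close>

lemma holds_generically_carrierI:
  assumes f: "polyfun n f" and w: "\<exists>A\<in>carrier_mat n n. f A \<noteq> 0"
    and Q: "\<And>A. A \<in> carrier_mat n n \<Longrightarrow> f A \<noteq> 0 \<Longrightarrow> Q A"
  shows "holds_generically n (carrier_mat n n) Q"
proof -
  from f obtain p where p: "cpoly_vars p \<subseteq> {..<n} \<times> {..<n}"
    "\<forall>A\<in>carrier_mat n n. cpoly_eval (\<lambda>ij. A $$ ij) p = f A" by (auto simp: polyfun_def)
  have "algebraic_subvariety n {A \<in> carrier_mat n n. f A = 0}"
    unfolding algebraic_subvariety_def
    by (rule exI[of _ "{p}"]) (use p in auto)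
  then show ?thesis unfolding holds_generically_def
    by (intro exI[of _ "{A \<in> carrier_mat n n. f A = 0}"]) (use w Q in auto)
qed

lemma holds_generically_DETI:
  assumes f: "polyfun n f" and w: "\<exists>A\<in>DET n. f A \<noteq> 0"
    and Q: "\<And>A. A \<in> DET n \<Longrightarrow> f A \<noteq> 0 \<Longrightarrow> Q A"
  shows "holds_generically n (DET n) Q"
proof -
  from f obtain p where p: "cpoly_vars p \<subseteq> {..<n} \<times> {..<n}"
    "\<forall>A\<in>carrier_mat n n. cpoly_eval (\<lambda>ij. A $$ ij) p = f A" by (auto simp: polyfun_def)
  have "polyfun n det" using polyfun_det[OF polymat_id] .
  then obtain d where d: "cpoly_vars d \<subseteq> {..<n} \<times> {..<n}"
    "\<forall>A\<in>carrier_mat n n. cpoly_eval (\<lambda>ij. A $$ ij) d = det A" by (auto simp: polyfun_def)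
  have "algebraic_subvariety n {A \<in> DET n. f A = 0}"
    unfolding algebraic_subvariety_def DET_def
    by (rule exI[of _ "{p, d}"]) (use p d in auto)
  then show ?thesis unfolding holds_generically_def
    by (intro exI[of _ "{A \<in> DET n. f A = 0}"]) (use w Q in auto)
qed

section \<open>Products of skew symmetric matrices\<close>

lemma skew_symmetric_matI:
  assumes "A \<in> carrier_mat n n" and "\<And>i j. i < n \<Longrightarrow> j < n \<Longrightarrow> A $$ (i, j) + A $$ (j, i) = 0"
  shows "skew_symmetric_mat n A"
  unfolding skew_symmetric_mat_def
proof
  show "A = - transpose_mat A"
    by (rule eq_matI) (use assms in \<open>auto simp: eq_neg_iff_add_eq_0\<close>)
qed (rule assms(1))

lemma product_of_skew_0: "product_of_skew_symmetric n 0 A \<longleftrightarrow> A = 1\<^sub>m n"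
  by (auto simp: product_of_skew_symmetric_def)

lemma product_of_skew_Suc:
  "product_of_skew_symmetric n (Suc r) A \<longleftrightarrow>
     (\<exists>S B. skew_symmetric_mat n S \<and> product_of_skew_symmetric n r B \<and> A = S * B)"
  unfolding product_of_skew_symmetric_def
  apply (auto simp: length_Suc_conv)
  subgoal by metis
  subgoal for S Ss by (rule exI[of _ "S # Ss"]) auto
  done

lemma product_of_skew_carrier: "product_of_skew_symmetric n r A \<Longrightarrow> A \<in> carrier_mat n n"
  by (induction r arbitrary: A)
     (auto simp: product_of_skew_0 product_of_skew_Suc skew_symmetric_mat_def)

lemma product_of_skew_single:
  "skew_symmetric_mat n S \<Longrightarrow> product_of_skew_symmetric n (Suc 0) S"
  unfolding product_of_skew_Suc product_of_skew_0
  by (rule exI[of _ S], rule exI[of _ "1\<^sub>m n"]) (auto simp: skew_symmetric_mat_def)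

lemma product_of_skew_mult:
  "product_of_skew_symmetric n r A \<Longrightarrow> product_of_skew_symmetric n s B \<Longrightarrow>
     product_of_skew_symmetric n (r + s) (A * B)"
proof (induction r arbitrary: A)
  case 0
  then show ?case using product_of_skew_carrier[OF 0(2)] by (auto simp: product_of_skew_0)
next
  case (Suc r)
  from Suc.prems(1) obtain S C where SC: "skew_symmetric_mat n S" "product_of_skew_symmetric n r C"
    "A = S * C" by (auto simp: product_of_skew_Suc)
  have "A * B = S * (C * B)"
    using SC product_of_skew_carrier[OF SC(2)] product_of_skew_carrier[OF Suc.prems(2)]
    by (simp add: skew_symmetric_mat_def assoc_mult_mat[of _ n n _ n _ n])
  with Suc.IH[OF SC(2) Suc.prems(2)] SC(1) show ?case
    unfolding add_Suc product_of_skew_Suc by blast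
qed

lemma skew_congruence:
  assumes "skew_symmetric_mat n S" "P \<in> carrier_mat n n"
  shows "skew_symmetric_mat n (P * S * transpose_mat P)"
proof -
  have S: "S \<in> carrier_mat n n" and ST: "transpose_mat S = - S"
    using assms(1) unfolding skew_symmetric_mat_def by (auto, metis Matrix.transpose_transpose transpose_uminus)
  have "transpose_mat (P * S * transpose_mat P) = P * (transpose_mat S * transpose_mat P)"
    using S assms(2) by (simp add: transpose_mult[of _ n n _ n])
  also have "\<dots> = - (P * S * transpose_mat P)"
    unfolding ST using S assms(2) by (simp add: assoc_mult_mat[of _ n n _ n _ n])
  finally show ?thesis using S assms(2) unfolding skew_symmetric_mat_def by simp
qed

text \<open>Between the factors one may insert \<open>P\<^sup>T (P\<^sup>T)\<^sup>-\<^sup>1\<close> and \<open>P\<^sup>-\<^sup>1 P\<close> alternately, so that the factors undergo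
  congruences by \<open>P\<close> and by its inverse transpose in turn. After the last factor the transformation
  left over is \<open>P\<^sup>T\<close> or \<open>P\<^sup>-\<^sup>1\<close> according to the parity of the number of factors: odd products
  are preserved by congruence, even products by similarity.\<close>

lemma product_of_skew_transform:
  assumes "product_of_skew_symmetric n r A"
    and "P \<in> carrier_mat n n" "Q \<in> carrier_mat n n" "P * Q = 1\<^sub>m n" "Q * P = 1\<^sub>m n"
  shows "product_of_skew_symmetric n r (P * A * (if even r then Q else transpose_mat P))"
  using assms
proof (induction r arbitrary: A P Q)
  case 0
  then show ?case by (simp add: product_of_skew_0)
next
  case (Suc r)
  from Suc.prems(1) obtain S B where SB: "skew_symmetric_mat n S" "product_of_skew_symmetric n r B"
    "A = S * B" by (auto simp: product_of_skew_Suc)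
  note car = product_of_skew_carrier[OF SB(2)] Suc.prems(2,3) SB(1)[unfolded skew_symmetric_mat_def, THEN conjunct1]
  let ?P = "transpose_mat P" and ?Q = "transpose_mat Q"
  have PQ: "?P * ?Q = 1\<^sub>m n" "?Q * ?P = 1\<^sub>m n"
    using Suc.prems by (metis transpose_mult transpose_one)+
  have IH: "product_of_skew_symmetric n r (?Q * B * (if even r then ?P else Q))"
    using Suc.IH[OF SB(2), of ?Q ?P] car PQ by auto
  define R where "R = (if even r then ?P else Q)"
  have R: "R \<in> carrier_mat n n" using car by (auto simp: R_def)
  note IH = IH[folded R_def]
  have canc: "?P * (?Q * X) = X" if "X \<in> carrier_mat n n" for X
    using that car PQ(1) assoc_mult_mat[of ?P n n ?Q n X n] by simp
  have "(P * S * ?P) * (?Q * B * R) = P * A * R"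
    unfolding SB(3) using car R
    by (simp add: assoc_mult_mat[of _ n n _ n _ n] canc)
  moreover have "skew_symmetric_mat n (P * S * ?P)" using skew_congruence[OF SB(1)] car by simp
  ultimately have "product_of_skew_symmetric n (Suc r) (P * A * R)"
    unfolding product_of_skew_Suc using IH by metis
  moreover have "R = (if even (Suc r) then Q else ?P)" by (simp add: R_def)
  ultimately show ?case by simp
qed

lemma product_of_skew_congruence:
  assumes "product_of_skew_symmetric n r A" "odd r"
    and "P \<in> carrier_mat n n" "Q \<in> carrier_mat n n" "P * Q = 1\<^sub>m n" "Q * P = 1\<^sub>m n"
  shows "product_of_skew_symmetric n r (P * A * transpose_mat P)"
  using product_of_skew_transform[OF assms(1,3-6)] assms(2) by simp

lemma product_of_skew_similar:
  assumes "product_of_skew_symmetric n r A" "even r"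
    and "P \<in> carrier_mat n n" "Q \<in> carrier_mat n n" "P * Q = 1\<^sub>m n" "Q * P = 1\<^sub>m n"
  shows "product_of_skew_symmetric n r (P * A * Q)"
  using product_of_skew_transform[OF assms(1,3-6)] assms(2) by simp

definition dmat :: "nat \<Rightarrow> (nat \<Rightarrow> complex) \<Rightarrow> complex mat" where
  "dmat n d = mat n n (\<lambda>(i, j). if i = j then d i else 0)"

lemma dmat_carrier [simp]: "dmat n d \<in> carrier_mat n n"
  and dmat_dim [simp]: "dim_row (dmat n d) = n" "dim_col (dmat n d) = n"
  and dmat_index [simp]: "i < n \<Longrightarrow> j < n \<Longrightarrow> dmat n d $$ (i, j) = (if i = j then d i else 0)"
  by (auto simp: dmat_def)

lemma mult_dmat_index:
  assumes "M \<in> carrier_mat n n" "i < n" "j < n"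
  shows "(M * dmat n d) $$ (i, j) = M $$ (i, j) * d j"
  using assms by (simp add: scalar_prod_def sum.delta if_distrib cong: if_cong)

lemma dmat_mult_index:
  assumes "M \<in> carrier_mat n n" "i < n" "j < n"
  shows "(dmat n d * M) $$ (i, j) = d i * M $$ (i, j)"
  using assms by (simp add: scalar_prod_def sum.delta if_distrib if_distribR cong: if_cong)

lemma dmat_mult: "dmat n d * dmat n e = dmat n (\<lambda>i. d i * e i)"
  by (rule eq_matI) (auto simp: mult_dmat_index[OF dmat_carrier] simp del: index_mult_mat(1))

lemma dmat_1: "dmat n (\<lambda>i. 1) = 1\<^sub>m n"
  by (rule eq_matI) auto

lemma dmat_pow: "dmat n d ^\<^sub>m k = dmat n (\<lambda>i. d i ^ k)"
  by (induction k) (auto simp: dmat_1 dmat_mult mult.commute)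

text \<open>Let \<open>S\<close> be the signed permutation matrix of \<open>\<sigma>\<close>, which is skew symmetric with \<open>S S = - I\<close>. As \<open>d\<close> is
  constant on the orbits of \<open>\<sigma>\<close>, also \<open>- S D\<close> is skew symmetric, and \<open>D = S (- S D)\<close>.\<close>

lemma paired_diagonal_product_of_two_skew:
  assumes "\<And>i. i < n \<Longrightarrow> \<sigma> i < n \<and> \<sigma> i \<noteq> i \<and> \<sigma> (\<sigma> i) = i \<and> d (\<sigma> i) = d i"
  shows "product_of_skew_symmetric n 2 (dmat n d)"
proof -
  define s :: "nat \<Rightarrow> nat \<Rightarrow> complex" where "s i j = (if j = \<sigma> i then if i < j then 1 else -1 else 0)" for i j
  have s: "s i j = - s j i" if "i < n" "j < n" for i j
    using assms[of i] assms[of j] that by (auto simp: s_def)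
  define S where "S = mat n n (\<lambda>(i, j). s i j)"
  define T where "T = mat n n (\<lambda>(i, j). - s i j * d j)"
  have S: "skew_symmetric_mat n S"
    by (rule skew_symmetric_matI) (use s in \<open>auto simp: S_def eq_neg_iff_add_eq_0\<close>)
  have "- s i j * d j + (- s j i * d i) = 0" if "i < n" "j < n" for i j
    using assms[of i] assms[of j] that by (cases "j = \<sigma> i") (auto simp: s_def)
  then have T: "skew_symmetric_mat n T"
    by (intro skew_symmetric_matI) (simp_all add: T_def del: minus_mult_left[symmetric] mult_minus_left)
  have "S * T = dmat n d"
  proof (rule eq_matI)
    fix i j assume "i < dim_row (dmat n d)" "j < dim_col (dmat n d)"
    then have ij: "i < n" "j < n" by auto
    have "(S * T) $$ (i, j) = (\<Sum>k = 0..<n. s i k * (- s k j * d j))"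
      using ij by (simp add: S_def T_def scalar_prod_def)
    also have "\<dots> = (\<Sum>k = 0..<n. if k = \<sigma> i then s i (\<sigma> i) * (- s (\<sigma> i) j * d j) else 0)"
      by (rule sum.cong) (auto simp: s_def)
    also have "\<dots> = s i (\<sigma> i) * (- s (\<sigma> i) j * d j)"
      using assms[OF ij(1)] by simp
    also have "\<dots> = dmat n d $$ (i, j)"
      using assms[OF ij(1)] ij by (auto simp: s_def)
    finally show "(S * T) $$ (i, j) = dmat n d $$ (i, j)" .
  qed (auto simp: S_def T_def)
  with product_of_skew_mult[OF product_of_skew_single[OF S] product_of_skew_single[OF T]]
  show ?thesis by (simp add: numeral_2_eq_2)
qed

section \<open>Simultaneous diagonalization of a matrix pencil\<close>

lemma right_inverse_exists:
  fixes A :: "complex mat"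
  assumes "A \<in> carrier_mat n n" "det A \<noteq> 0"
  obtains B where "B \<in> carrier_mat n n" "A * B = 1\<^sub>m n" "B * A = 1\<^sub>m n"
  using det_non_zero_imp_unit[OF assms, of "()"]
  unfolding Units_def ring_mat_def by auto

lemma cancel_inverse:
  fixes P :: "complex mat"
  assumes "P \<in> carrier_mat n n" "Q \<in> carrier_mat n n" "P * Q = 1\<^sub>m n" "X \<in> carrier_mat n k"
  shows "P * (Q * X) = X"
  using assms assoc_mult_mat[of P n n Q n X k] by simp

lemma pencil_kernel_vector:
  fixes A B :: "complex mat"
  assumes "A \<in> carrier_mat n n" "B \<in> carrier_mat n n"
  shows "det (A - h \<cdot>\<^sub>m B) = 0 \<longleftrightarrow>
    (\<exists>v\<in>carrier_vec n. v \<noteq> 0\<^sub>v n \<and> A *\<^sub>v v = h \<cdot>\<^sub>v (B *\<^sub>v v))"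
proof -
  have C: "A - h \<cdot>\<^sub>m B \<in> carrier_mat n n" using assms by (simp add: minus_carrier_mat)
  have eq: "(A - h \<cdot>\<^sub>m B) *\<^sub>v v = A *\<^sub>v v - h \<cdot>\<^sub>v (B *\<^sub>v v)" if "v \<in> carrier_vec n" for v
    using that assms by (intro eq_vecI) (auto simp: scalar_prod_def algebra_simps sum_subtractf sum_distrib_left)
  have "A *\<^sub>v v - h \<cdot>\<^sub>v (B *\<^sub>v v) = 0\<^sub>v n \<longleftrightarrow> A *\<^sub>v v = h \<cdot>\<^sub>v (B *\<^sub>v v)" for v
    using assms by (auto simp: vec_eq_iff)
  with det_0_iff_vec_prod_zero[OF C] eq show ?thesis by auto
qed

text \<open>Kernel vectors of the pencil at distinct roots are linearly independent: a linear relation between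
  them stays one when its coefficients are multiplied by the values of a polynomial at the roots, and a
  Lagrange polynomial isolates a single vector.\<close>

lemma pencil_eigenbasis:
  fixes A B :: "complex mat"
  assumes A: "A \<in> carrier_mat n n" and B: "B \<in> carrier_mat n n" "det B \<noteq> 0"
    and inj: "inj_on h {..<n}" and root: "\<And>i. i < n \<Longrightarrow> det (A - h i \<cdot>\<^sub>m B) = 0"
  obtains P Q where "P \<in> carrier_mat n n" "Q \<in> carrier_mat n n" "P * Q = 1\<^sub>m n" "Q * P = 1\<^sub>m n"
    "A * P = B * P * dmat n h"
proof -
  have "\<forall>i. \<exists>v. i < n \<longrightarrow> v \<in> carrier_vec n \<and> v \<noteq> 0\<^sub>v n \<and> A *\<^sub>v v = h i \<cdot>\<^sub>v (B *\<^sub>v v)"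
    using root pencil_kernel_vector[OF A B(1)] by blast
  then obtain v where v: "\<And>i. i < n \<Longrightarrow> v i \<in> carrier_vec n"
      "\<And>i. i < n \<Longrightarrow> v i \<noteq> 0\<^sub>v n" "\<And>i. i < n \<Longrightarrow> A *\<^sub>v v i = h i \<cdot>\<^sub>v (B *\<^sub>v v i)"
    by metis
  define P where "P = mat n n (\<lambda>(i, j). v j $ i)"
  have P: "P \<in> carrier_mat n n" by (simp add: P_def)
  have colP: "col P j = v j" if "j < n" for j
    using v(1)[OF that] that by (intro eq_vecI) (auto simp: P_def)
  have AP: "A * P = B * P * dmat n h"
  proof (rule eq_matI)
    fix i j assume "i < dim_row (B * P * dmat n h)" "j < dim_col (B * P * dmat n h)"
    then have ij: "i < n" "j < n" using B by auto
    have "(A * P) $$ (i, j) = (A *\<^sub>v v j) $ i" using ij A P colP by simp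
    also have "\<dots> = h j * (B *\<^sub>v v j) $ i" using ij v(3) B by simp
    also have "\<dots> = (B * P * dmat n h) $$ (i, j)"
      using ij B P colP by (subst mult_dmat_index) auto
    finally show "(A * P) $$ (i, j) = (B * P * dmat n h) $$ (i, j)" .
  qed (use A B P in auto)
  have "det P \<noteq> 0"
  proof
    assume "det P = 0"
    then obtain c where c: "c \<in> carrier_vec n" "c \<noteq> 0\<^sub>v n" "P *\<^sub>v c = 0\<^sub>v n"
      using det_0_iff_vec_prod_zero[OF P] by blast
    have Binj: "w = 0\<^sub>v n" if "w \<in> carrier_vec n" "B *\<^sub>v w = 0\<^sub>v n" for w
      using that det_0_iff_vec_prod_zero[OF B(1)] B(2) by blast
    \<comment> \<open>The kernel of \<open>P\<close> is stable under the diagonal matrix, hence under all polynomials in it.\<close>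
    have stable: "P *\<^sub>v (dmat n h *\<^sub>v w) = 0\<^sub>v n" if w: "w \<in> carrier_vec n" "P *\<^sub>v w = 0\<^sub>v n" for w
    proof (rule Binj)
      have "B *\<^sub>v (P *\<^sub>v (dmat n h *\<^sub>v w)) = (B * P * dmat n h) *\<^sub>v w"
        using B P w mult_mat_vec_carrier[of "dmat n h" n n w] by (simp add: assoc_mult_mat_vec[of _ n n _ n])
      also have "\<dots> = A *\<^sub>v (P *\<^sub>v w)"
        unfolding AP[symmetric] using A P w by (simp add: assoc_mult_mat_vec[of _ n n _ n])
      also have "\<dots> = 0\<^sub>v n" using A w by (auto simp: vec_eq_iff scalar_prod_def)
      finally show "B *\<^sub>v (P *\<^sub>v (dmat n h *\<^sub>v w)) = 0\<^sub>v n" .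
    qed (use P w in \<open>auto intro!: mult_mat_vec_carrier[of _ n n]\<close>)
    have poly: "P *\<^sub>v vec n (\<lambda>i. poly f (h i) * c $ i) = 0\<^sub>v n" for f
    proof (induction f)
      case 0
      then show ?case using P by (auto simp: vec_eq_iff scalar_prod_def)
    next
      case (pCons a f)
      let ?w = "vec n (\<lambda>i. poly f (h i) * c $ i)"
      have "vec n (\<lambda>i. poly (pCons a f) (h i) * c $ i) = a \<cdot>\<^sub>v c + dmat n h *\<^sub>v ?w"
        using c(1) by (intro eq_vecI)
          (auto simp: algebra_simps scalar_prod_def if_distrib if_distribR sum.delta cong: if_cong)
      moreover have "P *\<^sub>v (a \<cdot>\<^sub>v c + dmat n h *\<^sub>v ?w) = a \<cdot>\<^sub>v (P *\<^sub>v c) + P *\<^sub>v (dmat n h *\<^sub>v ?w)"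
        using P c(1) by (subst mult_add_distrib_mat_vec[of _ n n])
          (auto simp: mult_mat_vec intro!: mult_mat_vec_carrier[of _ n n])
      ultimately have "P *\<^sub>v vec n (\<lambda>i. poly (pCons a f) (h i) * c $ i) =
          a \<cdot>\<^sub>v (P *\<^sub>v c) + P *\<^sub>v (dmat n h *\<^sub>v ?w)" by (simp only:)
      also have "P *\<^sub>v (dmat n h *\<^sub>v ?w) = 0\<^sub>v n" by (rule stable[OF _ pCons(2)]) simp
      also have "a \<cdot>\<^sub>v (P *\<^sub>v c) + 0\<^sub>v n = 0\<^sub>v n" unfolding c(3) by auto
      finally show ?case .
    qed
    obtain k where k: "k < n" "c $ k \<noteq> 0" using c(1,2) by (auto simp: vec_eq_iff)
    define f where "f = (\<Prod>j\<in>{..<n} - {k}. [:- h j, 1:])"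
    have f0: "poly f (h j) = 0" if "j < n" "j \<noteq> k" for j
      using that by (auto simp: f_def poly_prod)
    have fk: "poly f (h k) \<noteq> 0"
      using inj k(1) by (auto simp: f_def poly_prod inj_on_def)
    have "v k $ i = 0" if "i < n" for i
    proof -
      have "0 = (P *\<^sub>v vec n (\<lambda>i. poly f (h i) * c $ i)) $ i" using poly that by simp
      also have "\<dots> = (\<Sum>j = 0..<n. v j $ i * (poly f (h j) * c $ j))"
        using that P by (simp add: scalar_prod_def P_def)
      also have "\<dots> = (\<Sum>j = 0..<n. if j = k then v k $ i * (poly f (h k) * c $ k) else 0)"
        using f0 by (intro sum.cong) auto
      finally show ?thesis using k fk by simp
    qed
    then have "v k = 0\<^sub>v n" using v(1)[OF k(1)] by (auto simp: vec_eq_iff)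
    with v(2)[OF k(1)] show False by simp
  qed
  from right_inverse_exists[OF P this] AP P that show ?thesis by metis
qed

lemma similar_if_common_eigenvalues:
  fixes A B :: "complex mat"
  assumes A: "A \<in> carrier_mat n n" and B: "B \<in> carrier_mat n n" and inj: "inj_on h {..<n}"
    and "\<And>i. i < n \<Longrightarrow> det (A - h i \<cdot>\<^sub>m 1\<^sub>m n) = 0" "\<And>i. i < n \<Longrightarrow> det (B - h i \<cdot>\<^sub>m 1\<^sub>m n) = 0"
  obtains P Q where "P \<in> carrier_mat n n" "Q \<in> carrier_mat n n" "P * Q = 1\<^sub>m n" "Q * P = 1\<^sub>m n"
    "A = P * B * Q"
proof -
  obtain P1 Q1 where 1: "P1 \<in> carrier_mat n n" "Q1 \<in> carrier_mat n n" "P1 * Q1 = 1\<^sub>m n"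
    "Q1 * P1 = 1\<^sub>m n" "A * P1 = 1\<^sub>m n * P1 * dmat n h"
    using pencil_eigenbasis[OF A one_carrier_mat _ inj assms(4)] by auto
  obtain P2 Q2 where 2: "P2 \<in> carrier_mat n n" "Q2 \<in> carrier_mat n n" "P2 * Q2 = 1\<^sub>m n"
    "Q2 * P2 = 1\<^sub>m n" "B * P2 = 1\<^sub>m n * P2 * dmat n h"
    using pencil_eigenbasis[OF B one_carrier_mat _ inj assms(5)] by auto
  have "A = A * (P1 * Q1)" using A 1(3) by simp
  also have "\<dots> = A * P1 * Q1" using A 1(1,2) by (simp add: assoc_mult_mat[of _ n n _ n _ n])
  also have "\<dots> = P1 * dmat n h * Q1" using 1 by simp
  also have "dmat n h = Q2 * (B * P2)" using 2 cancel_inverse[OF 2(2,1,4), of "dmat n h" n] by simp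
  finally have "A = P1 * (Q2 * (B * P2)) * Q1" .
  also have "\<dots> = P1 * Q2 * B * (P2 * Q1)"
    using 1(1,2) 2(1,2) B by (simp add: assoc_mult_mat[of _ n n _ n _ n])
  finally have "A = \<dots>" .
  moreover have "P1 * Q2 * (P2 * Q1) = 1\<^sub>m n" "P2 * Q1 * (P1 * Q2) = 1\<^sub>m n"
    using 1(1-4) 2(1-4) by (simp_all add: assoc_mult_mat[of _ n n _ n _ n]
        cancel_inverse[OF 2(2,1,4)] cancel_inverse[OF 1(2,1,4)])
  ultimately show ?thesis using that[of "P1 * Q2" "P2 * Q1"] 1 2 by simp
qed

section \<open>Congruence of matrices with the same cosquare spectrum\<close>

text \<open>In a basis of eigenvectors of the cosquare the matrix \<open>G\<close> of the bilinear form satisfies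
  \<open>G = G\<^sup>T D\<close>. Reading this entry by entry twice shows that \<open>G\<close> is supported on pairs of reciprocal
  eigenvalues.\<close>

lemma congruence_diagonalizes_cosquare:
  fixes A :: "complex mat"
  assumes A: "A \<in> carrier_mat n n" "det A \<noteq> 0" and inj: "inj_on h {..<n}"
    and root: "\<And>i. i < n \<Longrightarrow> det (A - h i \<cdot>\<^sub>m transpose_mat A) = 0"
  obtains P Q where "P \<in> carrier_mat n n" "Q \<in> carrier_mat n n" "P * Q = 1\<^sub>m n" "Q * P = 1\<^sub>m n"
    "\<And>i j. i < n \<Longrightarrow> j < n \<Longrightarrow>
       (transpose_mat P * A * P) $$ (i, j) = h j * (transpose_mat P * A * P) $$ (j, i)"
    "\<And>i. i < n \<Longrightarrow> \<exists>j<n. (transpose_mat P * A * P) $$ (i, j) \<noteq> 0"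
proof -
  have AT: "transpose_mat A \<in> carrier_mat n n" "det (transpose_mat A) \<noteq> 0"
    using A det_transpose[OF A(1)] by auto
  obtain P Q where P: "P \<in> carrier_mat n n" "Q \<in> carrier_mat n n" "P * Q = 1\<^sub>m n" "Q * P = 1\<^sub>m n"
    "A * P = transpose_mat A * P * dmat n h"
    using pencil_eigenbasis[OF A(1) AT inj root] by metis
  let ?P = "transpose_mat P" and ?Q = "transpose_mat Q"
  define G where "G = ?P * A * P"
  have G: "G \<in> carrier_mat n n" using P(1,2) A by (simp add: G_def)
  have "G = ?P * (A * P)" using P A by (simp add: G_def assoc_mult_mat[of _ n n _ n _ n])
  also have "\<dots> = ?P * transpose_mat A * P * dmat n h"
    unfolding P(5) using P(1,2) A AT by (simp add: assoc_mult_mat[of _ n n _ n _ n])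
  also have "?P * transpose_mat A * P = transpose_mat G"
    using P(1,2) A by (simp add: G_def transpose_mult[of _ n n _ n] assoc_mult_mat[of _ n n _ n _ n])
  finally have GT: "G = transpose_mat G * dmat n h" .
  have sym: "G $$ (i, j) = h j * G $$ (j, i)" if "i < n" "j < n" for i j
    using arg_cong[OF GT, of "\<lambda>M. M $$ (i, j)"] that G
    by (subst (asm) mult_dmat_index[of _ n]) auto
  have "\<exists>j<n. G $$ (i, j) \<noteq> 0" if i: "i < n" for i
  proof (rule ccontr)
    assume "\<not> ?thesis"
    then have "row G i = 0\<^sub>v n" using i G by (intro eq_vecI) auto
    then have "transpose_mat G *\<^sub>v unit_vec n i = 0\<^sub>v n"
      using i G by (intro eq_vecI) (auto simp: vec_eq_iff)
    moreover have "unit_vec n i \<noteq> (0\<^sub>v n :: complex vec)" using i by (auto simp: vec_eq_iff)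
    ultimately have "det (transpose_mat G) = 0"
      using det_0_iff_vec_prod_zero[of "transpose_mat G" n] G unit_vec_carrier by (metis transpose_carrier_mat)
    moreover have "det (transpose_mat G) = det P * det A * det P"
      unfolding det_transpose[OF G] unfolding G_def
      using P(1,2) A by (simp add: det_transpose det_mult[of _ n] del: assoc_mult_mat)
    moreover have "det P \<noteq> 0" using P det_mult[OF P(1,2)] by auto
    ultimately show False using A by simp
  qed
  with sym P that show ?thesis unfolding G_def by blast
qed

text \<open>In eigenbases of their cosquares both forms are monomial matrices with the same support, that of the
  involution \<open>\<sigma>\<close> pairing an eigenvalue with its reciprocal. A diagonal congruence \<open>E\<close> takes one
  to the other as soon as \<open>e\<^sub>i e\<^sub>\<sigma>\<^sub>i\<close> is the quotient \<open>\<rho>\<^sub>i\<close> of the entries, and this can be solved because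
  \<open>\<rho>\<close> is invariant under \<open>\<sigma>\<close>.\<close>

lemma congruent_if_common_cosquare_spectrum:
  fixes A B :: "complex mat"
  assumes A: "A \<in> carrier_mat n n" "det A \<noteq> 0" and B: "B \<in> carrier_mat n n" "det B \<noteq> 0"
    and inj: "inj_on h {..<n}"
    and rA: "\<And>i. i < n \<Longrightarrow> det (A - h i \<cdot>\<^sub>m transpose_mat A) = 0"
    and rB: "\<And>i. i < n \<Longrightarrow> det (B - h i \<cdot>\<^sub>m transpose_mat B) = 0"
  obtains P Q where "P \<in> carrier_mat n n" "Q \<in> carrier_mat n n" "P * Q = 1\<^sub>m n" "Q * P = 1\<^sub>m n"
    "B = P * A * transpose_mat P"
proof -
  obtain P1 Q1 where P1: "P1 \<in> carrier_mat n n" "Q1 \<in> carrier_mat n n" "P1 * Q1 = 1\<^sub>m n" "Q1 * P1 = 1\<^sub>m n"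
    "\<And>i j. i < n \<Longrightarrow> j < n \<Longrightarrow>
       (transpose_mat P1 * A * P1) $$ (i, j) = h j * (transpose_mat P1 * A * P1) $$ (j, i)"
    "\<And>i. i < n \<Longrightarrow> \<exists>j<n. (transpose_mat P1 * A * P1) $$ (i, j) \<noteq> 0"
    using congruence_diagonalizes_cosquare[OF A inj rA] by metis
  obtain P2 Q2 where P2: "P2 \<in> carrier_mat n n" "Q2 \<in> carrier_mat n n" "P2 * Q2 = 1\<^sub>m n" "Q2 * P2 = 1\<^sub>m n"
    "\<And>i j. i < n \<Longrightarrow> j < n \<Longrightarrow>
       (transpose_mat P2 * B * P2) $$ (i, j) = h j * (transpose_mat P2 * B * P2) $$ (j, i)"
    "\<And>i. i < n \<Longrightarrow> \<exists>j<n. (transpose_mat P2 * B * P2) $$ (i, j) \<noteq> 0"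
    using congruence_diagonalizes_cosquare[OF B inj rB] by metis
  define G where "G = transpose_mat P1 * A * P1"
  define K where "K = transpose_mat P2 * B * P2"
  note G = P1(5,6)[folded G_def] and K = P2(5,6)[folded K_def]
  have Gc: "G \<in> carrier_mat n n" and Kc: "K \<in> carrier_mat n n"
    using A B P1 P2 by (simp_all add: G_def K_def)
  have supp: "h i * h j = 1" if "i < n" "j < n" "M $$ (i, j) \<noteq> 0"
    and "\<And>i j. i < n \<Longrightarrow> j < n \<Longrightarrow> M $$ (i, j) = h j * M $$ (j, i)" for M :: "complex mat" and i j
  proof -
    have "M $$ (i, j) = h j * (h i * M $$ (i, j))" using that by metis
    with that(3) show ?thesis by (simp add: mult.commute)
  qed
  obtain \<sigma> where \<sigma>: "\<And>i. i < n \<Longrightarrow> \<sigma> i < n" "\<And>i. i < n \<Longrightarrow> G $$ (i, \<sigma> i) \<noteq> 0"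
    using G(2) by metis
  have h\<sigma>: "h i * h (\<sigma> i) = 1" if "i < n" for i using supp[of i "\<sigma> i" G] \<sigma> G(1) that by blast
  have uniq: "j = \<sigma> i" if "i < n" "j < n" "h i * h j = 1" for i j
  proof -
    have "h i * h j = h i * h (\<sigma> i)" using h\<sigma> that by simp
    moreover have "h i \<noteq> 0" using that(3) by auto
    ultimately have "h j = h (\<sigma> i)" by simp
    with inj that(2) \<sigma>(1)[OF that(1)] show ?thesis by (auto simp: inj_on_def)
  qed
  have \<sigma>\<sigma>: "\<sigma> (\<sigma> i) = i" if "i < n" for i
    using uniq[of "\<sigma> i" i] h\<sigma>[OF that] \<sigma>(1) that by (simp add: mult.commute)
  have K\<sigma>: "K $$ (i, \<sigma> i) \<noteq> 0" if "i < n" for i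
    using K(2)[OF that] uniq[OF that] supp[OF that _ _ K(1)] by metis
  have G0: "G $$ (i, j) = 0" and K0: "K $$ (i, j) = 0" if "i < n" "j < n" "j \<noteq> \<sigma> i" for i j
    using uniq[OF that(1,2)] supp[OF that(1,2) _ G(1)] supp[OF that(1,2) _ K(1)] that(3) by blast+
  define \<rho> where "\<rho> i = K $$ (i, \<sigma> i) / G $$ (i, \<sigma> i)" for i
  have \<rho>\<sigma>: "\<rho> (\<sigma> i) = \<rho> i" if "i < n" for i
  proof -
    have "h i \<noteq> 0" using h\<sigma>[OF that] by auto
    then show ?thesis
      using G(1)[OF \<sigma>(1)[OF that] that] K(1)[OF \<sigma>(1)[OF that] that] by (simp add: \<rho>_def \<sigma>\<sigma> that)
  qed
  have \<rho>0: "\<rho> i \<noteq> 0" if "i < n" for i using \<sigma>(2) K\<sigma> that by (simp add: \<rho>_def)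
  \<comment> \<open>At a fixed point of \<open>\<sigma>\<close> a square root is needed; otherwise one member of the orbit takes all of \<open>\<rho>\<close>.\<close>
  define e where "e i = (if \<sigma> i = i then csqrt (\<rho> i) else if i < \<sigma> i then \<rho> i else 1)" for i
  have e\<sigma>: "e i * e (\<sigma> i) = \<rho> i" if "i < n" for i
    using that \<sigma>\<sigma>[OF that] \<rho>\<sigma>[OF that] power2_csqrt[of "\<rho> i"]
    by (auto simp: e_def power2_eq_square)
  have e0: "e i \<noteq> 0" if "i < n" for i using e\<sigma> \<rho>0 that by fastforce
  have KG: "K = dmat n e * G * dmat n e"
  proof (rule eq_matI)
    fix i j assume "i < dim_row (dmat n e * G * dmat n e)" "j < dim_col (dmat n e * G * dmat n e)"
    then have ij: "i < n" "j < n" by auto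
    have "(dmat n e * G * dmat n e) $$ (i, j) = e i * G $$ (i, j) * e j"
      using ij Gc mult_carrier_mat[OF dmat_carrier Gc, of e]
      by (simp del: index_mult_mat(1) add: mult_dmat_index[of _ n] dmat_mult_index)
    also have "\<dots> = K $$ (i, j)"
    proof (cases "j = \<sigma> i")
      case True
      have "e i * G $$ (i, j) * e j = (e i * e (\<sigma> i)) * G $$ (i, \<sigma> i)" by (simp add: True)
      also have "\<dots> = K $$ (i, j)" using e\<sigma>[OF ij(1)] \<sigma>(2)[OF ij(1)] by (simp add: True \<rho>_def)
      finally show ?thesis .
    next
      case False then show ?thesis using G0 K0 ij by simp
    qed
    finally show "K $$ (i, j) = (dmat n e * G * dmat n e) $$ (i, j)" by simp
  qed (use Gc Kc in auto)
  let ?e' = "dmat n (\<lambda>i. inverse (e i))"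
  have ee: "dmat n e * ?e' = 1\<^sub>m n" "?e' * dmat n e = 1\<^sub>m n"
    using e0 by (auto simp: dmat_mult mat_eq_iff)
  let ?T = transpose_mat
  have T2: "?T P2 * ?T Q2 = 1\<^sub>m n" "?T Q2 * ?T P2 = 1\<^sub>m n" "?T P1 * ?T Q1 = 1\<^sub>m n" "?T Q1 * ?T P1 = 1\<^sub>m n"
    using P1(1-4) P2(1-4) by (metis transpose_mult transpose_one)+
  have de: "?T (dmat n e) = dmat n e" by (rule eq_matI) auto
  define P where "P = ?T Q2 * dmat n e * ?T P1"
  define Q where "Q = ?T Q1 * ?e' * ?T P2"
  have "B = ?T Q2 * (?T P2 * B * P2) * Q2"
    using B(1) P2(1-4) T2 by (simp add: assoc_mult_mat[of _ n n _ n _ n] cancel_inverse[of _ n _ _ n])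
  also have "?T P2 * B * P2 = dmat n e * (?T P1 * A * P1) * dmat n e"
    using KG unfolding K_def G_def .
  finally have BE: "B = ?T Q2 * (dmat n e * (?T P1 * A * P1) * dmat n e) * Q2" .
  have "?T Q2 * (E * (?T P1 * A * P1) * E) * Q2 = ?T Q2 * E * ?T P1 * A * ?T (?T Q2 * E * ?T P1)"
    if "E \<in> carrier_mat n n" "?T E = E" for E
    using A(1) P1(1) P2(2) that
    by (simp add: assoc_mult_mat[of _ n n _ n _ n] transpose_mult[of _ n n _ n])
  from this[OF dmat_carrier de]
  have "?T Q2 * (dmat n e * (?T P1 * A * P1) * dmat n e) * Q2 = P * A * ?T P" unfolding P_def .
  with BE have "B = P * A * ?T P" by simp
  moreover have "P \<in> carrier_mat n n" "Q \<in> carrier_mat n n"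
    unfolding P_def Q_def using P1(1,2) P2(1,2)
    by (auto intro!: mult_carrier_mat[of _ n n _ n] simp del: assoc_mult_mat)
  moreover have "P * Q = 1\<^sub>m n \<and> Q * P = 1\<^sub>m n"
  proof -
    have inv: "?T Q2 * E * ?T P1 * (?T Q1 * F * ?T P2) = 1\<^sub>m n"
      "?T Q1 * F * ?T P2 * (?T Q2 * E * ?T P1) = 1\<^sub>m n"
    if "E \<in> carrier_mat n n" "F \<in> carrier_mat n n" "E * F = 1\<^sub>m n" "F * E = 1\<^sub>m n" for E F
    using P1(1-4) P2(1-4) T2 that
    by (simp_all add: assoc_mult_mat[of _ n n _ n _ n] cancel_inverse[of _ n _ _ n])
    show ?thesis unfolding P_def Q_def using inv[OF dmat_carrier dmat_carrier ee] ..
  qed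
  ultimately show ?thesis using that by blast
qed

section \<open>A polynomial detecting distinct eigenvalues\<close>

lemma mtrace_mult_commute:
  assumes "A \<in> carrier_mat n n" "B \<in> carrier_mat n n"
  shows "mtrace (A * B) = mtrace (B * A)"
proof -
  have "mtrace (A * B) = (\<Sum>i<n. \<Sum>j<n. A $$ (i, j) * B $$ (j, i))"
    using assms by (auto simp: mtrace_def scalar_prod_def atLeast0LessThan intro!: sum.cong)
  also have "\<dots> = (\<Sum>j<n. \<Sum>i<n. B $$ (j, i) * A $$ (i, j))"
    by (subst sum.swap) (simp add: mult.commute)
  also have "\<dots> = mtrace (B * A)"
    using assms by (auto simp: mtrace_def scalar_prod_def atLeast0LessThan intro!: sum.cong)
  finally show ?thesis .
qed

lemma upper_triangular_pow:
  fixes T :: "complex mat"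
  assumes T: "T \<in> carrier_mat n n" "upper_triangular T"
  shows "upper_triangular (T ^\<^sub>m k) \<and> (\<forall>i<n. (T ^\<^sub>m k) $$ (i, i) = T $$ (i, i) ^ k)"
proof (induction k)
  case 0
  then show ?case using T by (auto simp: upper_triangular_def)
next
  case (Suc k)
  have Tk: "T ^\<^sub>m k \<in> carrier_mat n n" using T by simp
  have prod: "(T ^\<^sub>m Suc k) $$ (i, j) = (\<Sum>l = 0..<n. (T ^\<^sub>m k) $$ (i, l) * T $$ (l, j))"
    if "i < n" "j < n" for i j using that T Tk by (simp add: scalar_prod_def)
  have z: "(T ^\<^sub>m k) $$ (i, l) = 0" if "l < i" "i < n" for i l
    using Suc that Tk by (auto simp: upper_triangular_def)
  have z': "T $$ (i, l) = 0" if "l < i" "i < n" for i l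
    using T that by (auto simp: upper_triangular_def)
  have "(T ^\<^sub>m Suc k) $$ (i, j) = 0" if "j < i" "i < n" for i j
    unfolding prod[OF that(2) order.strict_trans[OF that]]
  proof (rule sum.neutral, safe)
    fix l assume "l \<in> {0..<n}"
    then show "(T ^\<^sub>m k) $$ (i, l) * T $$ (l, j) = 0"
      using z[of l i] z'[of j l] that by (cases "l < i") auto
  qed
  moreover have "(T ^\<^sub>m Suc k) $$ (i, i) = T $$ (i, i) ^ Suc k" if "i < n" for i
  proof -
    have "(T ^\<^sub>m Suc k) $$ (i, i) =
        (\<Sum>l = 0..<n. if l = i then (T ^\<^sub>m k) $$ (i, i) * T $$ (i, i) else 0)"
      unfolding prod[OF that that]
    proof (rule sum.cong, simp)
      fix l assume "l \<in> {0..<n}"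
      then show "(T ^\<^sub>m k) $$ (i, l) * T $$ (l, i) = (if l = i then (T ^\<^sub>m k) $$ (i, i) * T $$ (i, i) else 0)"
        using z[of l i] z'[of i l] that by (cases l i rule: linorder_cases) auto
    qed
    then show ?thesis using Suc that by simp
  qed
  ultimately show ?case using T by (auto simp: upper_triangular_def)
qed

text \<open>For eigenvalues \<open>t\<^sub>k\<close> of \<open>M\<close> the entries are the power sums of the \<open>t\<^sub>k\<close>. So this is the Hankel
  determinant of the power sums, which equals the discriminant of the characteristic polynomial and
  is visibly polynomial in the entries of \<open>M\<close>.\<close>

definition trace_discriminant :: "complex mat \<Rightarrow> complex" where
  "trace_discriminant M = det (mat (dim_row M) (dim_row M) (\<lambda>(i, j). mtrace (M ^\<^sub>m (i + j))))"

lemma trace_discriminant_vandermonde: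
  assumes "M \<in> carrier_mat n n" "\<And>k. mtrace (M ^\<^sub>m k) = (\<Sum>i<n. t i ^ k)"
  shows "trace_discriminant M = (det (mat n n (\<lambda>(i, k). t k ^ i))) ^ 2"
proof -
  let ?V = "mat n n (\<lambda>(i, k). t k ^ i)"
  have "mat n n (\<lambda>(i, j). mtrace (M ^\<^sub>m (i + j))) = ?V * transpose_mat ?V"
    unfolding assms(2)
    by (rule eq_matI) (auto simp: scalar_prod_def power_add atLeast0LessThan intro!: sum.cong)
  then show ?thesis using assms(1) det_mult[of ?V n "transpose_mat ?V"] det_transpose[of ?V n]
    by (simp add: trace_discriminant_def power2_eq_square)
qed

lemma trace_discriminant_nonzero_imp:
  assumes M: "M \<in> carrier_mat n n" and nz: "trace_discriminant M \<noteq> 0"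
  obtains h where "inj_on h {..<n}" "\<And>i. i < n \<Longrightarrow> det (M - h i \<cdot>\<^sub>m 1\<^sub>m n) = 0"
proof -
  from char_poly_factorized[OF M] obtain es where es: "char_poly M = (\<Prod>a\<leftarrow>es. [:- a, 1:])" by auto
  obtain T P Q where "schur_decomposition M es = (T, P, Q)"
    by (cases "schur_decomposition M es") auto
  from schur_decomposition[OF M es this] have
    sim: "similar_mat_wit M T P Q" and ut: "upper_triangular T" and d: "diag_mat T = es" by auto
  note w = similar_mat_witD2[OF M sim]
  define h where "h i = T $$ (i, i)" for i
  have "mtrace (M ^\<^sub>m k) = (\<Sum>i<n. h i ^ k)" for k
  proof -
    have Tk: "T ^\<^sub>m k \<in> carrier_mat n n" using w by simp
    have "mtrace (M ^\<^sub>m k) = mtrace (P * (T ^\<^sub>m k * Q))"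
      using similar_mat_wit_pow_id[OF sim, of k] w Tk by (simp add: assoc_mult_mat[of _ n n _ n _ n])
    also have "\<dots> = mtrace (T ^\<^sub>m k)"
      using w Tk mtrace_mult_commute[of P n "T ^\<^sub>m k * Q"] mult_carrier_mat[OF Tk w(7)] by (simp add: assoc_mult_mat[of _ n n _ n _ n])
    also have "\<dots> = (\<Sum>i<n. h i ^ k)"
      using upper_triangular_pow[OF w(5) ut, of k] w(5) by (simp add: mtrace_def h_def)
    finally show ?thesis .
  qed
  then have disc: "trace_discriminant M = (det (mat n n (\<lambda>(i, k). h k ^ i))) ^ 2"
    by (rule trace_discriminant_vandermonde[OF M])
  have "inj_on h {..<n}"
  proof (rule inj_onI, rule ccontr)
    fix i j assume ij: "i \<in> {..<n}" "j \<in> {..<n}" "h i = h j" "i \<noteq> j"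
    have "det (mat n n (\<lambda>(i, k). h k ^ i)) = 0"
      by (rule det_identical_columns[of _ n i j]) (use ij in \<open>auto simp: vec_eq_iff\<close>)
    with disc nz show False by simp
  qed
  moreover have "det (M - h i \<cdot>\<^sub>m 1\<^sub>m n) = 0" if "i < n" for i
  proof -
    have "h i \<in> set es" unfolding d[symmetric] diag_mat_def h_def using that w by auto
    then have "poly (char_poly M) (h i) = 0" unfolding es by (induction es) auto
    then have "eigenvalue M (h i)" using eigenvalue_root_char_poly[OF M] by simp
    then have "det (char_matrix M (h i)) = 0" using eigenvalue_det[OF M] by simp
    moreover have "char_matrix M (h i) = M - h i \<cdot>\<^sub>m 1\<^sub>m n"
      using M by (intro eq_matI) (auto simp: char_matrix_def)
    ultimately show ?thesis by simp
  qed
  ultimately show ?thesis using that by blast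
qed

lemma trace_discriminant_nonzeroI:
  assumes M: "M \<in> carrier_mat n n" and inj: "inj_on h {..<n}"
    and root: "\<And>i. i < n \<Longrightarrow> det (M - h i \<cdot>\<^sub>m 1\<^sub>m n) = 0"
  shows "trace_discriminant M \<noteq> 0"
proof -
  obtain P Q where P: "P \<in> carrier_mat n n" "Q \<in> carrier_mat n n" "P * Q = 1\<^sub>m n" "Q * P = 1\<^sub>m n"
    "M * P = 1\<^sub>m n * P * dmat n h"
    using pencil_eigenbasis[OF M one_carrier_mat _ inj root] by auto
  have "M = M * (P * Q)" using M P(3) by simp
  also have "\<dots> = M * P * Q" using M P(1,2) by (simp add: assoc_mult_mat[of _ n n _ n _ n])
  also have "\<dots> = P * dmat n h * Q" using P(1,2,5) by simp
  finally have sim: "similar_mat_wit M (dmat n h) P Q"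
    using M P by (intro similar_mat_witI[of _ _ n]) auto
  have "mtrace (M ^\<^sub>m k) = (\<Sum>i<n. h i ^ k)" for k
  proof -
    have "mtrace (M ^\<^sub>m k) = mtrace (P * (dmat n (\<lambda>i. h i ^ k) * Q))"
      using similar_mat_wit_pow_id[OF sim, of k] P(1,2) by (simp add: dmat_pow assoc_mult_mat[of _ n n _ n _ n])
    also have "\<dots> = mtrace (dmat n (\<lambda>i. h i ^ k))"
      using P mtrace_mult_commute[of P n "dmat n (\<lambda>i. h i ^ k) * Q"]
        mult_carrier_mat[OF dmat_carrier P(2), of "\<lambda>i. h i ^ k"]
      by (simp add: assoc_mult_mat[of _ n n _ n _ n])
    finally show ?thesis by (simp add: mtrace_def)
  qed
  then have disc: "trace_discriminant M = (det (mat n n (\<lambda>(i, k). h k ^ i))) ^ 2" (is "_ = (det ?V) ^ 2")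
    by (rule trace_discriminant_vandermonde[OF M])
  have "det ?V \<noteq> 0"
  proof
    assume "det ?V = 0"
    then have "det (transpose_mat ?V) = 0" using det_transpose[of ?V n] by simp
    then obtain c where c: "c \<in> carrier_vec n" "c \<noteq> 0\<^sub>v n" "transpose_mat ?V *\<^sub>v c = 0\<^sub>v n"
      using det_0_iff_vec_prod_zero[of "transpose_mat ?V" n] by auto
    define f where "f = (\<Sum>i<n. monom (c $ i) i)"
    have "poly f (h k) = 0" if "k < n" for k
    proof -
      have "0 = (transpose_mat ?V *\<^sub>v c) $ k" using c that by simp
      also have "\<dots> = poly f (h k)"
        using that c(1) by (auto simp: scalar_prod_def f_def poly_sum poly_monom atLeast0LessThan mult.commute intro!: sum.cong)
      finally show ?thesis by simp
    qed
    then have sub: "h ` {..<n} \<subseteq> {x. poly f x = 0}" by auto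
    have coeff: "coeff f i = (if i < n then c $ i else 0)" for i
      by (auto simp: f_def coeff_sum)
    obtain k where k: "k < n" "c $ k \<noteq> 0" using c(1,2) by (auto simp: vec_eq_iff)
    then have f0: "f \<noteq> 0" using coeff[of k] by auto
    have "degree f \<le> n - 1" by (rule degree_le) (use coeff in auto)
    moreover have "n \<le> card {x. poly f x = 0}"
      using card_mono[OF poly_roots_finite[OF f0] sub] card_image[OF inj] by simp
    moreover have "card {x. poly f x = 0} \<le> degree f" by (rule card_poly_roots_bound[OF f0])
    ultimately show False using k(1) by linarith
  qed
  then show ?thesis using disc by simp
qed

text \<open>The cosquare \<open>(C\<^sup>T)\<^sup>-\<^sup>1 C\<close> has the roots of \<open>det (C - t C\<^sup>T)\<close> as eigenvalues. Multiplying it by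
  \<open>det C\<close> clears the denominators, so that the discriminant becomes polynomial in the entries of \<open>C\<close>.\<close>

definition cosquare_discriminant :: "complex mat \<Rightarrow> complex" where
  "cosquare_discriminant C = trace_discriminant (adj_mat (transpose_mat C) * C)"

lemma det_pencil_cosquare:
  assumes C: "C \<in> carrier_mat n n"
  shows "det C * det (adj_mat (transpose_mat C) * C - (det C * t) \<cdot>\<^sub>m 1\<^sub>m n) =
         det C ^ n * det (C - t \<cdot>\<^sub>m transpose_mat C)"
proof -
  let ?T = "transpose_mat C"
  have T: "?T \<in> carrier_mat n n" "det ?T = det C" using C det_transpose by auto
  note adj = adj_mat[OF T(1)]
  have "?T * (adj_mat ?T * C - (det C * t) \<cdot>\<^sub>m 1\<^sub>m n) = ?T * (adj_mat ?T * C) - ?T * ((det C * t) \<cdot>\<^sub>m 1\<^sub>m n)"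
    using T C adj by (intro mult_minus_distrib_mat) auto
  also have "?T * (adj_mat ?T * C) = ?T * adj_mat ?T * C"
    using T(1) C adj(1) by (simp add: assoc_mult_mat[of _ n n _ n _ n])
  also have "\<dots> = det C \<cdot>\<^sub>m C"
    unfolding adj(2) T(2) using C by (simp add: mult_smult_assoc_mat[of _ n n _ n])
  also have "?T * ((det C * t) \<cdot>\<^sub>m 1\<^sub>m n) = (det C * t) \<cdot>\<^sub>m ?T"
    using T(1) by (simp add: mult_smult_distrib[of _ n n _ n])
  also have "det C \<cdot>\<^sub>m C - (det C * t) \<cdot>\<^sub>m ?T = det C \<cdot>\<^sub>m (C - t \<cdot>\<^sub>m ?T)"
    using C by (intro eq_matI) (auto simp: algebra_simps)
  finally have eq: "?T * (adj_mat ?T * C - (det C * t) \<cdot>\<^sub>m 1\<^sub>m n) = det C \<cdot>\<^sub>m (C - t \<cdot>\<^sub>m ?T)" .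
  have "det (?T * (adj_mat ?T * C - (det C * t) \<cdot>\<^sub>m 1\<^sub>m n)) =
      det ?T * det (adj_mat ?T * C - (det C * t) \<cdot>\<^sub>m 1\<^sub>m n)"
    by (rule det_mult[OF T(1)]) (simp add: minus_carrier_mat)
  with eq T C show ?thesis by simp
qed

lemma cosquare_discriminant_nonzero_imp:
  assumes C: "C \<in> carrier_mat n n" "det C \<noteq> 0" and nz: "cosquare_discriminant C \<noteq> 0"
  obtains h where "inj_on h {..<n}" "\<And>i. i < n \<Longrightarrow> det (C - h i \<cdot>\<^sub>m transpose_mat C) = 0"
proof -
  have M: "adj_mat (transpose_mat C) * C \<in> carrier_mat n n"
    using C adj_mat(1)[of "transpose_mat C" n] by (metis mult_carrier_mat transpose_carrier_mat)
  obtain h where h: "inj_on h {..<n}"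
    "\<And>i. i < n \<Longrightarrow> det (adj_mat (transpose_mat C) * C - h i \<cdot>\<^sub>m 1\<^sub>m n) = 0"
    using trace_discriminant_nonzero_imp[OF M nz[unfolded cosquare_discriminant_def]] by metis
  have "inj_on (\<lambda>i. h i / det C) {..<n}" using h(1) C(2) by (auto simp: inj_on_def)
  moreover have "det (C - (h i / det C) \<cdot>\<^sub>m transpose_mat C) = 0" if "i < n" for i
    using det_pencil_cosquare[OF C(1), of "h i / det C"] h(2)[OF that] C(2) by simp
  ultimately show ?thesis using that by blast
qed

lemma cosquare_discriminant_nonzeroI:
  assumes C: "C \<in> carrier_mat n n" "det C \<noteq> 0" and inj: "inj_on h {..<n}"
    and root: "\<And>i. i < n \<Longrightarrow> det (C - h i \<cdot>\<^sub>m transpose_mat C) = 0"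
  shows "cosquare_discriminant C \<noteq> 0"
  unfolding cosquare_discriminant_def
proof (rule trace_discriminant_nonzeroI)
  show "adj_mat (transpose_mat C) * C \<in> carrier_mat n n"
    using C adj_mat(1)[of "transpose_mat C" n] by (metis mult_carrier_mat transpose_carrier_mat)
  show "inj_on (\<lambda>i. det C * h i) {..<n}" using inj C(2) by (auto simp: inj_on_def)
  show "det (adj_mat (transpose_mat C) * C - (det C * h i) \<cdot>\<^sub>m 1\<^sub>m n) = 0" if "i < n" for i
    using det_pencil_cosquare[OF C(1), of "h i"] root[OF that] C(2) by simp
qed

lemma polyfun_trace_discriminant:
  assumes "polymat n k M" shows "polyfun n (\<lambda>A. trace_discriminant (M A))"
proof (rule polyfun_cong)
  show "polyfun n (\<lambda>A. det (mat k k (\<lambda>(i, j). mtrace (M A ^\<^sub>m (i + j)))))"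
    by (rule polyfun_det, rule polymat_mat, rule polyfun_trace, rule polymat_pow, rule assms)
qed (use assms in \<open>auto simp: trace_discriminant_def polymat_def\<close>)

lemma polyfun_cosquare_discriminant:
  assumes "polymat n k M" shows "polyfun n (\<lambda>A. cosquare_discriminant (M A))"
  unfolding cosquare_discriminant_def
  by (rule polyfun_trace_discriminant[of n k], rule polymat_mult, rule polymat_adj,
      rule polymat_transpose) (rule assms)+

section \<open>Raising the number of factors and the dimension\<close>

lemma product_of_skew_two_iff:
  "product_of_skew_symmetric n 2 A \<longleftrightarrow>
     (\<exists>S T. skew_symmetric_mat n S \<and> skew_symmetric_mat n T \<and> A = S * T)"
proof
  assume "product_of_skew_symmetric n 2 A"
  then show "\<exists>S T. skew_symmetric_mat n S \<and> skew_symmetric_mat n T \<and> A = S * T"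
    unfolding numeral_2_eq_2 product_of_skew_Suc product_of_skew_0
    by (metis right_mult_one_mat skew_symmetric_mat_def)
next
  assume "\<exists>S T. skew_symmetric_mat n S \<and> skew_symmetric_mat n T \<and> A = S * T"
  then show "product_of_skew_symmetric n 2 A"
    using product_of_skew_mult[OF product_of_skew_single product_of_skew_single, of n]
    by (auto simp: numeral_2_eq_2)
qed

lemma product_of_skew_three_iff:
  "product_of_skew_symmetric n 3 A \<longleftrightarrow>
     (\<exists>S T U. skew_symmetric_mat n S \<and> skew_symmetric_mat n T \<and> skew_symmetric_mat n U \<and> A = S * (T * U))"
  using product_of_skew_Suc[of n 2 A] unfolding product_of_skew_two_iff
  by (auto simp: eval_nat_numeral)

lemma skew_inverse_pair_exists:
  assumes "even n"
  obtains K K' where "skew_symmetric_mat n K" "skew_symmetric_mat n K'"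
    "K \<in> carrier_mat n n" "K' \<in> carrier_mat n n" "K * K' = 1\<^sub>m n" "K' * K = 1\<^sub>m n"
proof -
  have "product_of_skew_symmetric n 2 (dmat n (\<lambda>i. 1))"
    by (rule paired_diagonal_product_of_two_skew[where \<sigma> = "\<lambda>i. if even i then i + 1 else i - 1"])
       (use assms in \<open>auto elim!: evenE oddE\<close>)
  then obtain K K' where "skew_symmetric_mat n K" "skew_symmetric_mat n K'" "K * K' = 1\<^sub>m n"
    unfolding product_of_skew_two_iff dmat_1 by metis
  with that mat_mult_left_right_inverse[of K n K'] show ?thesis
    unfolding skew_symmetric_mat_def by metis
qed

lemma skew_four_block:
  assumes "skew_symmetric_mat a S" "skew_symmetric_mat b T" "U \<in> carrier_mat a b"
  shows "skew_symmetric_mat (a + b) (four_block_mat S U (- transpose_mat U) T)"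
proof -
  have S: "S \<in> carrier_mat a a" "T \<in> carrier_mat b b"
    using assms by (auto simp: skew_symmetric_mat_def)
  have e: "M $$ (i, j) = - M $$ (j, i)" if "skew_symmetric_mat k M" "i < k" "j < k" for M k i j
  proof -
    from that(1) have "M = - transpose_mat M" "M \<in> carrier_mat k k" by (auto simp: skew_symmetric_mat_def)
    then have "M $$ (i, j) = (- transpose_mat M) $$ (i, j)" by simp
    then show ?thesis using \<open>M \<in> carrier_mat k k\<close> that by simp
  qed
  show ?thesis
  proof (rule skew_symmetric_matI)
    fix i j assume "i < a + b" "j < a + b"
    then show "four_block_mat S U (- transpose_mat U) T $$ (i, j) +
      four_block_mat S U (- transpose_mat U) T $$ (j, i) = 0"
      using S assms(3) e[OF assms(1), of i j] e[OF assms(2), of "i - a" "j - a"]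
      by (auto simp: not_less)
  qed (use S assms(3) in auto)
qed

lemma skew_zero: "skew_symmetric_mat n (0\<^sub>m n n)"
  by (rule skew_symmetric_matI) auto

text \<open>For skew symmetric \<open>S\<close> this is \<open>(I c)\<^sup>T S (I c)\<close>, because then \<open>c\<^sup>T S c = 0\<close>.\<close>

definition extend_skew :: "nat \<Rightarrow> complex mat \<Rightarrow> complex mat \<Rightarrow> complex mat" where
  "extend_skew k S c = four_block_mat S (S * c) (transpose_mat c * S) (0\<^sub>m 1 1)"

lemma skew_extend_skew:
  assumes S: "skew_symmetric_mat k S" and c: "c \<in> carrier_mat k 1"
  shows "skew_symmetric_mat (Suc k) (extend_skew k S c)"
proof -
  have Sc: "S \<in> carrier_mat k k" and ST: "S = - transpose_mat S"
    using S by (auto simp: skew_symmetric_mat_def)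
  have "transpose_mat (S * c) = transpose_mat c * transpose_mat S"
    using Sc c by (simp add: transpose_mult[of _ k k _ 1])
  then have "- transpose_mat (S * c) = transpose_mat c * (- transpose_mat S)"
    using Sc c by (simp add: uminus_mult_right_mat)
  then have "transpose_mat c * S = - transpose_mat (S * c)" using ST by simp
  then show ?thesis
    unfolding extend_skew_def
    using skew_four_block[OF S skew_zero[of 1], of "S * c"] Sc c by simp
qed

definition leading_block :: "nat \<Rightarrow> complex mat \<Rightarrow> complex mat" where
  "leading_block k A = mat k k (\<lambda>(i, j). A $$ (i, j))"

definition pad :: "nat \<Rightarrow> complex mat \<Rightarrow> complex mat \<Rightarrow> complex mat" where
  "pad k A w = four_block_mat A (0\<^sub>m k 1) w (0\<^sub>m 1 1)"

lemma pad_carrier [simp]: "A \<in> carrier_mat k k \<Longrightarrow> w \<in> carrier_mat 1 k \<Longrightarrow> pad k A w \<in> carrier_mat (Suc k) (Suc k)"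
  unfolding pad_def by auto

lemma pad_mult:
  assumes "A \<in> carrier_mat k k" "w \<in> carrier_mat 1 k" "B \<in> carrier_mat k k" "u \<in> carrier_mat 1 k"
  shows "pad k A w * pad k B u = pad k (A * B) (w * B)"
  unfolding pad_def using assms
  by (subst mult_four_block_mat[of _ k k _ 1 _ 1 _ _ k _ 1]) auto

lemma pad_mult_extend_skew:
  assumes "A \<in> carrier_mat k k" "w \<in> carrier_mat 1 k" "S \<in> carrier_mat k k" "c \<in> carrier_mat k 1"
  shows "pad k A w * extend_skew k S c = four_block_mat (A * S) (A * S * c) (w * S) (w * S * c)"
  unfolding pad_def extend_skew_def using assms
  by (subst mult_four_block_mat[of _ k k _ 1 _ 1 _ _ k _ 1])
     (auto simp: assoc_mult_mat[of _ k k _ k _ 1] assoc_mult_mat[of _ 1 k _ k _ 1])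

lemma skew_pad:
  assumes "skew_symmetric_mat k S" shows "skew_symmetric_mat (Suc k) (pad k S (0\<^sub>m 1 k))"
proof -
  have ut: "- transpose_mat (0\<^sub>m k 1) = (0\<^sub>m 1 k :: complex mat)" by (rule eq_matI) auto
  show ?thesis
  using skew_four_block[OF assms skew_zero[of 1], of "0\<^sub>m k 1"] ut
  unfolding pad_def by simp
qed

lemma det_pad:
  assumes "A \<in> carrier_mat k k" "w \<in> carrier_mat 1 k" shows "det (pad k A w) = 0"
proof -
  have "pad k A w *\<^sub>v unit_vec (Suc k) k = 0\<^sub>v (Suc k)"
    using assms by (intro eq_vecI) (auto simp: pad_def)
  moreover have "unit_vec (Suc k) k \<noteq> (0\<^sub>v (Suc k) :: complex vec)" by (auto simp: vec_eq_iff)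
  ultimately show ?thesis
    using det_0_iff_vec_prod_zero[OF pad_carrier[OF assms]] unit_vec_carrier by blast
qed

lemma leading_block_pad:
  "A \<in> carrier_mat k k \<Longrightarrow> w \<in> carrier_mat 1 k \<Longrightarrow> leading_block k (pad k A w) = A"
  by (rule eq_matI) (auto simp: leading_block_def pad_def)

lemma leading_block_carrier [simp]: "leading_block k A \<in> carrier_mat k k"
  by (simp add: leading_block_def)

text \<open>A kernel vector of \<open>A\<close> has a nonzero last entry because the leading block is invertible; normalized
  to \<open>-1\<close> there, its other entries are \<open>c\<close>.\<close>

lemma singular_bordered_form:
  assumes A: "A \<in> carrier_mat (Suc k) (Suc k)" "det A = 0" and L: "det (leading_block k A) \<noteq> 0"
  obtains b c where "b \<in> carrier_mat 1 k" "c \<in> carrier_mat k 1"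
    "A = four_block_mat (leading_block k A) (leading_block k A * c) b (b * c)"
proof -
  let ?L = "leading_block k A"
  obtain v where v: "v \<in> carrier_vec (Suc k)" "v \<noteq> 0\<^sub>v (Suc k)" "A *\<^sub>v v = 0\<^sub>v (Suc k)"
    using det_0_iff_vec_prod_zero[OF A(1)] A(2) by blast
  have eq: "(\<Sum>j<k. A $$ (i, j) * v $ j) + A $$ (i, k) * v $ k = 0" if "i < Suc k" for i
  proof -
    have "(A *\<^sub>v v) $ i = (\<Sum>j<Suc k. A $$ (i, j) * v $ j)"
      using A v(1) that by (auto simp: scalar_prod_def atLeast0LessThan intro!: sum.cong)
    then show ?thesis using v(3) that by simp
  qed
  have vk: "v $ k \<noteq> 0"
  proof
    assume 0: "v $ k = 0"
    define u where "u = vec k (\<lambda>i. v $ i)"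
    have "?L *\<^sub>v u = 0\<^sub>v k"
      using eq 0 by (intro eq_vecI)
        (auto simp: u_def leading_block_def scalar_prod_def atLeast0LessThan)
    moreover have "u \<in> carrier_vec k" by (simp add: u_def)
    ultimately have "u = 0\<^sub>v k" using L det_0_iff_vec_prod_zero[of ?L k] by auto
    then have "v $ i = 0" if "i < k" for i using that unfolding u_def by (metis index_vec index_zero_vec(1))
    with 0 v(1) have "v = 0\<^sub>v (Suc k)" by (auto simp: vec_eq_iff less_Suc_eq)
    with v(2) show False by simp
  qed
  define c where "c = mat k 1 (\<lambda>(i, j). - v $ i / v $ k)"
  define b where "b = mat 1 k (\<lambda>(i, j). A $$ (k, j))"
  have col: "A $$ (i, k) = (\<Sum>j<k. A $$ (i, j) * (- v $ j / v $ k))" if "i < Suc k" for i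
  proof -
    have "A $$ (i, k) * v $ k = - (\<Sum>j<k. A $$ (i, j) * v $ j)"
      using eq[OF that] by (metis add.commute eq_neg_iff_add_eq_0)
    then have "A $$ (i, k) = - (\<Sum>j<k. A $$ (i, j) * v $ j) / v $ k" using vk by (simp add: field_simps)
    then show ?thesis by (simp add: sum_divide_distrib sum_negf[symmetric])
  qed
  have "A = four_block_mat ?L (?L * c) b (b * c)"
  proof (rule eq_matI)
    fix i j assume "i < dim_row (four_block_mat ?L (?L * c) b (b * c))"
      "j < dim_col (four_block_mat ?L (?L * c) b (b * c))"
    then have "i < Suc k" "j < Suc k" by (auto simp: b_def c_def leading_block_def)
    then show "A $$ (i, j) = four_block_mat ?L (?L * c) b (b * c) $$ (i, j)"
      using col[of i] by (cases "i = k"; cases "j = k")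
        (auto simp: b_def c_def leading_block_def scalar_prod_def atLeast0LessThan less_Suc_eq)
  qed (use A in \<open>auto simp: b_def c_def leading_block_def\<close>)
  then show ?thesis using that[of b c] by (simp add: b_def c_def)
qed

text \<open>Besides the column relation with \<open>c\<close> also the last row is a combination \<open>g\<close> of the others, so
  that \<open>A = (I g\<^sup>T)\<^sup>T L (I c)\<close> with \<open>L\<close> the leading block. If \<open>L = S T U\<close>, extending \<open>S\<close> by \<open>g\<close>, \<open>T\<close> by zero
  and \<open>U\<close> by \<open>c\<close> gives skew symmetric factors of \<open>A\<close>.\<close>

lemma three_skew_from_leading_block:
  assumes A: "A \<in> carrier_mat (Suc k) (Suc k)" "det A = 0" and L: "det (leading_block k A) \<noteq> 0"
    and 3: "product_of_skew_symmetric k 3 (leading_block k A)"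
  shows "product_of_skew_symmetric (Suc k) 3 A"
proof -
  let ?L = "leading_block k A"
  obtain b c where bc: "b \<in> carrier_mat 1 k" "c \<in> carrier_mat k 1"
    "A = four_block_mat ?L (?L * c) b (b * c)" using singular_bordered_form[OF A L] by metis
  obtain L' where L': "L' \<in> carrier_mat k k" "L' * ?L = 1\<^sub>m k"
    using right_inverse_exists[OF leading_block_carrier L] by metis
  define g where "g = b * L'"
  have g: "g \<in> carrier_mat 1 k" and gL: "g * ?L = b"
    using bc(1) L' by (simp_all add: g_def assoc_mult_mat[of _ 1 k _ k _ k])
  from 3 obtain S T U where STU: "skew_symmetric_mat k S" "skew_symmetric_mat k T"
    "skew_symmetric_mat k U" "?L = S * (T * U)" unfolding product_of_skew_three_iff by auto
  then have car: "S \<in> carrier_mat k k" "T \<in> carrier_mat k k" "U \<in> carrier_mat k k"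
    by (auto simp: skew_symmetric_mat_def)
  let ?S = "extend_skew k S (transpose_mat g)" and ?T = "pad k T (0\<^sub>m 1 k)"
  have "?S * ?T = pad k (S * T) (g * S * T)"
    unfolding extend_skew_def pad_def using car g
    by (subst mult_four_block_mat[of _ k k _ 1 _ 1 _ _ k _ 1]) auto
  then have "?S * ?T * extend_skew k U c = A"
    using pad_mult_extend_skew[of "S * T" k "g * S * T" U c] car g bc(2)
    by (subst bc(3), unfold STU(4) gL[symmetric])
       (simp add: assoc_mult_mat[of _ k k _ k _ k] assoc_mult_mat[of _ 1 k _ k _ k])
  moreover have "?S * ?T * extend_skew k U c = ?S * (?T * extend_skew k U c)"
    by (rule assoc_mult_mat[of _ "Suc k" "Suc k" _ "Suc k" _ "Suc k"])
      (use skew_extend_skew[OF STU(1), of "transpose_mat g"] skew_pad[OF STU(2)]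
        skew_extend_skew[OF STU(3) bc(2)] g in \<open>auto simp: skew_symmetric_mat_def\<close>)
  ultimately show ?thesis
    unfolding product_of_skew_three_iff
    using skew_extend_skew[OF STU(1), of "transpose_mat g"] skew_pad[OF STU(2)]
      skew_extend_skew[OF STU(3) bc(2)] g by (metis transpose_carrier_mat)
qed

text \<open>The polynomial \<open>f\<close> is the certificate of genericity: \<open>f = 0\<close> is the exceptional subvariety, and it is
  proper because of the witness. Invertibility of the witness is used for passing to dimension \<open>n + 1\<close>.\<close>

definition certified :: "nat \<Rightarrow> nat \<Rightarrow> bool" where
  "certified n r \<longleftrightarrow> (\<exists>f. polyfun n f \<and> (\<exists>A\<in>carrier_mat n n. f A \<noteq> 0 \<and> det A \<noteq> 0) \<and>
     (\<forall>A\<in>carrier_mat n n. f A \<noteq> 0 \<longrightarrow> product_of_skew_symmetric n r A))"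

text \<open>The witness is required to have a vanishing last column: the step from \<open>r\<close> to \<open>r + 1\<close> factors
  evaluates the old polynomial only at such matrices.\<close>

definition certified_det :: "nat \<Rightarrow> nat \<Rightarrow> bool" where
  "certified_det k r \<longleftrightarrow> (\<exists>f. polyfun (Suc k) f \<and>
     (\<exists>A\<in>carrier_mat k k. \<exists>w\<in>carrier_mat 1 k. det A \<noteq> 0 \<and> f (pad k A w) \<noteq> 0) \<and>
     (\<forall>A\<in>DET (Suc k). f A \<noteq> 0 \<longrightarrow> product_of_skew_symmetric (Suc k) r A))"

lemma certifiedI:
  assumes "polyfun n f" "A \<in> carrier_mat n n" "f A \<noteq> 0" "det A \<noteq> 0"
    and "\<And>A. A \<in> carrier_mat n n \<Longrightarrow> f A \<noteq> 0 \<Longrightarrow> product_of_skew_symmetric n r A"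
  shows "certified n r"
  unfolding certified_def using assms by (intro exI[of _ f] conjI bexI[of _ A] ballI impI) simp_all

lemma certified_detI:
  assumes "polyfun (Suc k) f" "A \<in> carrier_mat k k" "w \<in> carrier_mat 1 k" "det A \<noteq> 0" "f (pad k A w) \<noteq> 0"
    and "\<And>A. A \<in> DET (Suc k) \<Longrightarrow> f A \<noteq> 0 \<Longrightarrow> product_of_skew_symmetric (Suc k) r A"
  shows "certified_det k r"
  unfolding certified_det_def using assms
  by (intro exI[of _ f] conjI bexI[of _ A] bexI[of _ w] ballI impI) simp_all

lemma certified_imp_generic:
  "certified n r \<Longrightarrow> holds_generically n (carrier_mat n n) (product_of_skew_symmetric n r)"
  unfolding certified_def using holds_generically_carrierI[of n _ "product_of_skew_symmetric n r"] by blast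

lemma certified_det_imp_generic:
  assumes "certified_det k r"
  shows "holds_generically (Suc k) (DET (Suc k)) (product_of_skew_symmetric (Suc k) r)"
proof -
  from assms obtain f A w where f: "polyfun (Suc k) f" "A \<in> carrier_mat k k" "w \<in> carrier_mat 1 k"
    "f (pad k A w) \<noteq> 0" "\<And>A. A \<in> DET (Suc k) \<Longrightarrow> f A \<noteq> 0 \<Longrightarrow> product_of_skew_symmetric (Suc k) r A"
    unfolding certified_det_def by blast
  have "pad k A w \<in> DET (Suc k)" using f(2,3) by (simp add: DET_def det_pad)
  with f show ?thesis by (intro holds_generically_DETI) auto
qed

text \<open>With \<open>K\<close> a fixed invertible skew symmetric matrix, \<open>A = (A K\<^sup>-\<^sup>1) K\<close>.\<close>

lemma certified_Suc:
  assumes "certified n r" "even n" shows "certified n (Suc r)"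
proof -
  from assms(1) obtain f W where f: "polyfun n f" "W \<in> carrier_mat n n" "f W \<noteq> 0" "det W \<noteq> 0"
    "\<And>A. A \<in> carrier_mat n n \<Longrightarrow> f A \<noteq> 0 \<Longrightarrow> product_of_skew_symmetric n r A"
    unfolding certified_def by blast
  obtain K K' where K: "skew_symmetric_mat n K" "skew_symmetric_mat n K'"
    "K \<in> carrier_mat n n" "K' \<in> carrier_mat n n" "K * K' = 1\<^sub>m n" "K' * K = 1\<^sub>m n"
    using skew_inverse_pair_exists[OF assms(2)] by metis
  have dK: "det K \<noteq> 0" using det_mult[OF K(3,4)] K(5) by auto
  have "polyfun n (\<lambda>A. f (A * K'))"
    by (rule polyfun_eval[OF f(1)], rule polymat_mult, rule polymat_id, rule polymat_const, rule K)
  moreover have "f (W * K * K') \<noteq> 0" "det (W * K) \<noteq> 0"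
    using f K dK by (simp_all add: assoc_mult_mat[of _ n n _ n _ n] det_mult[of _ n])
  moreover have "product_of_skew_symmetric n (Suc r) A" if "A \<in> carrier_mat n n" "f (A * K') \<noteq> 0" for A
  proof -
    have "product_of_skew_symmetric n r (A * K')" using f(5)[OF _ that(2)] that K by simp
    from product_of_skew_mult[OF this product_of_skew_single[OF K(1)]]
    show ?thesis using that K by (simp add: assoc_mult_mat[of _ n n _ n _ n])
  qed
  ultimately show ?thesis
    using mult_carrier_mat[OF f(2) K(3)] by (intro certifiedI[of n "\<lambda>A. f (A * K')" "W * K"])
qed

lemma polymat_leading_block: "polymat (Suc k) k (leading_block k)"
  unfolding leading_block_def by (intro polymat_mat polyfun_coord) auto

text \<open>Odd dimension has no invertible skew symmetric matrix. With \<open>K\<close> as in dimension \<open>k\<close>, the bordered form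
  of a singular \<open>A\<close> gives \<open>A = (A (K\<^sup>-\<^sup>1 \<oplus> 0)) (I c)\<^sup>T K (I c)\<close> instead.\<close>

lemma certified_det_Suc:
  assumes "certified_det k r" "even k" shows "certified_det k (Suc r)"
proof -
  from assms(1) obtain f W w where f: "polyfun (Suc k) f" "W \<in> carrier_mat k k" "w \<in> carrier_mat 1 k"
    "det W \<noteq> 0" "f (pad k W w) \<noteq> 0"
    "\<And>A. A \<in> DET (Suc k) \<Longrightarrow> f A \<noteq> 0 \<Longrightarrow> product_of_skew_symmetric (Suc k) r A"
    unfolding certified_det_def by blast
  obtain K K' where K: "skew_symmetric_mat k K" "skew_symmetric_mat k K'"
    "K \<in> carrier_mat k k" "K' \<in> carrier_mat k k" "K * K' = 1\<^sub>m k" "K' * K = 1\<^sub>m k"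
    using skew_inverse_pair_exists[OF assms(2)] by metis
  have dK: "det K \<noteq> 0" using det_mult[OF K(3,4)] K(5) by auto
  let ?K = "pad k K' (0\<^sub>m 1 k)"
  have Kc: "?K \<in> carrier_mat (Suc k) (Suc k)" using K by simp
  let ?f = "\<lambda>A. f (A * ?K) * det (leading_block k A)"
  have "polyfun (Suc k) ?f"
    by (rule polyfun_mult, rule polyfun_eval[OF f(1)], rule polymat_mult, rule polymat_id,
        rule polymat_const, rule Kc, rule polyfun_det, rule polymat_leading_block)
  moreover have "?f (pad k (W * K) (w * K)) \<noteq> 0" "det (W * K) \<noteq> 0"
    using f K dK
    by (simp_all add: pad_mult assoc_mult_mat[of _ k k _ k _ k] assoc_mult_mat[of _ 1 k _ k _ k]
        det_mult[of _ k] leading_block_pad)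
  moreover have "product_of_skew_symmetric (Suc k) (Suc r) A" if "A \<in> DET (Suc k)" "?f A \<noteq> 0" for A
  proof -
    define L where "L = leading_block k A"
    have Lc: "L \<in> carrier_mat k k" by (simp add: L_def)
    have A: "A \<in> carrier_mat (Suc k) (Suc k)" "det A = 0" using that(1) by (auto simp: DET_def)
    have L: "det L \<noteq> 0" using that(2) by (auto simp: L_def)
    obtain b c where bc: "b \<in> carrier_mat 1 k" "c \<in> carrier_mat k 1"
      "A = four_block_mat L (L * c) b (b * c)" using singular_bordered_form[OF A L[unfolded L_def]] unfolding L_def by metis
    have AK: "A * ?K = pad k (L * K') (b * K')"
      unfolding pad_def using K Lc bc(1,2)
      by (subst bc(3), subst mult_four_block_mat[of _ k k _ 1 _ 1 _ _ k _ 1]) auto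
    then have "A * ?K \<in> DET (Suc k)"
      using mult_carrier_mat[OF Lc K(4)] mult_carrier_mat[OF bc(1) K(4)] by (simp add: DET_def det_pad)
    then have "product_of_skew_symmetric (Suc k) r (A * ?K)" using f(6) that(2) by auto
    from product_of_skew_mult[OF this product_of_skew_single[OF skew_extend_skew[OF K(1) bc(2)]]]
    have "product_of_skew_symmetric (Suc k) (Suc r) (A * ?K * extend_skew k K c)" by simp
    also have "A * ?K * extend_skew k K c = A"
    proof -
      have "L * K' * K = L" "b * K' * K = b"
        using K Lc bc(1) by (simp_all add: assoc_mult_mat[of _ k k _ k _ k] assoc_mult_mat[of _ 1 k _ k _ k])
      then show ?thesis unfolding AK
        using pad_mult_extend_skew[OF mult_carrier_mat[OF Lc K(4)] mult_carrier_mat[OF bc(1) K(4)] K(3) bc(2)] bc(3)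
        by simp
    qed
    finally show ?thesis .
  qed
  ultimately show ?thesis
    using mult_carrier_mat[OF f(2) K(3)] mult_carrier_mat[OF f(3) K(3)]
    by (intro certified_detI[of k ?f "W * K" "w * K"])
qed

lemma certified_mono: "r \<le> s \<Longrightarrow> certified n r \<Longrightarrow> even n \<Longrightarrow> certified n s"
  by (induction rule: dec_induct) (auto intro: certified_Suc)

lemma certified_det_mono: "r \<le> s \<Longrightarrow> certified_det k r \<Longrightarrow> even k \<Longrightarrow> certified_det k s"
  by (induction rule: dec_induct) (auto intro: certified_det_Suc)

text \<open>The certificate in dimension \<open>k\<close> is applied to the leading block.\<close>

lemma certified_three_imp_certified_det:
  assumes "certified k 3" shows "certified_det k 3"
proof -
  from assms obtain f W where f: "polyfun k f" "W \<in> carrier_mat k k" "f W \<noteq> 0" "det W \<noteq> 0"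
    "\<And>A. A \<in> carrier_mat k k \<Longrightarrow> f A \<noteq> 0 \<Longrightarrow> product_of_skew_symmetric k 3 A"
    unfolding certified_def by blast
  let ?f = "\<lambda>A. f (leading_block k A) * det (leading_block k A)"
  have "polyfun (Suc k) ?f"
    by (rule polyfun_mult, rule polyfun_eval[OF f(1)], rule polymat_leading_block,
        rule polyfun_det, rule polymat_leading_block)
  moreover have "?f (pad k W (0\<^sub>m 1 k)) \<noteq> 0" using f by (simp add: leading_block_pad)
  moreover have "product_of_skew_symmetric (Suc k) 3 A" if "A \<in> DET (Suc k)" "?f A \<noteq> 0" for A
    using three_skew_from_leading_block[of A k] that f(5)[OF leading_block_carrier] by (auto simp: DET_def)
  ultimately show ?thesis
    using f(2,4) by (intro certified_detI[of k ?f W "0\<^sub>m 1 k"]) simp_all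
qed

section \<open>Even dimension and an odd number of factors\<close>

lemma kernel_imp_det_0:
  fixes M :: "complex mat"
  assumes M: "M \<in> carrier_mat n n" and k: "k < n" "v k \<noteq> 0"
    and ker: "\<And>i. i < n \<Longrightarrow> (\<Sum>j<n. M $$ (i, j) * v j) = 0"
  shows "det M = 0"
proof -
  have "M *\<^sub>v vec n v = 0\<^sub>v n"
    using M ker by (intro eq_vecI) (auto simp: scalar_prod_def atLeast0LessThan)
  moreover have "vec n v \<noteq> 0\<^sub>v n" using k by (auto simp: vec_eq_iff)
  ultimately show ?thesis using det_0_iff_vec_prod_zero[OF M] by (metis vec_carrier)
qed

lemma det_dmat: "det (dmat n d) = (\<Prod>i<n. d i)"
  by (subst det_upper_triangular[of _ n])
     (auto simp: upper_triangular_def prod_list_diag_prod atLeast0LessThan)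

text \<open>In an eigenbasis the pencil is diagonal with entries \<open>h i - t\<close>.\<close>

lemma pencil_roots_exhausted:
  fixes A B :: "complex mat"
  assumes A: "A \<in> carrier_mat n n" and B: "B \<in> carrier_mat n n" "det B \<noteq> 0"
    and inj: "inj_on h {..<n}" and root: "\<And>i. i < n \<Longrightarrow> det (A - h i \<cdot>\<^sub>m B) = 0"
    and t: "det (A - t \<cdot>\<^sub>m B) = 0"
  shows "t \<in> h ` {..<n}"
proof -
  obtain P Q where P: "P \<in> carrier_mat n n" "Q \<in> carrier_mat n n" "P * Q = 1\<^sub>m n" "Q * P = 1\<^sub>m n"
    "A * P = B * P * dmat n h"
    using pencil_eigenbasis[OF A B inj root] by metis
  have BP: "B * P \<in> carrier_mat n n" using B P by simp
  have C: "A - t \<cdot>\<^sub>m B \<in> carrier_mat n n" using A B by (simp add: minus_carrier_mat)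
  have "(A - t \<cdot>\<^sub>m B) * P = A * P - t \<cdot>\<^sub>m (B * P)"
    using A B P(1) by (simp add: minus_mult_distrib_mat[of _ n n _ _ n] mult_smult_assoc_mat[of _ n n _ n])
  also have "\<dots> = B * P * dmat n (\<lambda>i. h i - t)"
    unfolding P(5) using BP B(1) P(1)
    by (intro eq_matI) (auto simp: mult_dmat_index[OF BP] algebra_simps simp del: index_mult_mat(1))
  finally have "det ((A - t \<cdot>\<^sub>m B) * P) = det (B * P * dmat n (\<lambda>i. h i - t))" by simp
  then have "det (B * P) * (\<Prod>i<n. h i - t) = 0"
    using t det_mult[OF C P(1)] det_mult[OF BP dmat_carrier] by (simp add: det_dmat)
  moreover have "det (B * P) \<noteq> 0" using det_mult[OF B(1) P(1)] B(2) det_mult[OF P(1,2)] P(3) by auto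
  ultimately show ?thesis by auto
qed

text \<open>This is \<open>J diag(X\<^sup>T, Y)\<close> for the standard symplectic matrix \<open>J\<close>, so it has one more skew symmetric
  factor than \<open>diag(X\<^sup>T, Y)\<close>. Its pencil splits: the roots of \<open>det (B - s B\<^sup>T)\<close> are, up to sign, the roots of
  \<open>det (Y - t X)\<close> and their reciprocals.\<close>

definition bip :: "nat \<Rightarrow> complex mat \<Rightarrow> complex mat \<Rightarrow> complex mat" where
  "bip m X Y = four_block_mat (0\<^sub>m m m) Y (- transpose_mat X) (0\<^sub>m m m)"

lemma bip_carrier [simp]: "X \<in> carrier_mat m m \<Longrightarrow> Y \<in> carrier_mat m m \<Longrightarrow> bip m X Y \<in> carrier_mat (m + m) (m + m)"
  by (auto simp: bip_def)

lemma det_antidiagonal_blocks: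
  fixes U V :: "complex mat"
  assumes "U \<in> carrier_mat m m" "V \<in> carrier_mat m m"
  shows "det (four_block_mat (0\<^sub>m m m) U V (0\<^sub>m m m)) = (-1) ^ m * (det U * det V)"
proof -
  have "det (four_block_mat (0\<^sub>m m m) U V (0\<^sub>m m m)) = det (0\<^sub>m m m * 0\<^sub>m m m - U * V)"
    by (rule det_four_block_mat[of _ m]) (use assms in auto)
  also have "0\<^sub>m m m * 0\<^sub>m m m - U * V = (-1) \<cdot>\<^sub>m (U * V)"
    using assms by (intro eq_matI) auto
  finally show ?thesis using assms det_mult[OF assms] by simp
qed

lemma det_bip_pencil:
  assumes X: "X \<in> carrier_mat m m" and Y: "Y \<in> carrier_mat m m" and s: "s \<noteq> 0"
  shows "det (bip m X Y - s \<cdot>\<^sub>m transpose_mat (bip m X Y)) =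
     (-1) ^ m * (det (Y - (-s) \<cdot>\<^sub>m X) * ((-s) ^ m * det (Y - (- (1 / s)) \<cdot>\<^sub>m X)))"
proof -
  have "bip m X Y - s \<cdot>\<^sub>m transpose_mat (bip m X Y) =
    four_block_mat (0\<^sub>m m m) (Y - (-s) \<cdot>\<^sub>m X) ((-s) \<cdot>\<^sub>m transpose_mat (Y - (- (1 / s)) \<cdot>\<^sub>m X)) (0\<^sub>m m m)"
    using X Y s by (intro eq_matI) (auto simp: bip_def algebra_simps)
  moreover have "det (transpose_mat (Y - (- (1 / s)) \<cdot>\<^sub>m X)) = det (Y - (- (1 / s)) \<cdot>\<^sub>m X)"
    using X Y by (intro det_transpose[of _ m]) (auto simp: minus_carrier_mat)
  ultimately show ?thesis
    using X Y by (simp add: det_antidiagonal_blocks minus_carrier_mat)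
qed

lemma det_bip:
  assumes X: "X \<in> carrier_mat m m" and Y: "Y \<in> carrier_mat m m"
  shows "det (bip m X Y) = det Y * det X"
proof -
  have "- transpose_mat X = (-1) \<cdot>\<^sub>m transpose_mat X" using X by (intro eq_matI) auto
  then have "det (- transpose_mat X) = (-1) ^ m * det X"
    using X det_transpose[OF X] by simp
  moreover have "(-1 :: complex) ^ m * (-1) ^ m = 1" by (simp add: power_add[symmetric])
  ultimately show ?thesis
    using X Y unfolding bip_def by (subst det_antidiagonal_blocks) (auto simp: algebra_simps)
qed

lemma bip_product_of_skew:
  assumes X: "X \<in> carrier_mat m m" and Y: "Y \<in> carrier_mat m m"
    and "product_of_skew_symmetric (m + m) r (four_block_mat (transpose_mat X) (0\<^sub>m m m) (0\<^sub>m m m) Y)"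
  shows "product_of_skew_symmetric (m + m) (Suc r) (bip m X Y)"
proof -
  let ?J = "four_block_mat (0\<^sub>m m m) (1\<^sub>m m) (- transpose_mat (1\<^sub>m m)) (0\<^sub>m m m) :: complex mat"
  have J: "skew_symmetric_mat (m + m) ?J" by (rule skew_four_block[OF skew_zero skew_zero]) simp
  have "?J * four_block_mat (transpose_mat X) (0\<^sub>m m m) (0\<^sub>m m m) Y = bip m X Y"
    unfolding bip_def using X Y
    by (subst mult_four_block_mat[of _ m m _ m _ m _ _ m _ m]) (auto simp: uminus_mult_left_mat[symmetric])
  with product_of_skew_Suc J assms(3) show ?thesis by metis
qed

text \<open>The roots of \<open>det (A - t A\<^sup>T)\<close> come in pairs \<open>t, 1/t\<close>. From each pair take the root outside the
  unit circle, or in the upper half plane when the pair lies on the circle.\<close>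

lemma reciprocal_transversal:
  fixes R :: "complex set"
  assumes "finite R" "card R = 2 * m" "\<And>t. t \<in> R \<Longrightarrow> inverse t \<in> R"
    and "0 \<notin> R" "1 \<notin> R" "-1 \<notin> R"
  obtains H where "finite H" "card H = m" "0 \<notin> H" "R = H \<union> inverse ` H"
proof -
  define big where "big t \<longleftrightarrow> norm t > 1 \<or> norm t = 1 \<and> Im t > 0" for t :: complex
  define H where "H = {t\<in>R. big t}"
  have either: "big (inverse t) \<longleftrightarrow> \<not> big t" if "t \<in> R" for t
  proof -
    have t: "t \<noteq> 0" "t \<noteq> 1" "t \<noteq> -1" using that assms(4-6) by auto
    show ?thesis
    proof (cases "norm t = 1")
      case True
      then have n1: "(Re t)\<^sup>2 + (Im t)\<^sup>2 = 1" by (simp add: cmod_def)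
      have "Im t \<noteq> 0"
      proof
        assume "Im t = 0"
        with n1 have "Re t = 1 \<or> Re t = -1" by (simp add: power2_eq_1_iff)
        with \<open>Im t = 0\<close> t show False by (auto simp: complex_eq_iff)
      qed
      moreover have "Im (inverse t) = - Im t" using n1 by simp
      ultimately show ?thesis using True by (auto simp: big_def norm_inverse)
    next
      case False
      have "norm t > 0" using t by simp
      then have "inverse (norm t) > 1 \<longleftrightarrow> norm t < 1"
        by (metis inverse_inverse_eq inverse_less_1_iff less_imp_inverse_less one_less_inverse_iff)
      with False show ?thesis by (auto simp: big_def norm_inverse)
    qed
  qed
  have fin: "finite H" using assms(1) by (simp add: H_def)
  have RH: "R = H \<union> inverse ` H"
  proof
    show "R \<subseteq> H \<union> inverse ` H"
    proof
      fix t assume t: "t \<in> R"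
      show "t \<in> H \<union> inverse ` H"
      proof (cases "big t")
        case False
        then have "inverse t \<in> H" using either[OF t] assms(3)[OF t] by (simp add: H_def)
        then show ?thesis by (intro UnI2 image_eqI[of _ _ "inverse t"]) simp_all
      qed (use t in \<open>simp add: H_def\<close>)
    qed
    show "H \<union> inverse ` H \<subseteq> R" using assms(3) by (auto simp: H_def)
  qed
  have "H \<inter> inverse ` H = {}" using either by (auto simp: H_def)
  moreover have "card (inverse ` H) = card H" by (rule card_image) (auto simp: inj_on_def)
  ultimately have "card R = 2 * card H" using RH card_Un_disjoint[OF fin finite_imageI[OF fin]] by simp
  then have "card H = m" using assms(2) by simp
  moreover have "0 \<notin> H" using assms(4) by (simp add: H_def)
  ultimately show ?thesis by (rule that[OF fin _ _ RH])
qed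

text \<open>A generic \<open>A\<close> has \<open>2m\<close> distinct cosquare eigenvalues, closed under inversion and different from
  \<open>\<plusminus>1\<close>. If one from each reciprocal pair is prescribed, up to sign, for the pencil \<open>Y - t X\<close>, then \<open>bip m X Y\<close>
  has the same cosquare spectrum as \<open>A\<close> and is therefore congruent to \<open>A\<close>.\<close>

lemma certified_from_bipartite_family:
  assumes m: "m > 0" and r: "odd r"
    and fam: "\<And>H. finite H \<Longrightarrow> card H = m \<Longrightarrow> 0 \<notin> H \<Longrightarrow> \<exists>X Y. X \<in> carrier_mat m m \<and> Y \<in> carrier_mat m m \<and>
       det X \<noteq> 0 \<and> det Y \<noteq> 0 \<and> (\<forall>h\<in>H. det (Y - h \<cdot>\<^sub>m X) = 0) \<and> product_of_skew_symmetric (m + m) r (bip m X Y)"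
  shows "certified (m + m) r"
proof -
  let ?n = "m + m"
  let ?T = transpose_mat
  let ?f = "\<lambda>A. det A * det (A + (-1) \<cdot>\<^sub>m ?T A) * (det (A + 1 \<cdot>\<^sub>m ?T A) * cosquare_discriminant A)"
  have pencil: "A + (-t) \<cdot>\<^sub>m ?T A = A - t \<cdot>\<^sub>m ?T A" if "A \<in> carrier_mat ?n ?n" for A and t :: complex
    using that by (intro eq_matI) auto
  have "polyfun ?n ?f"
    by (intro polyfun_mult polyfun_det[of _ ?n] polyfun_cosquare_discriminant[of _ ?n] polymat_add
        polymat_smult polymat_transpose polymat_id)
  \<comment> \<open>The cosquare of this witness has the eigenvalues \<open>2, \<dots>, m + 1\<close> and their reciprocals.\<close>
  moreover define W where "W = bip m (- 1\<^sub>m m) (dmat m (\<lambda>i. of_nat i + 2))"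
  have Wc: "W \<in> carrier_mat ?n ?n" by (simp add: W_def)
  moreover have detW: "det W \<noteq> 0"
  proof -
    have "- 1\<^sub>m m = (-1 :: complex) \<cdot>\<^sub>m 1\<^sub>m m" by (rule eq_matI) auto
    then have "det (- 1\<^sub>m m :: complex mat) \<noteq> 0" by simp
    moreover have "of_nat i + 2 \<noteq> (0::complex)" for i
      by (metis of_nat_numeral of_nat_add of_nat_eq_0_iff add_is_0 zero_neq_numeral)
    ultimately show ?thesis by (simp add: W_def det_bip det_dmat)
  qed
  moreover have "?f W \<noteq> 0"
  proof -
    have Wroot: "det (W - s \<cdot>\<^sub>m ?T W) = (-1) ^ m * ((\<Prod>i<m. of_nat i + 2 - s) *
        ((-s) ^ m * (\<Prod>i<m. of_nat i + 2 - 1 / s)))" if "s \<noteq> 0" for s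
    proof -
      have *: "dmat m (\<lambda>i. of_nat i + 2) - (- u) \<cdot>\<^sub>m (- 1\<^sub>m m) = dmat m (\<lambda>i. of_nat i + 2 - u)" for u :: complex
        by (rule eq_matI) auto
      show ?thesis unfolding W_def by (subst det_bip_pencil[OF _ _ that]) (simp_all only: * det_dmat, auto)
    qed
    have nz: "of_nat i + 2 - (1::complex) \<noteq> 0" "of_nat i + 2 - (-1::complex) \<noteq> 0" for i
    proof -
      have "of_nat i + 2 - (1::complex) = of_nat (i + 1)" "of_nat i + 2 - (-1::complex) = of_nat (i + 3)" by simp_all
      then show "of_nat i + 2 - (1::complex) \<noteq> 0" "of_nat i + 2 - (-1::complex) \<noteq> 0"
        by (metis of_nat_eq_0_iff add_is_0 zero_neq_one zero_neq_numeral)+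
    qed
    have "det (W - 1 \<cdot>\<^sub>m ?T W) \<noteq> 0" "det (W - (-1) \<cdot>\<^sub>m ?T W) \<noteq> 0"
      using Wroot[of 1] Wroot[of "-1"] nz by simp_all
    moreover have "cosquare_discriminant W \<noteq> 0"
    proof (rule cosquare_discriminant_nonzeroI[OF Wc detW])
      define h :: "nat \<Rightarrow> complex" where
        "h i = (if i < m then of_nat i + 2 else 1 / (of_nat (i - m) + 2))" for i
      have n2: "norm (of_nat i + 2 :: complex) = of_nat i + 2" for i
        by (metis norm_of_nat of_nat_add of_nat_numeral)
      have inj2: "i = j" if "(of_nat i + 2 :: complex) = of_nat j + 2" for i j using that by simp
      show "inj_on h {..<?n}"
      proof (rule inj_onI)
        fix i j assume ij: "i \<in> {..<?n}" "j \<in> {..<?n}" "h i = h j"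
        have norms: "norm (h k) > 1 \<longleftrightarrow> k < m" for k
        proof (cases "k < m")
          case False
          define j where "j = k - m"
          have "norm (h k) = 1 / (of_nat j + 2)"
            using False by (simp only: h_def j_def[symmetric] if_False norm_divide n2 norm_one)
          with False show ?thesis by simp
        qed (simp add: h_def n2)
        from ij(3) norms[of i] norms[of j] have "i < m \<longleftrightarrow> j < m" by simp
        then show "i = j" using ij inj2 by (auto simp: h_def not_less split: if_splits)
      qed
      fix i assume i: "i < ?n"
      have "of_nat k + 2 \<noteq> (0 :: complex)" for k using n2[of k] by fastforce
      note nz2 = this[of i] this[of "i - m"]
      have "h i = of_nat i + 2 \<or> h i = 1 / (of_nat (i - m) + 2)"
        unfolding h_def by (cases "i < m") (simp_all only: if_True if_False, simp_all)
      with nz2 have "h i \<noteq> 0" by (metis divide_eq_0_iff one_neq_zero)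
      then show "det (W - h i \<cdot>\<^sub>m ?T W) = 0"
        unfolding Wroot[OF \<open>h i \<noteq> 0\<close>] using i
        by (cases "i < m") (auto simp: h_def intro!: bexI[of _ "i - m"])
    qed
    ultimately show ?thesis using detW pencil[OF Wc, of 1] pencil[OF Wc, of "-1"] by simp
  qed
  moreover have "product_of_skew_symmetric ?n r A" if A: "A \<in> carrier_mat ?n ?n" and fA: "?f A \<noteq> 0" for A
  proof -
    have dA: "det A \<noteq> 0" and dT: "det (?T A) \<noteq> 0" and AT: "?T A \<in> carrier_mat ?n ?n"
      using fA A det_transpose[OF A] by auto
    obtain h where h: "inj_on h {..<?n}" "\<And>i. i < ?n \<Longrightarrow> det (A - h i \<cdot>\<^sub>m ?T A) = 0"
      using cosquare_discriminant_nonzero_imp[OF A dA] fA by auto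
    define R where "R = h ` {..<?n}"
    have R: "t \<in> R \<longleftrightarrow> det (A - t \<cdot>\<^sub>m ?T A) = 0" for t
      using pencil_roots_exhausted[OF A AT dT h(1,2), of t] h(2) by (auto simp: R_def)
    have R1: "1 \<notin> R" "-1 \<notin> R" using fA pencil[OF A, of 1] pencil[OF A, of "-1"] by (auto simp: R)
    have "A - 0 \<cdot>\<^sub>m ?T A = A" using A by (intro eq_matI) auto
    then have R0: "0 \<notin> R" using dA by (simp add: R)
    have Rinv: "inverse t \<in> R" if "t \<in> R" for t
    proof -
      have t: "t \<noteq> 0" using R0 that by auto
      have "A - inverse t \<cdot>\<^sub>m ?T A = (- inverse t) \<cdot>\<^sub>m ?T (A - t \<cdot>\<^sub>m ?T A)"
        using A t by (intro eq_matI) (auto simp: field_simps)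
      moreover have "det (?T (A - t \<cdot>\<^sub>m ?T A)) = 0"
        using that A det_transpose[of "A - t \<cdot>\<^sub>m ?T A" ?n] by (simp add: R minus_carrier_mat)
      ultimately show ?thesis by (simp add: R)
    qed
    have "card R = 2 * m" using card_image[OF h(1)] by (simp add: R_def)
    then obtain H where H: "finite H" "card H = m" "0 \<notin> H" "R = H \<union> inverse ` H"
      using reciprocal_transversal[OF _ _ Rinv R0 R1, of m] by (auto simp: R_def)
    let ?H = "uminus ` H"
    have "card ?H = m" using H(2) by (subst card_image) auto
    have H0: "0 \<notin> ?H" using H(3) by auto
    obtain X Y where XY: "X \<in> carrier_mat m m" "Y \<in> carrier_mat m m" "det X \<noteq> 0" "det Y \<noteq> 0"
      "\<And>h. h \<in> ?H \<Longrightarrow> det (Y - h \<cdot>\<^sub>m X) = 0" "product_of_skew_symmetric ?n r (bip m X Y)"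
      using fam[OF finite_imageI[OF H(1)] \<open>card ?H = m\<close> H0] by blast
    have "det (bip m X Y - h i \<cdot>\<^sub>m ?T (bip m X Y)) = 0" if "i < ?n" for i
    proof -
      have hR: "h i \<in> R" using that by (auto simp: R_def)
      then have h0: "h i \<noteq> 0" using R0 by auto
      have "- h i \<in> ?H \<or> - (1 / h i) \<in> ?H" using hR unfolding H(4) by (auto simp: divide_inverse)
      then show ?thesis using det_bip_pencil[OF XY(1,2) h0] XY(5) by auto
    qed
    moreover have "det (bip m X Y) \<noteq> 0" using XY det_bip by simp
    ultimately obtain P Q where PQ: "P \<in> carrier_mat ?n ?n" "Q \<in> carrier_mat ?n ?n"
      "P * Q = 1\<^sub>m ?n" "Q * P = 1\<^sub>m ?n" "A = P * bip m X Y * ?T P"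
      using congruent_if_common_cosquare_spectrum[OF bip_carrier[OF XY(1,2)] _ A dA h(1) _ h(2)] by metis
    show ?thesis
      unfolding PQ(5) by (rule product_of_skew_congruence[OF XY(6) r PQ(1-4)])
  qed
  ultimately show ?thesis by (intro certifiedI[of ?n ?f W])
qed

definition diagonalized :: "nat \<Rightarrow> complex mat \<Rightarrow> (nat \<Rightarrow> complex) \<Rightarrow> bool" where
  "diagonalized n X d \<longleftrightarrow> (\<exists>P Q. P \<in> carrier_mat n n \<and> Q \<in> carrier_mat n n \<and> P * Q = 1\<^sub>m n \<and>
     Q * P = 1\<^sub>m n \<and> X = P * dmat n d * Q)"

lemma diagonalized_carrier: "diagonalized n X d \<Longrightarrow> X \<in> carrier_mat n n"
  unfolding diagonalized_def by (auto intro!: mult_carrier_mat[of _ n n _ n] simp del: assoc_mult_mat)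

lemma diagonalizedI:
  assumes "X \<in> carrier_mat n n" "P \<in> carrier_mat n n" "Q \<in> carrier_mat n n" "P * Q = 1\<^sub>m n" "X * P = P * dmat n d"
  shows "diagonalized n X d"
proof -
  have "X = X * (P * Q)" using assms by simp
  also have "\<dots> = X * P * Q" using assms(1-3) by (simp add: assoc_mult_mat[of _ n n _ n _ n])
  finally show ?thesis
    unfolding diagonalized_def assms(5) using assms mat_mult_left_right_inverse[OF assms(2-4)] by blast
qed

lemma diagonalized_transpose:
  assumes "diagonalized n X d" shows "diagonalized n (transpose_mat X) d"
proof -
  obtain P Q where P: "P \<in> carrier_mat n n" "Q \<in> carrier_mat n n" "P * Q = 1\<^sub>m n"
     "Q * P = 1\<^sub>m n" "X = P * dmat n d * Q" using assms by (auto simp: diagonalized_def)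
  have "transpose_mat (P * E * Q) = transpose_mat Q * transpose_mat E * transpose_mat P"
    if "E \<in> carrier_mat n n" for E
    using P(1,2) that by (simp add: transpose_mult[of _ n n _ n] assoc_mult_mat[of _ n n _ n _ n])
  from this[OF dmat_carrier] have "transpose_mat X = transpose_mat Q * transpose_mat (dmat n d) * transpose_mat P"
    unfolding P(5) .
  moreover have "transpose_mat (dmat n d) = dmat n d" by (rule eq_matI) auto
  moreover have "transpose_mat P * transpose_mat Q = 1\<^sub>m n" "transpose_mat Q * transpose_mat P = 1\<^sub>m n"
    using P(1-4) by (metis transpose_mult transpose_one)+
  ultimately show ?thesis unfolding diagonalized_def using P(1,2) by (metis transpose_carrier_mat)
qed

lemma diagonalized_similar:
  assumes "diagonalized n X d" "P \<in> carrier_mat n n" "Q \<in> carrier_mat n n" "P * Q = 1\<^sub>m n" "Q * P = 1\<^sub>m n"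
  shows "diagonalized n (P * X * Q) d"
proof -
  obtain P1 Q1 where P: "P1 \<in> carrier_mat n n" "Q1 \<in> carrier_mat n n" "P1 * Q1 = 1\<^sub>m n"
     "Q1 * P1 = 1\<^sub>m n" "X = P1 * dmat n d * Q1" using assms(1) by (auto simp: diagonalized_def)
  have "P * (P1 * E * Q1) * Q = (P * P1) * E * (Q1 * Q)" if "E \<in> carrier_mat n n" for E
    using P(1,2) assms(2,3) that by (simp add: assoc_mult_mat[of _ n n _ n _ n])
  from this[OF dmat_carrier] have "P * X * Q = (P * P1) * dmat n d * (Q1 * Q)" unfolding P(5) .
  moreover have "(P * P1) * (Q1 * Q) = 1\<^sub>m n" "(Q1 * Q) * (P * P1) = 1\<^sub>m n"
    using P(1-4) assms by (simp_all add: assoc_mult_mat[of _ n n _ n _ n] cancel_inverse[of _ n _ _ n])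
  ultimately show ?thesis unfolding diagonalized_def using P(1,2) assms(2,3) by (metis mult_carrier_mat)
qed

lemma diagonalized_blocks:
  assumes "diagonalized m X d" "diagonalized k Y e"
  shows "diagonalized (m + k) (four_block_mat X (0\<^sub>m m k) (0\<^sub>m k m) Y) (\<lambda>i. if i < m then d i else e (i - m))"
proof -
  obtain P Q where P: "P \<in> carrier_mat m m" "Q \<in> carrier_mat m m" "P * Q = 1\<^sub>m m"
     "Q * P = 1\<^sub>m m" "X = P * dmat m d * Q" using assms(1) by (auto simp: diagonalized_def)
  obtain R S where R: "R \<in> carrier_mat k k" "S \<in> carrier_mat k k" "R * S = 1\<^sub>m k"
     "S * R = 1\<^sub>m k" "Y = R * dmat k e * S" using assms(2) by (auto simp: diagonalized_def)
  let ?B = "\<lambda>U V. four_block_mat U (0\<^sub>m m k) (0\<^sub>m k m) V :: complex mat"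
  have D: "dmat (m + k) (\<lambda>i. if i < m then d i else e (i - m)) = ?B (dmat m d) (dmat k e)"
    by (rule eq_matI) auto
  have mult: "?B U V * ?B U' V' = ?B (U * U') (V * V')"
    if "U \<in> carrier_mat m m" "U' \<in> carrier_mat m m" "V \<in> carrier_mat k k" "V' \<in> carrier_mat k k" for U U' V V'
    using that by (subst mult_four_block_mat[of _ m m _ k _ k _ _ m _ k]) auto
  have one: "?B (1\<^sub>m m) (1\<^sub>m k) = 1\<^sub>m (m + k)" by (rule eq_matI) auto
  have "?B X Y = ?B P R * ?B (dmat m d) (dmat k e) * ?B Q S"
    unfolding P(5) R(5) by (subst mult; (subst mult)?; (use P(1,2) R(1,2) in \<open>auto intro!: mult_carrier_mat[of _ m m _ m] mult_carrier_mat[of _ k k _ k] simp del: assoc_mult_mat\<close>)?)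
  moreover have "?B P R * ?B Q S = 1\<^sub>m (m + k)" "?B Q S * ?B P R = 1\<^sub>m (m + k)"
    using P(1-4) R(1-4) by (simp_all add: mult one)
  ultimately show ?thesis
    unfolding diagonalized_def D using P(1,2) R(1,2) by (meson four_block_carrier_mat)
qed

lemma diagonalized_product_of_two_skew:
  assumes "diagonalized n X d"
    and "\<And>i. i < n \<Longrightarrow> \<sigma> i < n \<and> \<sigma> i \<noteq> i \<and> \<sigma> (\<sigma> i) = i \<and> d (\<sigma> i) = d i"
  shows "product_of_skew_symmetric n 2 X"
proof -
  obtain P Q where P: "P \<in> carrier_mat n n" "Q \<in> carrier_mat n n" "P * Q = 1\<^sub>m n"
     "Q * P = 1\<^sub>m n" "X = P * dmat n d * Q" using assms(1) by (auto simp: diagonalized_def)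
  show ?thesis unfolding P(5)
    by (rule product_of_skew_similar[OF paired_diagonal_product_of_two_skew[of n \<sigma> d] _ P(1-4)])
       (use assms(2) in auto)
qed

lemma det_diagonalized: "diagonalized n X d \<Longrightarrow> det X = (\<Prod>i<n. d i)"
proof -
  assume "diagonalized n X d"
  then obtain P Q where P: "P \<in> carrier_mat n n" "Q \<in> carrier_mat n n" "P * Q = 1\<^sub>m n"
     "Q * P = 1\<^sub>m n" "X = P * dmat n d * Q" by (auto simp: diagonalized_def)
  have "det (P * E * Q) = det P * det E * det Q" if "E \<in> carrier_mat n n" for E
    using P(1,2) that by (simp add: det_mult[of _ n] del: assoc_mult_mat)
  from this[OF dmat_carrier] have "det X = det P * (\<Prod>i<n. d i) * det Q" unfolding P(5) det_dmat .
  moreover have "det P * det Q = 1" using det_mult[OF P(1,2)] P(3) by simp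
  ultimately show ?thesis by (metis mult.assoc mult.commute mult_1_right)
qed

section \<open>Three factors in even dimension at least eight\<close>

lemma diagonalized_shift:
  assumes "diagonalized n X d" shows "diagonalized n (X - b \<cdot>\<^sub>m 1\<^sub>m n) (\<lambda>i. d i - b)"
proof -
  obtain P Q where P: "P \<in> carrier_mat n n" "Q \<in> carrier_mat n n" "P * Q = 1\<^sub>m n"
     "Q * P = 1\<^sub>m n" "X = P * dmat n d * Q" using assms by (auto simp: diagonalized_def)
  have X: "X \<in> carrier_mat n n" by (rule diagonalized_carrier[OF assms])
  have "P * E * Q * P = P * E" if "E \<in> carrier_mat n n" for E
    using P(1,2,4) that by (simp add: assoc_mult_mat[of _ n n _ n _ n])
  from this[OF dmat_carrier] have XP: "X * P = P * dmat n d" unfolding P(5) .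
  have "(X - b \<cdot>\<^sub>m 1\<^sub>m n) * P = X * P - b \<cdot>\<^sub>m P"
    using X P(1) by (simp add: minus_mult_distrib_mat[of _ n n _ _ n] mult_smult_assoc_mat[of _ n n _ n])
  also have "\<dots> = P * dmat n (\<lambda>i. d i - b)"
    unfolding XP using P(1)
    by (intro eq_matI) (auto simp: mult_dmat_index[OF P(1)] algebra_simps simp del: index_mult_mat(1))
  finally show ?thesis
    using X by (intro diagonalizedI[OF _ P(1-3)]) (auto simp: minus_carrier_mat)
qed

text \<open>Since \<open>b\<close> is not an eigenvalue of \<open>X\<close>, the row \<open>v\<close> is of the form \<open>w (X - b)\<close>, and conjugation by
  the unipotent matrix with row \<open>w\<close> removes it.\<close>

lemma diagonalized_border_lower:
  assumes X: "diagonalized m X d" and v: "v \<in> carrier_mat 1 m" and b: "\<And>i. i < m \<Longrightarrow> d i \<noteq> b"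
  shows "diagonalized (Suc m) (four_block_mat X (0\<^sub>m m 1) v (b \<cdot>\<^sub>m 1\<^sub>m 1)) (\<lambda>i. if i < m then d i else b)"
proof -
  have Xc: "X \<in> carrier_mat m m" by (rule diagonalized_carrier[OF X])
  have "det (X - b \<cdot>\<^sub>m 1\<^sub>m m) \<noteq> 0" using det_diagonalized[OF diagonalized_shift[OF X]] b by simp
  then obtain X' where X': "X' \<in> carrier_mat m m" "X' * (X - b \<cdot>\<^sub>m 1\<^sub>m m) = 1\<^sub>m m"
    using right_inverse_exists[of "X - b \<cdot>\<^sub>m 1\<^sub>m m" m] by (metis minus_carrier_mat one_carrier_mat smult_carrier_mat)
  define w where "w = v * X'"
  have w: "w \<in> carrier_mat 1 m" using v X' by (simp add: w_def)
  have "w * (X - b \<cdot>\<^sub>m 1\<^sub>m m) = v * (X' * (X - b \<cdot>\<^sub>m 1\<^sub>m m))"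
    unfolding w_def by (rule assoc_mult_mat[OF v X'(1), of _ m]) (simp add: minus_carrier_mat)
  also have "\<dots> = v" using X' v by simp
  finally have wX: "w * X - b \<cdot>\<^sub>m w = v"
    using w Xc by (simp add: mult_minus_distrib_mat[of _ 1 m _ m] mult_smult_distrib[of _ 1 m _ m])
  define P where "P = four_block_mat (1\<^sub>m m) (0\<^sub>m m 1) w (1\<^sub>m 1)"
  define Q where "Q = four_block_mat (1\<^sub>m m) (0\<^sub>m m 1) (- w) (1\<^sub>m 1)"
  have PQc: "P \<in> carrier_mat (Suc m) (Suc m)" "Q \<in> carrier_mat (Suc m) (Suc m)"
    using w by (auto simp: P_def Q_def)
  have one: "four_block_mat (1\<^sub>m m) (0\<^sub>m m 1) (0\<^sub>m 1 m) (1\<^sub>m 1) = (1\<^sub>m (Suc m) :: complex mat)"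
    by (rule eq_matI) auto
  have "- w + w = 0\<^sub>m 1 m" "w + - w = 0\<^sub>m 1 m" using w by (auto simp: mat_eq_iff)
  moreover have "- 0\<^sub>m m m = (0\<^sub>m m m :: complex mat)" by (rule eq_matI) auto
  ultimately have PQ: "P * Q = 1\<^sub>m (Suc m)" "Q * P = 1\<^sub>m (Suc m)"
    unfolding P_def Q_def using w one
    by (subst mult_four_block_mat[of _ m m _ 1 _ 1 _ _ m _ 1]; simp)+
  let ?D = "four_block_mat X (0\<^sub>m m 1) (0\<^sub>m 1 m) (b \<cdot>\<^sub>m 1\<^sub>m 1)"
  have "diagonalized 1 (b \<cdot>\<^sub>m 1\<^sub>m 1) (\<lambda>i. b)"
    unfolding diagonalized_def
    by (intro exI[of _ "1\<^sub>m 1"]) (auto simp: mat_eq_iff)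
  from diagonalized_blocks[OF X this] have "diagonalized (Suc m) ?D (\<lambda>i. if i < m then d i else b)" by simp
  from diagonalized_similar[OF this PQc PQ]
  have "diagonalized (Suc m) (P * ?D * Q) (\<lambda>i. if i < m then d i else b)" .
  also have "P * ?D = four_block_mat X (0\<^sub>m m 1) (w * X) (b \<cdot>\<^sub>m 1\<^sub>m 1)"
    unfolding P_def using w Xc
    by (subst mult_four_block_mat[of _ m m _ 1 _ 1 _ _ m _ 1]) (auto simp: mat_eq_iff)
  also have "\<dots> * Q = four_block_mat X (0\<^sub>m m 1) (w * X + (b \<cdot>\<^sub>m 1\<^sub>m 1) * (- w)) (b \<cdot>\<^sub>m 1\<^sub>m 1)"
    unfolding Q_def using w Xc
    by (subst mult_four_block_mat[of _ m m _ 1 _ 1 _ _ m _ 1]) (auto simp: mat_eq_iff)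
  also have "w * X + (b \<cdot>\<^sub>m 1\<^sub>m 1) * (- w) = w * X - b \<cdot>\<^sub>m w"
    using w Xc by (subst mult_smult_assoc_mat[of _ 1 1 _ m]) (auto simp: mat_eq_iff)
  also note wX
  finally show ?thesis .
qed

lemma diagonalized_border_upper:
  assumes Y: "diagonalized m Y d" and u: "u \<in> carrier_mat m 1" and b: "\<And>i. i < m \<Longrightarrow> d i \<noteq> b"
  shows "diagonalized (Suc m) (four_block_mat Y u (0\<^sub>m 1 m) (b \<cdot>\<^sub>m 1\<^sub>m 1)) (\<lambda>i. if i < m then d i else b)"
proof -
  have Yc: "Y \<in> carrier_mat m m" by (rule diagonalized_carrier[OF Y])
  have "diagonalized (Suc m) (four_block_mat (transpose_mat Y) (0\<^sub>m m 1) (transpose_mat u) (b \<cdot>\<^sub>m 1\<^sub>m 1))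
     (\<lambda>i. if i < m then d i else b)"
    by (rule diagonalized_border_lower[OF diagonalized_transpose[OF Y] _ b]) (use u in auto)
  from diagonalized_transpose[OF this]
  have "diagonalized (Suc m) (transpose_mat (four_block_mat (transpose_mat Y) (0\<^sub>m m 1) (transpose_mat u) (b \<cdot>\<^sub>m 1\<^sub>m 1)))
     (\<lambda>i. if i < m then d i else b)" .
  also have "transpose_mat (four_block_mat (transpose_mat Y) (0\<^sub>m m 1) (transpose_mat u) (b \<cdot>\<^sub>m 1\<^sub>m 1)) =
     four_block_mat Y u (0\<^sub>m 1 m) (b \<cdot>\<^sub>m 1\<^sub>m 1)"
    using Yc u by (intro eq_matI) auto
  finally show ?thesis .
qed

text \<open>The kernel vector is \<open>R z\<close> followed by \<open>\<delta>\<close>. The hypothesis on \<open>z\<close> is the vanishing of the first \<open>m\<close>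
  components, written in an eigenbasis \<open>R\<close> of the pencil; the next one is the last component.\<close>

lemma bordered_pencil_singular:
  fixes X Y R S :: "complex mat"
  assumes c: "X \<in> carrier_mat m m" "Y \<in> carrier_mat m m" "R \<in> carrier_mat m m" "S \<in> carrier_mat m m"
    and SR: "S * R = 1\<^sub>m m" and YR: "Y * R = X * R * dmat m h"
    and z: "\<And>i. i < m \<Longrightarrow> (h i - t) * z i + \<delta> = 0"
    and last: "b * (1 - t) * \<delta> - t * (\<Sum>i<m. w i * z i) = 0"
    and nz: "\<delta> \<noteq> 0 \<or> (\<exists>i<m. z i \<noteq> 0)"
  shows "det (four_block_mat Y (X * R * mat m 1 (\<lambda>_. 1)) (0\<^sub>m 1 m) (b \<cdot>\<^sub>m 1\<^sub>m 1) -
     t \<cdot>\<^sub>m four_block_mat X (0\<^sub>m m 1) (mat 1 m (\<lambda>(_, i). w i) * S) (b \<cdot>\<^sub>m 1\<^sub>m 1)) = 0"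
proof -
  have z': "h i * z i + \<delta> = t * z i" if "i < m" for i
  proof -
    have "h i * z i + \<delta> - t * z i = 0" using z[OF that] by (simp add: algebra_simps)
    then show ?thesis by simp
  qed
  define u where "u = X * R * mat m 1 (\<lambda>_. 1)"
  define v where "v = mat 1 m (\<lambda>(_, i). w i) * S"
  have uc: "u \<in> carrier_mat m 1" and vc: "v \<in> carrier_mat 1 m" using c by (auto simp: u_def v_def)
  define Z where "Z = R *\<^sub>v vec m z"
  have Zc: "Z \<in> carrier_vec m" using c by (simp add: Z_def)
  let ?Y = "four_block_mat Y u (0\<^sub>m 1 m) (b \<cdot>\<^sub>m 1\<^sub>m 1)" and ?X = "four_block_mat X (0\<^sub>m m 1) v (b \<cdot>\<^sub>m 1\<^sub>m 1)"
  let ?e = "vec 1 (\<lambda>_. \<delta>)"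
  have XR: "X * R \<in> carrier_mat m m" using c by simp
  have "?Y *\<^sub>v (Z @\<^sub>v ?e) = (Y *\<^sub>v Z + u *\<^sub>v ?e) @\<^sub>v (0\<^sub>m 1 m *\<^sub>v Z + (b \<cdot>\<^sub>m 1\<^sub>m 1) *\<^sub>v ?e)"
    by (rule four_block_mat_mult_vec[of _ m m _ 1 _ 1]) (use c uc Zc in auto)
  moreover have "?X *\<^sub>v (Z @\<^sub>v ?e) = (X *\<^sub>v Z + 0\<^sub>m m 1 *\<^sub>v ?e) @\<^sub>v (v *\<^sub>v Z + (b \<cdot>\<^sub>m 1\<^sub>m 1) *\<^sub>v ?e)"
    by (rule four_block_mat_mult_vec[of _ m m _ 1 _ 1]) (use c vc Zc in auto)
  moreover have "Y *\<^sub>v Z + u *\<^sub>v ?e = t \<cdot>\<^sub>v (X *\<^sub>v Z + 0\<^sub>m m 1 *\<^sub>v ?e)"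
  proof -
    have "Y *\<^sub>v Z = (Y * R) *\<^sub>v vec m z" unfolding Z_def using c by simp
    also have "\<dots> = (X * R) *\<^sub>v (dmat m h *\<^sub>v vec m z)"
      unfolding YR by (rule assoc_mult_mat_vec[OF XR]) auto
    also have "dmat m h *\<^sub>v vec m z = vec m (\<lambda>i. h i * z i)"
      by (intro eq_vecI) (auto simp: scalar_prod_def if_distrib if_distribR sum.delta cong: if_cong)
    finally have 1: "Y *\<^sub>v Z = (X * R) *\<^sub>v vec m (\<lambda>i. h i * z i)" .
    have 2: "u *\<^sub>v ?e = (X * R) *\<^sub>v vec m (\<lambda>i. \<delta>)"
    proof -
      have "u *\<^sub>v ?e = (X * R) *\<^sub>v (mat m 1 (\<lambda>_. 1) *\<^sub>v ?e)"
        unfolding u_def by (rule assoc_mult_mat_vec[OF XR]) auto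
      also have "mat m 1 (\<lambda>_. 1) *\<^sub>v ?e = vec m (\<lambda>i. \<delta>)"
        by (intro eq_vecI) (auto simp: scalar_prod_def)
      finally show ?thesis .
    qed
    have 3: "X *\<^sub>v Z = (X * R) *\<^sub>v vec m z" unfolding Z_def using c by simp
    have "(X * R) *\<^sub>v vec m (\<lambda>i. h i * z i) + (X * R) *\<^sub>v vec m (\<lambda>i. \<delta>) =
        (X * R) *\<^sub>v (vec m (\<lambda>i. h i * z i) + vec m (\<lambda>i. \<delta>))"
      by (rule mult_add_distrib_mat_vec[OF XR, symmetric]) auto
    also have "vec m (\<lambda>i. h i * z i) + vec m (\<lambda>i. \<delta>) = t \<cdot>\<^sub>v vec m z"
      using z' by (intro eq_vecI) simp_all
    also have "(X * R) *\<^sub>v (t \<cdot>\<^sub>v vec m z) = t \<cdot>\<^sub>v ((X * R) *\<^sub>v vec m z)"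
      by (rule mult_mat_vec[OF XR]) auto
    finally have "Y *\<^sub>v Z + u *\<^sub>v ?e = t \<cdot>\<^sub>v (X *\<^sub>v Z)" unfolding 1 2 3 .
    moreover have "X *\<^sub>v Z + 0\<^sub>m m 1 *\<^sub>v ?e = X *\<^sub>v Z"
      using c Zc by (intro eq_vecI) (auto simp: scalar_prod_def)
    ultimately show ?thesis by simp
  qed
  moreover have "0\<^sub>m 1 m *\<^sub>v Z + (b \<cdot>\<^sub>m 1\<^sub>m 1) *\<^sub>v ?e = t \<cdot>\<^sub>v (v *\<^sub>v Z + (b \<cdot>\<^sub>m 1\<^sub>m 1) *\<^sub>v ?e)"
  proof -
    have "v *\<^sub>v Z = mat 1 m (\<lambda>(_, i). w i) *\<^sub>v (S *\<^sub>v Z)"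
      unfolding v_def using c Zc by (intro assoc_mult_mat_vec[of _ 1 m _ m]) auto
    also have "S *\<^sub>v Z = (S * R) *\<^sub>v vec m z"
      unfolding Z_def using c by simp
    also have "\<dots> = vec m z" by (simp add: SR)
    finally have "(v *\<^sub>v Z) $ 0 = (\<Sum>i<m. w i * z i)"
      by (simp add: scalar_prod_def atLeast0LessThan)
    moreover have "b * (1 - t) * \<delta> - t * s = b * \<delta> - t * (s + b * \<delta>)" for s
      by (simp add: algebra_simps)
    ultimately have e: "b * \<delta> = t * ((v *\<^sub>v Z) $ 0 + b * \<delta>)" using last by simp
    have l: "(0\<^sub>m 1 m *\<^sub>v Z + (b \<cdot>\<^sub>m 1\<^sub>m 1) *\<^sub>v ?e) $ 0 = b * \<delta>"
      using Zc by (simp add: scalar_prod_def)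
    have r: "(t \<cdot>\<^sub>v (v *\<^sub>v Z + (b \<cdot>\<^sub>m 1\<^sub>m 1) *\<^sub>v ?e)) $ 0 = t * ((v *\<^sub>v Z) $ 0 + b * \<delta>)"
      using vc by (simp add: scalar_prod_def)
    show ?thesis
    proof (rule eq_vecI)
      fix i assume "i < dim_vec (t \<cdot>\<^sub>v (v *\<^sub>v Z + (b \<cdot>\<^sub>m 1\<^sub>m 1) *\<^sub>v ?e))"
      then have "i = 0" by simp
      then show "(0\<^sub>m 1 m *\<^sub>v Z + (b \<cdot>\<^sub>m 1\<^sub>m 1) *\<^sub>v ?e) $ i =
          (t \<cdot>\<^sub>v (v *\<^sub>v Z + (b \<cdot>\<^sub>m 1\<^sub>m 1) *\<^sub>v ?e)) $ i"
        using l r e by metis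
    qed simp
  qed
  ultimately have "?Y *\<^sub>v (Z @\<^sub>v ?e) = t \<cdot>\<^sub>v (?X *\<^sub>v (Z @\<^sub>v ?e))"
    using c Zc vc by (auto simp: vec_eq_iff append_vec_def)
  moreover have "Z @\<^sub>v ?e \<in> carrier_vec (Suc m)" using append_carrier_vec[OF Zc, of ?e 1] by simp
  moreover have "Z @\<^sub>v ?e \<noteq> 0\<^sub>v (Suc m)"
  proof
    assume 0: "Z @\<^sub>v ?e = 0\<^sub>v (Suc m)"
    have "(Z @\<^sub>v ?e) $ m = \<delta>" using Zc by simp
    with 0 have "\<delta> = 0" by simp
    have "Z $ i = 0" if "i < m" for i
    proof -
      have "(Z @\<^sub>v ?e) $ i = Z $ i" using Zc that by simp
      with 0 that show ?thesis by simp
    qed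
    then have "Z = 0\<^sub>v m" using Zc by (auto simp: vec_eq_iff)
    moreover have "S *\<^sub>v Z = vec m z" unfolding Z_def using c SR
      by (metis assoc_mult_mat_vec one_mult_mat_vec vec_carrier)
    ultimately have "vec m z = 0\<^sub>v m" using c by (auto simp: vec_eq_iff scalar_prod_def)
    then have "z i = 0" if "i < m" for i using that by (metis index_vec index_zero_vec(1))
    with nz \<open>\<delta> = 0\<close> show False by auto
  qed
  moreover have "?Y \<in> carrier_mat (Suc m) (Suc m)" "?X \<in> carrier_mat (Suc m) (Suc m)"
    using c uc vc by auto
  ultimately show ?thesis
    using pencil_kernel_vector[of ?Y "Suc m" ?X t] unfolding u_def v_def by blast
qed

text \<open>With \<open>F = \<Prod>(t - h i)\<close> this expands \<open>G / F\<close> as \<open>t - 1\<close> plus \<open>t\<close> times simple fractions, which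
  requires \<open>G / F = -1\<close> at \<open>t = 0\<close>; this is the product condition. Multiplied out, the left side has degree
  at most \<open>m\<close> and vanishes at \<open>0\<close> and at the \<open>h i\<close>.\<close>

lemma interpolation_identity:
  fixes h :: "nat \<Rightarrow> complex"
  assumes inj: "inj_on h {..<m}" and h0: "\<And>i. i < m \<Longrightarrow> h i \<noteq> 0"
    and K: "finite K" "card K = Suc m" and pr: "(\<Prod>i<m. h i) = (\<Prod>k\<in>K. k)"
  defines "G \<equiv> \<lambda>t. \<Prod>k\<in>K. t - k" and "F \<equiv> \<lambda>i t. \<Prod>j\<in>{..<m} - {i}. t - h j"
  shows "(1 - t) * (\<Prod>i<m. t - h i) - t * (\<Sum>i<m. G (h i) / (h i * F i (h i)) * F i t) + G t = 0"
proof -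
  define w where "w i = G (h i) / (h i * F i (h i))" for i
  define pF where "pF = (\<Prod>i<m. [:- h i, 1:])"
  define pG where "pG = (\<Prod>k\<in>K. [:- k, 1:])"
  define p where "p i = (\<Prod>j\<in>{..<m} - {i}. [:- h j, 1:])" for i
  define s where "s = (\<Sum>i<m. smult (w i) (p i))"
  define L where "L = [:1, -1:] * pF - [:0, 1:] * s + pG"
  have ev: "poly pF t = (\<Prod>i<m. t - h i)" "poly pG t = G t" "poly (p i) t = F i t" for t i
    by (simp_all add: pF_def pG_def p_def G_def F_def poly_prod)
  have polyL: "poly L t = (1 - t) * (\<Prod>i<m. t - h i) - t * (\<Sum>i<m. w i * F i t) + G t" for t
    by (simp add: L_def ev s_def poly_sum algebra_simps)
  have dF: "degree pF = m" "lead_coeff pF = 1"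
    by (simp add: pF_def degree_prod_eq_sum_degree, unfold pF_def lead_coeff_prod, simp)
  have dG: "degree pG = Suc m" "lead_coeff pG = 1"
    using K by (simp add: pG_def degree_prod_eq_sum_degree, unfold pG_def lead_coeff_prod, simp)
  have dp: "degree (p i) < m" if "i < m" for i
    using that by (simp add: p_def degree_prod_eq_sum_degree)
  have cs: "coeff s k = 0" if "k \<ge> m" for k
  proof -
    have "coeff (p i) k = 0" if "i < m" for i using dp[OF that] \<open>k \<ge> m\<close> by (intro coeff_eq_0) simp
    then show ?thesis by (simp add: s_def coeff_sum)
  qed
  have cL: "coeff L k = 0" if "k \<ge> Suc m" for k
  proof -
    obtain j where j: "k = Suc j" "j \<ge> m" using \<open>Suc m \<le> k\<close> by (metis Suc_le_D Suc_le_mono)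
    have "coeff L k = coeff pF (Suc j) - coeff pF j - coeff s j + coeff pG (Suc j)"
      by (simp add: L_def j)
    also have "coeff pF (Suc j) = 0" using dF j by (intro coeff_eq_0) simp
    also have "coeff s j = 0" by (rule cs[OF j(2)])
    also have "coeff pG (Suc j) = coeff pF j"
    proof (cases "j = m")
      case True then show ?thesis using dF dG by simp
    next
      case False
      then show ?thesis using dF dG j by (simp add: coeff_eq_0)
    qed
    finally show ?thesis by simp
  qed
  have "L = 0"
  proof (rule ccontr)
    assume L0: "L \<noteq> 0"
    have dL: "degree L \<le> m" by (rule degree_le) (use cL in auto)
    have "poly L 0 = 0"
    proof -
      have "(\<Prod>i<m. 0 - h i) = (-1) ^ m * (\<Prod>i<m. h i)" by (simp add: prod_uminus)
      moreover have "G 0 = (-1) ^ Suc m * (\<Prod>k\<in>K. k)" using K by (simp add: G_def prod_uminus)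
      ultimately show ?thesis by (simp add: polyL pr)
    qed
    moreover have "poly L (h i) = 0" if i: "i < m" for i
    proof -
      have "(\<Prod>j<m. h i - h j) = 0" using i by auto
      moreover have "(\<Sum>j<m. w j * F j (h i)) = (\<Sum>j<m. if j = i then w i * F i (h i) else 0)"
      proof (rule sum.cong)
        fix j assume "j \<in> {..<m}"
        then show "w j * F j (h i) = (if j = i then w i * F i (h i) else 0)"
          using i by (auto simp: F_def)
      qed simp
      moreover have "F i (h i) \<noteq> 0" using inj i by (auto simp: F_def inj_on_def)
      ultimately show ?thesis using i h0[OF i] by (simp add: polyL w_def)
    qed
    ultimately have sub: "insert 0 (h ` {..<m}) \<subseteq> {x. poly L x = 0}" by auto
    have "0 \<notin> h ` {..<m}" using h0 by force
    then have "card (insert 0 (h ` {..<m})) = Suc m" using card_image[OF inj] by simp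
    then have "Suc m \<le> degree L"
      using card_mono[OF poly_roots_finite[OF L0] sub] card_poly_roots_bound[OF L0] by simp
    with dL show False by simp
  qed
  with polyL[of t] show ?thesis by (simp add: w_def)
qed

text \<open>The union of the spectra of \<open>X\<close> and \<open>Y\<close> has even multiplicities, which makes \<open>diag(X\<^sup>T, Y)\<close> a
  product of two skew symmetric matrices. Eigenvalues shared by \<open>X\<close> and \<open>Y\<close> alone would force
  \<open>det X = det Y\<close> and thus fix the product of the roots of \<open>det (Y - t X)\<close>. The double eigenvalues \<open>dx 0\<close>
  of \<open>X\<close> and \<open>dy 0\<close> of \<open>Y\<close> leave this product free.\<close>

definition skew_pencil :: "nat \<Rightarrow> complex set \<Rightarrow> bool" where
  "skew_pencil m H \<longleftrightarrow> (\<exists>X Y dx dy. diagonalized m X dx \<and> diagonalized m Y dy \<and>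
     dx 0 = dx 1 \<and> dy 0 = dy 1 \<and> (\<forall>i. 2 \<le> i \<longrightarrow> i < m \<longrightarrow> dx i = dy i) \<and>
     (\<forall>i<m. dx i \<noteq> 0 \<and> dy i \<noteq> 0) \<and> (\<forall>h\<in>H. det (Y - h \<cdot>\<^sub>m X) = 0))"

lemma skew_pencilI:
  assumes "diagonalized m X dx" "diagonalized m Y dy" "dx 0 = dx 1" "dy 0 = dy 1"
    and "\<forall>i. 2 \<le> i \<longrightarrow> i < m \<longrightarrow> dx i = dy i" "\<forall>i<m. dx i \<noteq> 0 \<and> dy i \<noteq> 0"
    and "\<And>h. h \<in> H \<Longrightarrow> det (Y - h \<cdot>\<^sub>m X) = 0"
  shows "skew_pencil m H"
  unfolding skew_pencil_def
  by (rule exI[of _ X], rule exI[of _ Y], rule exI[of _ dx], rule exI[of _ dy]) (use assms in simp)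

lemma distinct_numbers_with_given_product:
  assumes "m \<ge> 2" and c: "c \<noteq> 0"
  obtains h :: "nat \<Rightarrow> complex" where "inj_on h {..<m}" "\<And>i. i < m \<Longrightarrow> h i \<noteq> 0" "(\<Prod>i<m. h i) = c"
proof -
  obtain k where m: "m = Suc (Suc k)" using assms(1) by (metis add_2_eq_Suc le_Suc_ex)
  define C where "C = (\<Prod>i<k. of_nat (Suc i) :: complex)"
  have C1: "norm C \<ge> 1" unfolding C_def prod_norm[symmetric]
    by (rule prod_ge_1) (simp del: of_nat_Suc add: norm_of_nat)
  then have C0: "C \<noteq> 0" by auto
  \<comment> \<open>The numbers are \<open>1, \<dots>, k\<close>, a large \<open>y\<close>, and the remaining quotient, which has norm below 1.\<close>
  obtain y :: nat where y: "real y > real k + norm c" using reals_Archimedean2 by blast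
  then have y0: "y > k" using norm_ge_zero[of c] by (metis add_increasing2 le_less_trans of_nat_less_iff order_refl)
  define z where "z = c / (C * of_nat y)"
  have yk: "real y > 0" using y0 by simp
  have "norm z \<le> norm c / real y"
    using C1 yk mult_right_mono[of 1 "norm C" "real y"]
    by (auto simp: z_def norm_divide norm_mult intro!: divide_left_mono mult_pos_pos)
  also have "\<dots> < 1" using y yk by (simp add: divide_less_eq)
  finally have z1: "norm z < 1" .
  have z0: "z \<noteq> 0" using c C0 yk by (simp add: z_def)
  define h where "h i = (if i < k then of_nat (Suc i) else if i = k then of_nat y else z)" for i
  have nat_ne: "of_nat j \<noteq> z" if "j > 0" for j
  proof
    assume "of_nat j = z"
    then have "norm z = real j" by (metis norm_of_nat)
    with z1 that show False by simp
  qed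
  have "inj_on h {..<m}"
  proof (rule inj_onI)
    fix i j assume ij: "i \<in> {..<m}" "j \<in> {..<m}" "h i = h j"
    show "i = j"
      using ij y0 nat_ne[of "Suc i"] nat_ne[of "Suc j"] nat_ne[of y]
      by (auto simp: h_def m less_Suc_eq simp del: of_nat_Suc split: if_splits)
  qed
  moreover have "h i \<noteq> 0" for i using y0 z0 by (auto simp: h_def simp del: of_nat_Suc)
  moreover have "(\<Prod>i<m. h i) = c"
  proof -
    have "(\<Prod>i<k. h i) = C" unfolding C_def by (rule prod.cong) (auto simp: h_def)
    then show ?thesis using C0 yk by (simp add: m h_def z_def)
  qed
  ultimately show ?thesis using that by blast
qed

text \<open>Border a pencil with roots \<open>h i\<close> by a common new eigenvalue \<open>b\<close>. The determinant of the bordered pencil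
  is \<open>b (1 - t)\<close> times the old one plus \<open>t\<close> times a polynomial of degree less than \<open>m\<close>, which the bordering
  row and column prescribe freely. Hence all roots can be prescribed, provided that the constant and
  leading coefficients match; this is the equality of the products of the old and new roots.\<close>

lemma skew_pencil_Suc:
  assumes m: "m \<ge> 2" and IH: "\<And>H. finite H \<Longrightarrow> card H = m \<Longrightarrow> 0 \<notin> H \<Longrightarrow> skew_pencil m H"
    and K: "finite K" "card K = Suc m" "0 \<notin> K"
  shows "skew_pencil (Suc m) K"
proof -
  have "(\<Prod>k\<in>K. k) \<noteq> 0" using K by auto
  then obtain h where h: "inj_on h {..<m}" "\<And>i. i < m \<Longrightarrow> h i \<noteq> 0" "(\<Prod>i<m. h i) = (\<Prod>k\<in>K. k)"
    using distinct_numbers_with_given_product[OF m] by metis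
  have "skew_pencil m (h ` {..<m})"
    by (rule IH) (use h card_image[OF h(1)] in force)+
  then obtain X Y dx dy where XY: "diagonalized m X dx" "diagonalized m Y dy" "dx 0 = dx 1" "dy 0 = dy 1"
    "\<And>i. 2 \<le> i \<Longrightarrow> i < m \<Longrightarrow> dx i = dy i" "\<And>i. i < m \<Longrightarrow> dx i \<noteq> 0 \<and> dy i \<noteq> 0"
    "\<And>i. i < m \<Longrightarrow> det (Y - h i \<cdot>\<^sub>m X) = 0"
    unfolding skew_pencil_def by auto
  note Xc = diagonalized_carrier[OF XY(1)] and Yc = diagonalized_carrier[OF XY(2)]
  have "det X \<noteq> 0" using det_diagonalized[OF XY(1)] XY(6) by simp
  then obtain R S where R: "R \<in> carrier_mat m m" "S \<in> carrier_mat m m" "R * S = 1\<^sub>m m" "S * R = 1\<^sub>m m"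
    "Y * R = X * R * dmat m h"
    using pencil_eigenbasis[OF Yc Xc _ h(1) XY(7)] by metis
  have "finite (insert 0 (dx ` {..<m} \<union> dy ` {..<m}))" by simp
  then obtain b where b: "b \<notin> insert 0 (dx ` {..<m} \<union> dy ` {..<m})"
    using ex_new_if_finite[OF infinite_UNIV_char_0] by metis
  define G where "G t = (\<Prod>k\<in>K. t - k)" for t
  define F where "F i t = (\<Prod>j\<in>{..<m} - {i}. t - h j)" for i t
  \<comment> \<open>A root of the new polynomial that is also an old root gets weight \<open>0\<close>.\<close>
  define w where "w i = b * (G (h i) / (h i * F i (h i)))" for i
  define X' where "X' = four_block_mat X (0\<^sub>m m 1) (mat 1 m (\<lambda>(_, i). w i) * S) (b \<cdot>\<^sub>m 1\<^sub>m 1)"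
  define Y' where "Y' = four_block_mat Y (X * R * mat m 1 (\<lambda>_. 1)) (0\<^sub>m 1 m) (b \<cdot>\<^sub>m 1\<^sub>m 1)"
  let ?ext = "\<lambda>d i. if i < m then d i else b"
  have "diagonalized (Suc m) X' (?ext dx)"
    unfolding X'_def by (rule diagonalized_border_lower[OF XY(1)]) (use R b in auto)
  moreover have "diagonalized (Suc m) Y' (?ext dy)"
    unfolding Y'_def by (rule diagonalized_border_upper[OF XY(2)]) (use R Xc b in auto)
  moreover have "det (Y' - t \<cdot>\<^sub>m X') = 0" if t: "t \<in> K" for t
  proof (cases "\<exists>k<m. t = h k")
    case True
    then obtain k where k: "k < m" "t = h k" by auto
    have "G t = 0" using t K(1) by (auto simp: G_def)
    then have wk: "w k = 0" by (simp add: w_def k)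
    define z where "z i = (if i = k then 1 else 0 :: complex)" for i
    have "(\<Sum>i<m. w i * z i) = 0" by (rule sum.neutral) (use wk in \<open>auto simp: z_def\<close>)
    then show ?thesis unfolding X'_def Y'_def using k
      by (intro bordered_pencil_singular[OF Xc Yc R(1,2,4,5), of t z 0]) (auto simp: z_def)
  next
    case False
    define z where "z i = 1 / (t - h i)" for i
    have nz: "t - h i \<noteq> 0" if "i < m" for i using False that by auto
    define Q where "Q = (\<Prod>i<m. t - h i)"
    have Q0: "Q \<noteq> 0" using nz by (simp add: Q_def)
    have FQ: "F i t = Q * z i" if "i < m" for i
    proof -
      have "Q = (t - h i) * F i t" unfolding Q_def F_def using that by (subst prod.remove[of _ i]) auto
      then show ?thesis using nz[OF that] by (simp add: z_def)
    qed
    have "(1 - t) * Q - t * (\<Sum>i<m. G (h i) / (h i * F i (h i)) * F i t) + G t = 0"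
      using interpolation_identity[OF h(1,2) K(1,2) h(3), of t] unfolding G_def F_def Q_def by simp
    moreover have "G t = 0" using t K(1) by (auto simp: G_def)
    moreover have "(\<Sum>i<m. G (h i) / (h i * F i (h i)) * F i t) =
        Q * (\<Sum>i<m. G (h i) / (h i * F i (h i)) * z i)"
      unfolding sum_distrib_left by (rule sum.cong) (use FQ in auto)
    ultimately have "Q * ((1 - t) - t * (\<Sum>i<m. G (h i) / (h i * F i (h i)) * z i)) = 0"
      by (simp add: algebra_simps)
    with Q0 have "(1 - t) - t * (\<Sum>i<m. G (h i) / (h i * F i (h i)) * z i) = 0" by simp
    then have "b * ((1 - t) - t * (\<Sum>i<m. G (h i) / (h i * F i (h i)) * z i)) = 0" by simp
    then have "b * (1 - t) * 1 - t * (\<Sum>i<m. w i * z i) = 0"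
      by (simp add: w_def sum_distrib_left algebra_simps)
    moreover have "(h i - t) * z i + 1 = 0" if "i < m" for i using nz[OF that] by (simp add: z_def field_simps)
    ultimately show ?thesis unfolding X'_def Y'_def
      by (intro bordered_pencil_singular[OF Xc Yc R(1,2,4,5), of t z 1]) auto
  qed
  moreover have "?ext dx 0 = ?ext dx 1" "?ext dy 0 = ?ext dy 1" using XY(3,4) m by auto
  moreover have "\<forall>i. 2 \<le> i \<longrightarrow> i < Suc m \<longrightarrow> ?ext dx i = ?ext dy i" using XY(5) by auto
  moreover have "\<forall>i<Suc m. ?ext dx i \<noteq> 0 \<and> ?ext dy i \<noteq> 0" using XY(6) b by auto
  ultimately show ?thesis by (intro skew_pencilI[of "Suc m" X' "?ext dx" Y' "?ext dy"]) simp_all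
qed

lemma monic_polynomial_vanishing_on:
  fixes H :: "complex set"
  assumes "finite H" "card H = n" "0 \<notin> H"
  obtains c :: "nat \<Rightarrow> complex" where "c 0 \<noteq> 0" "c n = 1" "\<And>t. t \<in> H \<Longrightarrow> (\<Sum>k\<le>n. c k * t ^ k) = 0"
proof -
  define p where "p = (\<Prod>h\<in>H. [:- h, 1:])"
  have deg: "degree p = n" using assms by (simp add: p_def degree_prod_eq_sum_degree)
  have lc: "lead_coeff p = 1" unfolding p_def lead_coeff_prod by simp
  have "coeff p 0 \<noteq> 0"
    unfolding poly_0_coeff_0[symmetric] p_def using assms by (auto simp: poly_prod)
  moreover have "(\<Sum>k\<le>n. coeff p k * t ^ k) = 0" if "t \<in> H" for t
  proof -
    have "poly p t = 0" using that assms by (auto simp: p_def poly_prod)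
    then show ?thesis by (simp add: poly_altdef deg)
  qed
  ultimately show ?thesis using that[of "coeff p"] deg lc by simp
qed

lemma mat_of_rows_list_in: "length rs = m \<Longrightarrow> mat_of_rows_list n rs \<in> carrier_mat m n"
  by (simp add: mat_of_rows_list_def)

lemma less_4_iff: "i < 4 \<longleftrightarrow> i = 0 \<or> i = 1 \<or> i = 2 \<or> i = (3::nat)" by auto
lemma less_6_iff: "i < 6 \<longleftrightarrow> i = 0 \<or> i = 1 \<or> i = 2 \<or> i = 3 \<or> i = 4 \<or> i = (5::nat)" by auto
lemma set_4: "{0..<4} = {0, 1, 2, 3::nat}" "{..<4} = {0, 1, 2, 3::nat}" by auto
lemma set_6: "{0..<6} = {0, 1, 2, 3, 4, 5::nat}" "{..<6} = {0, 1, 2, 3, 4, 5::nat}" by auto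
lemma less_2_iff: "i < 2 \<longleftrightarrow> i = 0 \<or> i = (1::nat)" by auto
lemma less_3_iff: "i < 3 \<longleftrightarrow> i = 0 \<or> i = 1 \<or> i = (2::nat)" by auto
lemma set_2: "{0..<2} = {0, 1::nat}" "{..<2} = {0, 1::nat}" by auto
lemma set_3: "{0..<3} = {0, 1, 2::nat}" "{..<3} = {0, 1, 2::nat}" by auto

lemma mat_eqI_on:
  assumes "A \<in> carrier_mat n n" "B \<in> carrier_mat n n" "{..<n} = S"
    and "\<forall>i\<in>S. \<forall>j\<in>S. A $$ (i, j) = B $$ (i, j)"
  shows "A = B"
  by (rule eq_matI) (use assms in auto)

text \<open>In \<open>2\<times>2\<close> blocks let \<open>Y = (I I; 0 diag(2,3))\<close> and \<open>X = (diag(3,2) 0; V x)\<close>. Eliminating the identity block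
  reduces \<open>Y - t X\<close> to the quadratic matrix polynomial \<open>diag(2,3) - t W + t\<^sup>2 x diag(3,2)\<close> with
  \<open>W = x + 6 - V\<close> arbitrary. Its determinant is a quartic in which \<open>x\<close> fits the ratio of the outer
  coefficients, the diagonal of \<open>W\<close> fits those of \<open>t\<close> and \<open>t\<^sup>3\<close>, and the product of the other two entries fits that
  of \<open>t\<^sup>2\<close>. The order of the entries \<open>2, 3\<close> is reversed between the two diagonal blocks because
  otherwise the coefficients of \<open>t\<close> and \<open>t\<^sup>3\<close> would be proportional.\<close>

lemma skew_pencil_four:
  assumes H: "finite H" "card H = 4" "0 \<notin> H"
  shows "skew_pencil 4 H"
proof -
  obtain c where c: "c 0 \<noteq> 0" "c 4 = 1" "\<And>t. t \<in> H \<Longrightarrow> (\<Sum>k\<le>4. c k * t ^ k) = 0"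
    using monic_polynomial_vanishing_on[OF H] by metis
  have root: "c 0 + c 1 * t + c 2 * t ^ 2 + c 3 * t ^ 3 + t ^ 4 = 0" if "t \<in> H" for t
    using c(3)[OF that] c(2) by (simp add: eval_nat_numeral)
  \<comment> \<open>One of the two square roots avoids the other eigenvalues \<open>2\<close> and \<open>3\<close> of \<open>X\<close>.\<close>
  obtain x where x: "x ^ 2 = 1 / c 0" "x \<noteq> 2" "x \<noteq> 3"
  proof -
    let ?s = "csqrt (1 / c 0)"
    have "?s ^ 2 = 1 / c 0" "(- ?s) ^ 2 = 1 / c 0" by simp_all
    moreover have "?s \<noteq> 2 \<and> ?s \<noteq> 3 \<or> - ?s \<noteq> 2 \<and> - ?s \<noteq> 3" by (auto simp: complex_eq_iff)
    ultimately show ?thesis using that by blast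
  qed
  have xc: "x ^ 2 * c 0 = 1" using x(1) c(1) by simp
  then have x0: "x \<noteq> 0" by auto
  define a where "a = - 6 * x ^ 2 * c 1"
  define b where "b = - 6 * x * c 3"
  define w1 where "w1 = (3 * a - 2 * b) / 5"
  define w4 where "w4 = (3 * b - 2 * a) / 5"
  define w2 where "w2 = 13 * x + w1 * w4 - 6 * x ^ 2 * c 2"
  have w: "2 * w4 + 3 * w1 = a" "2 * w1 + 3 * w4 = b" by (simp_all add: w1_def w4_def field_simps)
  define X where "X = mat_of_rows_list 4 [[3, 0, 0, 0], [0, 2, 0, 0], [x + 6 - w1, - w2, x, 0], [-1, x + 6 - w4, 0, x]]"
  define Y where "Y = mat_of_rows_list 4 [[1, 0, 1, 0], [0, 1, 0, 1], [0, 0, 2, 0], [0, 0, 0, 3 :: complex]]"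
  define d where "d y i = (if i < 2 then y else if i = 2 then 3 else 2 :: complex)" for y and i :: nat
  have Xc: "X \<in> carrier_mat 4 4" and Yc: "Y \<in> carrier_mat 4 4"
    by (simp_all add: X_def Y_def mat_of_rows_list_in)
  note calc = mat_of_rows_list_def scalar_prod_def less_4_iff set_4 d_def
  have "diagonalized 4 X (d x)"
  proof (rule diagonalizedI[OF Xc])
    let ?P = "mat_of_rows_list 4 [[0, 0, 1, 0], [0, 0, 0, 1], [1, 0, (x + 6 - w1) / (3 - x), - w2 / (2 - x)],
      [0, 1, - 1 / (3 - x), (x + 6 - w4) / (2 - x)]]"
    let ?Q = "mat_of_rows_list 4 [[- ((x + 6 - w1) / (3 - x)), w2 / (2 - x), 1, 0],
      [1 / (3 - x), - ((x + 6 - w4) / (2 - x)), 0, 1], [1, 0, 0, 0], [0, 1, 0, 0]]"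
    show "?P \<in> carrier_mat 4 4" "?Q \<in> carrier_mat 4 4" by (simp_all add: mat_of_rows_list_in)
    show "?P * ?Q = 1\<^sub>m 4" by (rule eq_matI) (auto simp: calc)
    have "3 - x \<noteq> 0" "2 - x \<noteq> 0" using x by auto
    then show "X * ?P = ?P * dmat 4 (d x)"
      by (intro mat_eqI_on[OF _ _ set_4(2)])
        (use Xc in \<open>simp_all add: mat_of_rows_list_in mult_carrier_mat[of _ 4 4 _ 4]\<close>,
         simp add: X_def calc field_simps)
  qed
  moreover have "diagonalized 4 Y (d 1)"
  proof (rule diagonalizedI[OF Yc])
    let ?P = "mat_of_rows_list 4 [[1, 0, 0, 1], [0, 1, 1 / 2, 0], [0, 0, 0, 1], [0, 0, 1, 0]] :: complex mat"
    let ?Q = "mat_of_rows_list 4 [[1, 0, -1, 0], [0, 1, 0, - 1 / 2], [0, 0, 0, 1], [0, 0, 1, 0]] :: complex mat"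
    show "?P \<in> carrier_mat 4 4" "?Q \<in> carrier_mat 4 4" by (simp_all add: mat_of_rows_list_in)
    show "?P * ?Q = 1\<^sub>m 4" by (rule eq_matI) (auto simp: calc)
    show "Y * ?P = ?P * dmat 4 (d 1)"
      by (intro mat_eqI_on[OF _ _ set_4(2)])
        (use Yc in \<open>simp_all add: mat_of_rows_list_in mult_carrier_mat[of _ 4 4 _ 4]\<close>,
         simp add: Y_def calc)
  qed
  moreover have "det (Y - t \<cdot>\<^sub>m X) = 0" if t: "t \<in> H" for t
  proof -
    define A1 where "A1 = 2 - t * w1 + 3 * x * t ^ 2"
    define A2 where "A2 = 3 - t * w4 + 2 * x * t ^ 2"
    have t0: "t \<noteq> 0" using t H(3) by auto
    have "A1 * A2 - t ^ 2 * w2 = 6 - t * (2 * w4 + 3 * w1) + t ^ 2 * (13 * x + w1 * w4 - w2)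
        - x * t ^ 3 * (2 * w1 + 3 * w4) + 6 * x ^ 2 * t ^ 4"
      by (simp add: A1_def A2_def algebra_simps power2_eq_square power3_eq_cube power4_eq_xxxx)
    also have "\<dots> = 6 * (x ^ 2 * c 0) + 6 * x ^ 2 * (c 1 * t + c 2 * t ^ 2 + c 3 * t ^ 3 + t ^ 4)"
      unfolding w a_def b_def w2_def xc by (simp add: algebra_simps power2_eq_square)
    also have "\<dots> = 6 * x ^ 2 * (c 0 + c 1 * t + c 2 * t ^ 2 + c 3 * t ^ 3 + t ^ 4)"
      by (simp add: algebra_simps)
    finally have A: "A1 * A2 = t ^ 2 * w2" using root[OF t] by simp
    \<comment> \<open>\<open>(A2, t)\<close> is in the kernel of the eliminated \<open>2\<times>2\<close> matrix; the other entries are forced by the identity block.\<close>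
    define v where "v i = (if i = 0 then A2 else if i = 1 then t else if i = 2 then - (1 - 3 * t) * A2
      else - (1 - 2 * t) * t)" for i :: nat
    show ?thesis
    proof (rule kernel_imp_det_0[of _ 4 1 v])
      show "Y - t \<cdot>\<^sub>m X \<in> carrier_mat 4 4" using Xc Yc by (simp add: minus_carrier_mat)
      show "v 1 \<noteq> 0" using t0 by (simp add: v_def)
      fix i :: nat assume "i < 4"
      moreover have "(2 - t * x) * (- (1 - 3 * t) * A2) - t * (x + 6 - w1) * A2 + t * w2 * t = 0"
      proof -
        have "(2 - t * x) * (- (1 - 3 * t) * A2) - t * (x + 6 - w1) * A2 + t * w2 * t = t ^ 2 * w2 - A1 * A2"
          by (simp add: A1_def algebra_simps power2_eq_square)
        then show ?thesis using A by simp
      qed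
      moreover have "t * A2 - t * (x + 6 - w4) * t + (3 - t * x) * (- (1 - 2 * t) * t) = 0"
        by (simp add: A2_def algebra_simps power2_eq_square)
      ultimately show "(\<Sum>j<4. (Y - t \<cdot>\<^sub>m X) $$ (i, j) * v j) = 0"
        by (auto simp: X_def Y_def v_def calc algebra_simps)
    qed simp
  qed
  ultimately show ?thesis
    using x0 by (intro skew_pencilI[of 4 X "d x" Y "d 1"]) (auto simp: d_def)
qed

lemma skew_pencil_exists:
  assumes "m \<ge> 4" "finite H" "card H = m" "0 \<notin> H"
  shows "skew_pencil m H"
  using assms
proof (induction m arbitrary: H rule: dec_induct)
  case base
  then show ?case by (intro skew_pencil_four)
next
  case (step m)
  then show ?case by (intro skew_pencil_Suc) auto
qed

lemma certified_three:
  assumes "m \<ge> 4" shows "certified (m + m) 3"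
proof (rule certified_from_bipartite_family)
  fix H :: "complex set" assume H: "finite H" "card H = m" "0 \<notin> H"
  obtain X Y dx dy where XY: "diagonalized m X dx" "diagonalized m Y dy" "dx 0 = dx 1" "dy 0 = dy 1"
    "\<And>i. 2 \<le> i \<Longrightarrow> i < m \<Longrightarrow> dx i = dy i" "\<And>i. i < m \<Longrightarrow> dx i \<noteq> 0 \<and> dy i \<noteq> 0"
    "\<And>h. h \<in> H \<Longrightarrow> det (Y - h \<cdot>\<^sub>m X) = 0"
    using skew_pencil_exists[OF assms H] unfolding skew_pencil_def by blast
  note Xc = diagonalized_carrier[OF XY(1)] and Yc = diagonalized_carrier[OF XY(2)]
  define \<sigma> where "\<sigma> i = (if i = 0 then 1 else if i = 1 then 0 else if i = m then m + 1
     else if i = m + 1 then m else if i < m then i + m else i - m)" for i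
  have "product_of_skew_symmetric (m + m) 2 (four_block_mat (transpose_mat X) (0\<^sub>m m m) (0\<^sub>m m m) Y)"
  proof (rule diagonalized_product_of_two_skew[OF diagonalized_blocks[OF diagonalized_transpose[OF XY(1)] XY(2)]])
    fix i assume i: "i < m + m"
    show "\<sigma> i < m + m \<and> \<sigma> i \<noteq> i \<and> \<sigma> (\<sigma> i) = i \<and>
      (if \<sigma> i < m then dx (\<sigma> i) else dy (\<sigma> i - m)) = (if i < m then dx i else dy (i - m))"
      using i assms XY(3,4) XY(5)[of i] XY(5)[of "i - m"] by (auto simp: \<sigma>_def)
  qed
  from bip_product_of_skew[OF Xc Yc this]
  have "product_of_skew_symmetric (m + m) 3 (bip m X Y)" by (simp add: eval_nat_numeral)
  moreover have "det X \<noteq> 0" "det Y \<noteq> 0"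
    using det_diagonalized[OF XY(1)] det_diagonalized[OF XY(2)] XY(6) by auto
  ultimately show "\<exists>X Y. X \<in> carrier_mat m m \<and> Y \<in> carrier_mat m m \<and>
       det X \<noteq> 0 \<and> det Y \<noteq> 0 \<and> (\<forall>h\<in>H. det (Y - h \<cdot>\<^sub>m X) = 0) \<and> product_of_skew_symmetric (m + m) 3 (bip m X Y)"
    using Xc Yc XY(7) by blast
qed (use assms in auto)

section \<open>Five factors in dimension four\<close>

lemma diagonalized_smult_one: "diagonalized n (a \<cdot>\<^sub>m 1\<^sub>m n) (\<lambda>i. a)"
  by (rule diagonalizedI[of _ _ "1\<^sub>m n" "1\<^sub>m n"]) (auto simp: mat_eq_iff)

text \<open>With four factors available, \<open>diag(X\<^sup>T, Y)\<close> may be \<open>diag(I, y I)\<close> times \<open>diag(X\<^sup>T, N)\<close> with \<open>X\<close> similar to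
  \<open>N = diag(1, 2)\<close>, each being a product of two. The scalar \<open>y\<close> fits the product of the roots of
  \<open>det (y N - t X)\<close>, and the position of \<open>X\<close> in its conjugacy class fits their sum.\<close>

lemma certified_4_5: "certified 4 5"
proof -
  have "certified (2 + 2) 5"
  proof (rule certified_from_bipartite_family)
    fix H :: "complex set" assume H: "finite H" "card H = 2" "0 \<notin> H"
    obtain c where c: "c 0 \<noteq> 0" "c 2 = 1" "\<And>t. t \<in> H \<Longrightarrow> (\<Sum>k\<le>2. c k * t ^ k) = 0"
      using monic_polynomial_vanishing_on[OF H] by metis
    have root: "c 0 + c 1 * t + t ^ 2 = 0" if "t \<in> H" for t
      using c(3)[OF that] c(2) by (simp add: eval_nat_numeral)
    define y where "y = csqrt (c 0)"
    have y: "y ^ 2 = c 0" "y \<noteq> 0" using c(1) by (auto simp: y_def)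
    define p where "p = - 2 * c 1 / y - 3"
    have p: "y * (3 + p) = - 2 * c 1" using y(2) by (simp add: p_def)
    define q where "q = p * (3 - p) - 2"
    define d where "d i = (if i = 0 then 1 else 2 :: complex)" for i :: nat
    define X where "X = mat_of_rows_list 2 [[p, q], [1, 3 - p]]"
    define N where "N = dmat 2 d"
    define Y where "Y = y \<cdot>\<^sub>m N"
    have Xc: "X \<in> carrier_mat 2 2" and Nc: "N \<in> carrier_mat 2 2" and Yc: "Y \<in> carrier_mat 2 2"
      by (simp_all add: X_def N_def Y_def mat_of_rows_list_in)
    note calc = mat_of_rows_list_def scalar_prod_def less_2_iff set_2 d_def
    have dX: "diagonalized 2 X d"
    proof (rule diagonalizedI[OF Xc])
      let ?P = "mat_of_rows_list 2 [[p - 2, p - 1], [1, 1]]"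
      let ?Q = "mat_of_rows_list 2 [[- 1, p - 1], [1, 2 - p]]"
      show "?P \<in> carrier_mat 2 2" "?Q \<in> carrier_mat 2 2" by (simp_all add: mat_of_rows_list_in)
      show "?P * ?Q = 1\<^sub>m 2" by (rule eq_matI) (auto simp: calc algebra_simps)
      show "X * ?P = ?P * dmat 2 d"
        by (intro mat_eqI_on[OF _ _ set_2(2)])
          (use Xc in \<open>simp_all add: mat_of_rows_list_in mult_carrier_mat[of _ 2 2 _ 2]\<close>,
           simp add: X_def q_def calc algebra_simps)
    qed
    have dN: "diagonalized 2 N d"
      by (rule diagonalizedI[of _ _ "1\<^sub>m 2" "1\<^sub>m 2"]) (auto simp: N_def)
    let ?B = "\<lambda>U V. four_block_mat U (0\<^sub>m 2 2) (0\<^sub>m 2 2) V :: complex mat"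
    have "product_of_skew_symmetric (2 + 2) 2 (?B (1 \<cdot>\<^sub>m 1\<^sub>m 2) (y \<cdot>\<^sub>m 1\<^sub>m 2))"
      by (rule diagonalized_product_of_two_skew[OF diagonalized_blocks[OF diagonalized_smult_one diagonalized_smult_one],
            where \<sigma> = "\<lambda>i. if i < 2 then 1 - i else 5 - i"]) (auto simp: less_4_iff)
    moreover have "product_of_skew_symmetric (2 + 2) 2 (?B (transpose_mat X) N)"
      by (rule diagonalized_product_of_two_skew[OF diagonalized_blocks[OF diagonalized_transpose[OF dX] dN],
            where \<sigma> = "\<lambda>i. if i < 2 then i + 2 else i - 2"]) auto
    ultimately have "product_of_skew_symmetric (2 + 2) (2 + 2) (?B (1 \<cdot>\<^sub>m 1\<^sub>m 2) (y \<cdot>\<^sub>m 1\<^sub>m 2) * ?B (transpose_mat X) N)"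
      by (rule product_of_skew_mult)
    also have "?B (1 \<cdot>\<^sub>m 1\<^sub>m 2) (y \<cdot>\<^sub>m 1\<^sub>m 2) * ?B (transpose_mat X) N = ?B (transpose_mat X) Y"
      unfolding Y_def using Xc Nc
      by (subst mult_four_block_mat[of _ 2 2 _ 2 _ 2 _ _ 2 _ 2]) (auto simp: mult_smult_assoc_mat[of _ 2 2 _ 2])
    finally have "product_of_skew_symmetric (2 + 2) (Suc (2 + 2)) (bip 2 X Y)"
      by (rule bip_product_of_skew[OF Xc Yc])
    moreover have "det X \<noteq> 0" "det N \<noteq> 0"
      using det_diagonalized[OF dX] det_diagonalized[OF dN] by (simp_all add: d_def)
    moreover from this(2) have "det Y \<noteq> 0" using y c(1) Nc by (simp add: Y_def)
    moreover have "det (Y - t \<cdot>\<^sub>m X) = 0" if t: "t \<in> H" for t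
    proof -
      define v where "v i = (if i = 0 then 2 * y - t * (3 - p) else t)" for i :: nat
      have "(y - t * p) * (2 * y - t * (3 - p)) - t * q * t = 2 * y ^ 2 - t * (y * (3 + p)) + 2 * t ^ 2"
        by (simp add: q_def algebra_simps power2_eq_square)
      also have "\<dots> = 2 * (c 0 + c 1 * t + t ^ 2)" unfolding p y(1) by (simp add: algebra_simps)
      also have "\<dots> = 0" using root[OF t] by simp
      finally have e: "(y - t * p) * (2 * y - t * (3 - p)) - t * q * t = 0" .
      show ?thesis
      proof (rule kernel_imp_det_0[of _ 2 1 v])
        show "Y - t \<cdot>\<^sub>m X \<in> carrier_mat 2 2" using Xc Yc by (simp add: minus_carrier_mat)
        show "v 1 \<noteq> 0" using t H(3) by (auto simp: v_def)
        fix i :: nat assume "i < 2"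
        then show "(\<Sum>j<2. (Y - t \<cdot>\<^sub>m X) $$ (i, j) * v j) = 0"
          using e by (auto simp: X_def Y_def N_def v_def calc algebra_simps)
      qed simp
    qed
    ultimately show "\<exists>X Y. X \<in> carrier_mat 2 2 \<and> Y \<in> carrier_mat 2 2 \<and>
       det X \<noteq> 0 \<and> det Y \<noteq> 0 \<and> (\<forall>h\<in>H. det (Y - h \<cdot>\<^sub>m X) = 0) \<and> product_of_skew_symmetric (2 + 2) 5 (bip 2 X Y)"
      using Xc Yc by (intro exI[of _ X] exI[of _ Y]) (simp add: eval_nat_numeral)
  qed auto
  then show ?thesis by simp
qed

section \<open>Four factors in dimension six and three\<close>

lemma quadratic_splits:
  fixes a b c :: complex
  obtains p0 p1 q0 q1 where "p0 * q0 = a" "p0 * q1 + p1 * q0 = b" "p1 * q1 = c"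
proof (cases "c = 0")
  case True
  then show ?thesis using that[of 1 a b 0] by simp
next
  case False
  define s where "s = csqrt (b ^ 2 - 4 * a * c)"
  have s: "s ^ 2 = b ^ 2 - 4 * a * c" by (simp add: s_def)
  have "((b - s) / 2) * ((b + s) / (2 * c)) = (b ^ 2 - s ^ 2) / (4 * c)"
    using False by (simp add: field_simps power2_eq_square)
  also have "\<dots> = a" unfolding s using False by simp
  finally show ?thesis using that[of "(b - s) / 2" "(b + s) / (2 * c)" 1 c] False
    by (simp add: field_simps)
qed

lemma singular_2_kernel:
  fixes a b c d :: complex
  assumes "a * d = b * c"
  obtains z1 z2 where "z1 \<noteq> 0 \<or> z2 \<noteq> 0" "a * z1 + b * z2 = 0" "c * z1 + d * z2 = 0"
proof (cases "a = 0 \<and> b = 0")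
  case True
  show ?thesis
  proof (cases "c = 0 \<and> d = 0")
    case True
    then show ?thesis using \<open>a = 0 \<and> b = 0\<close> that[of 1 0] by simp
  next
    case False
    then show ?thesis using \<open>a = 0 \<and> b = 0\<close> that[of d "- c"] by (auto simp: algebra_simps)
  qed
next
  case False
  then show ?thesis using assms that[of b "- a"] by (auto simp: algebra_simps)
qed

text \<open>For an even number of factors similarity takes the role of congruence, so a single product with the
  eigenvalues of \<open>A\<close> suffices.\<close>

lemma certified_from_spectrum_family:
  assumes r: "even r" and fam: "\<And>h. inj_on h {..<n} \<Longrightarrow> (\<And>i. i < n \<Longrightarrow> h i \<noteq> 0) \<Longrightarrow> \<exists>B. B \<in> carrier_mat n n \<and>
    (\<forall>i<n. det (B - h i \<cdot>\<^sub>m 1\<^sub>m n) = 0) \<and> product_of_skew_symmetric n r B"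
  shows "certified n r"
proof -
  let ?f = "\<lambda>A. det A * trace_discriminant A"
  let ?W = "dmat n (\<lambda>i. of_nat (Suc i))"
  have "polyfun n ?f"
    by (intro polyfun_mult polyfun_det[of _ n] polyfun_trace_discriminant[of _ n] polymat_id)
  moreover have dW: "det ?W \<noteq> 0" by (simp add: det_dmat del: of_nat_Suc)
  moreover have "trace_discriminant ?W \<noteq> 0"
  proof (rule trace_discriminant_nonzeroI[where h = "\<lambda>i. of_nat (Suc i)" and n = n])
    fix i assume i: "i < n"
    have "?W - of_nat (Suc i) \<cdot>\<^sub>m 1\<^sub>m n = dmat n (\<lambda>j. of_nat (Suc j) - of_nat (Suc i))"
      by (rule eq_matI) auto
    then show "det (?W - of_nat (Suc i) \<cdot>\<^sub>m 1\<^sub>m n) = 0" using i by (auto simp: det_dmat)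
  qed (auto simp: inj_on_def)
  moreover have "product_of_skew_symmetric n r A" if A: "A \<in> carrier_mat n n" and fA: "?f A \<noteq> 0" for A
  proof -
    obtain h where h: "inj_on h {..<n}" "\<And>i. i < n \<Longrightarrow> det (A - h i \<cdot>\<^sub>m 1\<^sub>m n) = 0"
      using trace_discriminant_nonzero_imp[OF A] fA by auto
    have "A - 0 \<cdot>\<^sub>m 1\<^sub>m n = A" using A by (intro eq_matI) auto
    with h(2) fA have "h i \<noteq> 0" if "i < n" for i using that by force
    then obtain B where B: "B \<in> carrier_mat n n" "\<And>i. i < n \<Longrightarrow> det (B - h i \<cdot>\<^sub>m 1\<^sub>m n) = 0"
       "product_of_skew_symmetric n r B" using fam[OF h(1)] by blast
    obtain P Q where PQ: "P \<in> carrier_mat n n" "Q \<in> carrier_mat n n" "P * Q = 1\<^sub>m n" "Q * P = 1\<^sub>m n"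
      "A = P * B * Q"
      using similar_if_common_eigenvalues[OF A B(1) h(1) h(2) B(2)] by metis
    show ?thesis unfolding PQ(5) by (rule product_of_skew_similar[OF B(3) r PQ(1-4)])
  qed
  ultimately show ?thesis by (intro certifiedI[of n ?f ?W]) simp_all
qed

lemma diagonalized_inverse:
  assumes "diagonalized n X d" "\<And>i. i < n \<Longrightarrow> d i \<noteq> 0"
  obtains X' where "diagonalized n X' (\<lambda>i. inverse (d i))" "X * X' = 1\<^sub>m n" "X' * X = 1\<^sub>m n"
proof -
  obtain P Q where P: "P \<in> carrier_mat n n" "Q \<in> carrier_mat n n" "P * Q = 1\<^sub>m n"
     "Q * P = 1\<^sub>m n" "X = P * dmat n d * Q" using assms(1) by (auto simp: diagonalized_def)
  have inv: "P * E * Q * (P * F * Q) = 1\<^sub>m n"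
    if "E \<in> carrier_mat n n" "F \<in> carrier_mat n n" "E * F = 1\<^sub>m n" for E F
    using P(1-4) that by (simp add: assoc_mult_mat[of _ n n _ n _ n] cancel_inverse[of _ n _ _ n])
  have "dmat n d * dmat n (\<lambda>i. inverse (d i)) = 1\<^sub>m n" "dmat n (\<lambda>i. inverse (d i)) * dmat n d = 1\<^sub>m n"
    using assms(2) by (auto simp: dmat_mult mat_eq_iff)
  then have "X * (P * dmat n (\<lambda>i. inverse (d i)) * Q) = 1\<^sub>m n" "(P * dmat n (\<lambda>i. inverse (d i)) * Q) * X = 1\<^sub>m n"
    unfolding P(5) by (auto intro!: inv simp del: assoc_mult_mat)
  moreover have "diagonalized n (P * dmat n (\<lambda>i. inverse (d i)) * Q) (\<lambda>i. inverse (d i))"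
    unfolding diagonalized_def using P(1-4) by blast
  ultimately show ?thesis using that by blast
qed

text \<open>The product is \<open>X\<^sup>-\<^sup>1 Y\<close>, where \<open>X\<close> and \<open>Y\<close> are block triangular in \<open>2\<times>2\<close> blocks with distinct scalar blocks
  on the diagonal; their eigenvalues are double, so each is a product of two. With identity blocks
  above the diagonal of \<open>Y\<close>, elimination reduces \<open>Y - t X\<close> to \<open>G(t) = (g, t \<beta>; t \<gamma>, g)\<close>, where the cubic \<open>g\<close> has
  its outer coefficients given by the diagonals and \<open>\<beta>, \<gamma>\<close> are arbitrary linear polynomials. A sextic
  with roots \<open>h i\<close> is of the form \<open>g\<^sup>2 - t\<^sup>2 \<beta> \<gamma>\<close>: the coefficients of degree \<open>0, 1, 5, 6\<close> determine \<open>g\<close>, and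
  the remaining quadratic splits into linear factors.\<close>

lemma certified_6_4: "certified 6 4"
proof (rule certified_from_spectrum_family)
  fix h :: "nat \<Rightarrow> complex" assume inj: "inj_on h {..<6}" and h0: "\<And>i. i < 6 \<Longrightarrow> h i \<noteq> 0"
  have "finite (h ` {..<6})" "card (h ` {..<6}) = 6" "0 \<notin> h ` {..<6}"
    using h0 card_image[OF inj] by auto
  then obtain c where c: "c 0 \<noteq> 0" "c 6 = 1" "\<And>t. t \<in> h ` {..<6} \<Longrightarrow> (\<Sum>k\<le>6. c k * t ^ k) = 0"
    using monic_polynomial_vanishing_on[of "h ` {..<6}" 6] by metis
  have root: "c 0 + c 1 * t + c 2 * t ^ 2 + c 3 * t ^ 3 + c 4 * t ^ 4 + c 5 * t ^ 5 + t ^ 6 = 0"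
    if "t \<in> h ` {..<6}" for t
    using c(3)[OF that] c(2) by (simp add: eval_nat_numeral)
  \<comment> \<open>The last diagonal block of \<open>Y\<close> is \<open>g0 / 2\<close> and has to differ from the other two, \<open>1\<close> and \<open>2\<close>.\<close>
  obtain g0 where g0: "g0 ^ 2 = c 0" "g0 \<noteq> 2" "g0 \<noteq> 4"
  proof -
    let ?s = "csqrt (c 0)"
    have "?s ^ 2 = c 0" "(- ?s) ^ 2 = c 0" by simp_all
    moreover have "?s \<noteq> 2 \<and> ?s \<noteq> 4 \<or> - ?s \<noteq> 2 \<and> - ?s \<noteq> 4" by (auto simp: complex_eq_iff)
    ultimately show ?thesis using that by blast
  qed
  then have g00: "g0 \<noteq> 0" using c(1) by auto
  define g1 where "g1 = c 1 / (2 * g0)"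
  define g2 where "g2 = c 5 / 2"
  have g1: "2 * g0 * g1 = c 1" and g2: "2 * g2 = c 5" using g00 by (simp_all add: g1_def g2_def)
  obtain b0 b1 e0 e1 where be: "b0 * e0 = - (c 2 - g1 ^ 2 - 2 * g0 * g2)"
    "b0 * e1 + b1 * e0 = - (c 3 - 2 * g0 - 2 * g1 * g2)" "b1 * e1 = - (c 4 - g2 ^ 2 - 2 * g1)"
    using quadratic_splits by metis
  define y where "y = g0 / 2"
  have y: "y \<noteq> 0" "y \<noteq> 1" "y \<noteq> 2" "g0 = 2 * y" using g0 g00 by (auto simp: y_def)
  define a0 where "a0 = g1 - 1 + 2 * g0"
  define a1 where "a1 = g2 - g0 + 2"
  define X where "X = mat_of_rows_list 6 [[1, 0, 0, 0, 0, 0], [0, 1, 0, 0, 0, 0],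
    [2 * a1, 2 * b1, 2, 0, 0, 0], [2 * e1, 2 * a1, 0, 2, 0, 0],
    [g0 * a1 - a0, g0 * b1 - b0, 0, 0, - 1 / 2, 0], [g0 * e1 - e0, g0 * a1 - a0, 0, 0, 0, - 1 / 2]]"
  define Y where "Y = mat_of_rows_list 6 [[1, 0, 1, 0, 0, 0], [0, 1, 0, 1, 0, 0],
    [0, 0, 2, 0, 1, 0], [0, 0, 0, 2, 0, 1], [0, 0, 0, 0, y, 0], [0, 0, 0, 0, 0, y]]"
  define d where "d z i = (if i < 2 then 1 else if i < 4 then 2 else z :: complex)" for z and i :: nat
  have Xc: "X \<in> carrier_mat 6 6" and Yc: "Y \<in> carrier_mat 6 6"
    by (simp_all add: X_def Y_def mat_of_rows_list_in)
  note calc = mat_of_rows_list_def scalar_prod_def set_6 d_def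
  have dX: "diagonalized 6 X (d (- 1 / 2))"
  proof (rule diagonalizedI[OF Xc])
    let ?u = "2 / 3 :: complex"
    let ?P = "mat_of_rows_list 6 [[1, 0, 0, 0, 0, 0], [0, 1, 0, 0, 0, 0],
      [- 2 * a1, - 2 * b1, 1, 0, 0, 0], [- 2 * e1, - 2 * a1, 0, 1, 0, 0],
      [?u * (g0 * a1 - a0), ?u * (g0 * b1 - b0), 0, 0, 1, 0], [?u * (g0 * e1 - e0), ?u * (g0 * a1 - a0), 0, 0, 0, 1]]"
    let ?Q = "mat_of_rows_list 6 [[1, 0, 0, 0, 0, 0], [0, 1, 0, 0, 0, 0],
      [2 * a1, 2 * b1, 1, 0, 0, 0], [2 * e1, 2 * a1, 0, 1, 0, 0],
      [- ?u * (g0 * a1 - a0), - ?u * (g0 * b1 - b0), 0, 0, 1, 0], [- ?u * (g0 * e1 - e0), - ?u * (g0 * a1 - a0), 0, 0, 0, 1]]"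
    show Pc: "?P \<in> carrier_mat 6 6" and Qc: "?Q \<in> carrier_mat 6 6" by (simp_all add: mat_of_rows_list_in)
    show "?P * ?Q = 1\<^sub>m 6"
      by (rule mat_eqI_on[OF mult_carrier_mat[OF Pc Qc] one_carrier_mat set_6(2)]) (simp add: calc)
    show "X * ?P = ?P * dmat 6 (d (- 1 / 2))"
      by (rule mat_eqI_on[OF mult_carrier_mat[OF Xc Pc] mult_carrier_mat[OF Pc dmat_carrier] set_6(2)])
        (simp add: X_def calc field_simps)
  qed
  have dY: "diagonalized 6 Y (d y)"
  proof (rule diagonalizedI[OF Yc])
    define p where "p = 1 / (y - 2)"
    define q where "q = p / (y - 1)"
    have "p * (y - 2) = 1" "q * (y - 1) = p" using y by (simp_all add: p_def q_def)
    then have pq: "2 * p + 1 = p * y" "q + p = q * y" by (simp_all add: algebra_simps)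
    let ?P = "mat_of_rows_list 6 [[1, 0, 1, 0, q, 0], [0, 1, 0, 1, 0, q],
      [0, 0, 1, 0, p, 0], [0, 0, 0, 1, 0, p], [0, 0, 0, 0, 1, 0], [0, 0, 0, 0, 0, 1]]"
    let ?Q = "mat_of_rows_list 6 [[1, 0, - 1, 0, p - q, 0], [0, 1, 0, - 1, 0, p - q],
      [0, 0, 1, 0, - p, 0], [0, 0, 0, 1, 0, - p], [0, 0, 0, 0, 1, 0], [0, 0, 0, 0, 0, 1]]"
    show Pc: "?P \<in> carrier_mat 6 6" and Qc: "?Q \<in> carrier_mat 6 6" by (simp_all add: mat_of_rows_list_in)
    show "?P * ?Q = 1\<^sub>m 6"
      by (rule mat_eqI_on[OF mult_carrier_mat[OF Pc Qc] one_carrier_mat set_6(2)]) (simp add: calc)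
    show "Y * ?P = ?P * dmat 6 (d y)"
      by (rule mat_eqI_on[OF mult_carrier_mat[OF Yc Pc] mult_carrier_mat[OF Pc dmat_carrier] set_6(2)])
        (simp add: Y_def calc pq)
  qed
  have pair: "product_of_skew_symmetric 6 2 M" if "diagonalized 6 M (\<lambda>i. f (d z i))" for M f z
    by (rule diagonalized_product_of_two_skew[OF that, where \<sigma> = "\<lambda>i. if even i then i + 1 else i - 1"])
      (auto simp: d_def less_6_iff)
  obtain X' where X': "diagonalized 6 X' (\<lambda>i. inverse (d (- 1 / 2) i))" "X * X' = 1\<^sub>m 6" "X' * X = 1\<^sub>m 6"
    by (rule diagonalized_inverse[OF dX]) (auto simp: d_def)
  note X'c = diagonalized_carrier[OF X'(1)]
  have "product_of_skew_symmetric 6 (2 + 2) (X' * Y)"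
    by (rule product_of_skew_mult[OF pair[OF X'(1)] pair[of _ "\<lambda>x. x"]]) (rule dY)
  moreover have "det (X' * Y - h i \<cdot>\<^sub>m 1\<^sub>m 6) = 0" if i: "i < 6" for i
  proof -
    define t where "t = h i"
    have t: "t \<in> h ` {..<6}" using i by (auto simp: t_def)
    define g where "g = g0 + g1 * t + g2 * t ^ 2 + t ^ 3"
    define \<beta> where "\<beta> = b0 + b1 * t"
    define \<gamma> where "\<gamma> = e0 + e1 * t"
    have "t * \<beta> * (t * \<gamma>) = t ^ 2 * (b0 * e0 + (b0 * e1 + b1 * e0) * t + b1 * e1 * t ^ 2)"
      by (simp add: \<beta>_def \<gamma>_def algebra_simps power2_eq_square)
    then have "g * g - t * \<beta> * (t * \<gamma>) = g0 ^ 2 + 2 * g0 * g1 * t + c 2 * t ^ 2 + c 3 * t ^ 3 + c 4 * t ^ 4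
        + 2 * g2 * t ^ 5 + t ^ 6"
      unfolding be g_def by (simp add: algebra_simps eval_nat_numeral)
    also have "\<dots> = 0" unfolding g0 g1 g2 using root[OF t] by simp
    finally have "g * g = t * \<beta> * (t * \<gamma>)" by simp
    then obtain z1 z2 where z: "z1 \<noteq> 0 \<or> z2 \<noteq> 0" "g * z1 + t * \<beta> * z2 = 0" "t * \<gamma> * z1 + g * z2 = 0"
      by (rule singular_2_kernel) blast
    \<comment> \<open>\<open>(z1, z2)\<close> is in the kernel of \<open>G(t)\<close>; the identity blocks force the other entries.\<close>
    define v where "v i = (if i = 0 then z1 else if i = 1 then z2 else if i = 2 then - (1 - t) * z1
      else if i = 3 then - (1 - t) * z2
      else if i = 4 then 2 * t * (a1 * z1 + b1 * z2) + 2 * (1 - t) ^ 2 * z1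
      else 2 * t * (e1 * z1 + a1 * z2) + 2 * (1 - t) ^ 2 * z2)" for i :: nat
    have r4: "- t * ((g0 * a1 - a0) * z1 + (g0 * b1 - b0) * z2) +
        (y + t / 2) * (2 * t * (a1 * z1 + b1 * z2) + 2 * (1 - t) ^ 2 * z1) = g * z1 + t * \<beta> * z2"
      by (simp add: g_def \<beta>_def a0_def a1_def y(4) algebra_simps eval_nat_numeral)
    have r5: "- t * ((g0 * e1 - e0) * z1 + (g0 * a1 - a0) * z2) +
        (y + t / 2) * (2 * t * (e1 * z1 + a1 * z2) + 2 * (1 - t) ^ 2 * z2) = t * \<gamma> * z1 + g * z2"
      by (simp add: g_def \<gamma>_def a0_def a1_def y(4) algebra_simps eval_nat_numeral)
    have C: "Y - t \<cdot>\<^sub>m X \<in> carrier_mat 6 6" using Xc Yc by (simp add: minus_carrier_mat)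
    have "(\<Sum>j<6. (Y - t \<cdot>\<^sub>m X) $$ (i, j) * v j) = 0" if "i < 6" for i
    proof -
      consider "i = 0" | "i = 1" | "i = 2" | "i = 3" | "i = 4" | "i = 5"
        using \<open>i < 6\<close> unfolding less_6_iff by blast
      then show ?thesis
      proof cases
        case 5
        then have "(\<Sum>j<6. (Y - t \<cdot>\<^sub>m X) $$ (i, j) * v j) = - t * ((g0 * a1 - a0) * z1 + (g0 * b1 - b0) * z2) +
          (y + t / 2) * (2 * t * (a1 * z1 + b1 * z2) + 2 * (1 - t) ^ 2 * z1)"
          by (simp add: X_def Y_def v_def calc algebra_simps)
        then show ?thesis using r4 z(2) by simp
      next
        case 6
        then have "(\<Sum>j<6. (Y - t \<cdot>\<^sub>m X) $$ (i, j) * v j) = - t * ((g0 * e1 - e0) * z1 + (g0 * a1 - a0) * z2) +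
          (y + t / 2) * (2 * t * (e1 * z1 + a1 * z2) + 2 * (1 - t) ^ 2 * z2)"
          by (simp add: X_def Y_def v_def calc algebra_simps)
        then show ?thesis using r5 z(3) by simp
      qed (simp_all add: X_def Y_def v_def calc algebra_simps power2_eq_square)
    qed
    then have "det (Y - t \<cdot>\<^sub>m X) = 0"
      using z(1) kernel_imp_det_0[OF C, of 0 v] kernel_imp_det_0[OF C, of 1 v] by (auto simp: v_def)
    moreover have "X' * (Y - t \<cdot>\<^sub>m X) = X' * Y - t \<cdot>\<^sub>m 1\<^sub>m 6"
      using X'c Xc Yc X'(3) by (simp add: mult_minus_distrib_mat[of _ 6 6 _ 6] mult_smult_distrib[of _ 6 6 _ 6])
    ultimately show ?thesis using det_mult[OF X'c C] by (simp add: t_def)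
  qed
  ultimately show "\<exists>B. B \<in> carrier_mat 6 6 \<and> (\<forall>i<6. det (B - h i \<cdot>\<^sub>m 1\<^sub>m 6) = 0) \<and> product_of_skew_symmetric 6 4 B"
    using X'c Yc by (intro exI[of _ "X' * Y"]) simp
qed simp

text \<open>The matrix of the cross product with the vector \<open>(c, b, a)\<close>.\<close>

lemma cross_product_matrix_skew:
  "skew_symmetric_mat 3 (mat_of_rows_list 3 [[0, - a, b], [a, 0, - c], [- b, c, 0]])"
proof (rule skew_symmetric_matI)
  fix i j :: nat assume "i < 3" "j < 3"
  then show "mat_of_rows_list 3 [[0, - a, b], [a, 0, - c], [- b, c, 0]] $$ (i, j) +
     mat_of_rows_list 3 [[0, - a, b], [a, 0, - c], [- b, c, 0]] $$ (j, i) = 0"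
    unfolding less_3_iff by (auto simp: mat_of_rows_list_def)
qed (simp add: mat_of_rows_list_in)

text \<open>A generic singular \<open>3\<times>3\<close> matrix is similar to \<open>diag(l, m, 0)\<close>. This is a product of four cross product
  matrices, the outer two being \<open>E\<close>, whose kernel is the kernel of the product.\<close>

lemma certified_det_2_4: "certified_det 2 4"
proof -
  let ?f = "trace_discriminant"
  have "polyfun (Suc 2) ?f" by (rule polyfun_trace_discriminant[OF polymat_id])
  moreover define W where "W = dmat 2 (\<lambda>i. of_nat i + 1)"
  have "W \<in> carrier_mat 2 2" "det W \<noteq> 0" by (simp_all add: W_def det_dmat set_2)
  moreover have "?f (pad 2 W (0\<^sub>m 1 2)) \<noteq> 0"
  proof (rule trace_discriminant_nonzeroI)
    define d :: "nat \<Rightarrow> complex" where "d i = (if i < 2 then of_nat i + 1 else 0)" for i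
    have "pad 2 W (0\<^sub>m 1 2) - d i \<cdot>\<^sub>m 1\<^sub>m 3 = dmat 3 (\<lambda>j. d j - d i)" for i
      by (rule eq_matI) (auto simp: pad_def W_def d_def)
    then show "det (pad 2 W (0\<^sub>m 1 2) - d i \<cdot>\<^sub>m 1\<^sub>m 3) = 0" if "i < 3" for i
      using that by (auto simp: det_dmat)
    show "inj_on d {..<3}" by (auto simp: inj_on_def d_def set_3)
  qed (use pad_carrier[of W 2 "0\<^sub>m 1 2"] in \<open>simp add: W_def\<close>)
  moreover have "product_of_skew_symmetric (Suc 2) 4 A" if A: "A \<in> DET (Suc 2)" and fA: "?f A \<noteq> 0" for A
  proof -
    have Ac: "A \<in> carrier_mat 3 3" and dA: "det A = 0" using A by (simp_all add: DET_def)
    obtain h :: "nat \<Rightarrow> complex" where h: "inj_on h {..<3}" "\<And>i. i < 3 \<Longrightarrow> det (A - h i \<cdot>\<^sub>m 1\<^sub>m 3) = 0"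
      using trace_discriminant_nonzero_imp[OF Ac fA] by metis
    have "A - 0 \<cdot>\<^sub>m 1\<^sub>m 3 = A" using Ac by (intro eq_matI) auto
    then have "0 \<in> h ` {..<3}"
      using pencil_roots_exhausted[OF Ac one_carrier_mat _ h, of 0] dA by simp
    then obtain l m where lm: "h ` {..<3} = {l, m, 0}" "l \<noteq> 0"
    proof -
      assume *: "\<And>l m. h ` {..<3} = {l, m, 0} \<Longrightarrow> l \<noteq> 0 \<Longrightarrow> thesis"
      have n: "h 0 \<noteq> h 1" "h 0 \<noteq> h 2" "h 1 \<noteq> h 2" using h(1) by (auto simp: inj_on_def set_3)
      have im: "h ` {..<3} = {h 0, h 1, h 2}" by (simp add: set_3)
      from \<open>0 \<in> h ` {..<3}\<close> im consider "h 0 = 0" | "h 1 = 0" | "h 2 = 0" by auto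
      then show thesis
      proof cases
        case 1 then show thesis using *[of "h 1" "h 2"] n im by auto
      next
        case 2 then show thesis using *[of "h 0" "h 2"] n im by auto
      next
        case 3 then show thesis using *[of "h 0" "h 1"] n im by auto
      qed
    qed
    define d where "d i = (if i = 0 then l else if i = 1 then m else 0)" for i :: nat
    define E where "E = mat_of_rows_list 3 [[0, -1, 0], [1, 0, 0], [0, 0, 0 :: complex]]"
    define S where "S = mat_of_rows_list 3 [[0, - l, m - l], [l, 0, 0], [l - m, 0, 0]]"
    define T where "T = mat_of_rows_list 3 [[0, -1, 1], [1, 0, 0], [-1, 0, 0 :: complex]]"
    have car: "E \<in> carrier_mat 3 3" "S \<in> carrier_mat 3 3" "T \<in> carrier_mat 3 3"
      by (simp_all add: E_def S_def T_def mat_of_rows_list_in)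
    have "skew_symmetric_mat 3 E" "skew_symmetric_mat 3 S" "skew_symmetric_mat 3 T"
      using cross_product_matrix_skew[of 1 0 0] cross_product_matrix_skew[of l "m - l" 0]
        cross_product_matrix_skew[of 1 1 0] by (simp_all add: E_def S_def T_def)
    note sk = this[THEN product_of_skew_single]
    have "product_of_skew_symmetric 3 4 (E * (S * (T * E)))"
      using product_of_skew_mult[OF sk(1) product_of_skew_mult[OF sk(2) product_of_skew_mult[OF sk(3,1)]]]
      by (simp add: eval_nat_numeral)
    also have "E * (S * (T * E)) = dmat 3 d"
    proof (rule mat_eqI_on[OF _ _ set_3(2)])
      note calc = mat_of_rows_list_def scalar_prod_def set_3
      have TE: "T * E = mat_of_rows_list 3 [[-1, 0, 0], [0, -1, 0], [0, 1, 0]]"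
        by (rule mat_eqI_on[OF mult_carrier_mat[OF car(3,1)] _ set_3(2)])
           (simp_all add: mat_of_rows_list_in, simp add: T_def E_def calc)
      have STE: "S * (T * E) = mat_of_rows_list 3 [[0, m, 0], [- l, 0, 0], [m - l, 0, 0]]"
        unfolding TE
        by (rule mat_eqI_on[OF mult_carrier_mat[OF car(2)] _ set_3(2)])
           (simp_all add: mat_of_rows_list_in, simp add: S_def calc)
      show "\<forall>i\<in>{0, 1, 2}. \<forall>j\<in>{0, 1, 2}. (E * (S * (T * E))) $$ (i, j) = dmat 3 d $$ (i, j)"
        unfolding STE by (simp add: E_def calc d_def)
    qed (use car in \<open>auto intro!: mult_carrier_mat[of _ 3 3 _ 3]\<close>)
    finally have B: "product_of_skew_symmetric 3 4 (dmat 3 d)" .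
    have "det (dmat 3 d - h i \<cdot>\<^sub>m 1\<^sub>m 3) = 0" if "i < 3" for i
    proof -
      have "dmat 3 d - h i \<cdot>\<^sub>m 1\<^sub>m 3 = dmat 3 (\<lambda>j. d j - h i)" by (rule eq_matI) auto
      moreover have "h i \<in> {l, m, 0}" using lm(1) that by auto
      ultimately show ?thesis by (auto simp: det_dmat d_def set_3)
    qed
    then obtain P Q where PQ: "P \<in> carrier_mat 3 3" "Q \<in> carrier_mat 3 3" "P * Q = 1\<^sub>m 3" "Q * P = 1\<^sub>m 3"
      "A = P * dmat 3 d * Q"
      using similar_if_common_eigenvalues[OF Ac dmat_carrier h(1,2)] by metis
    have "product_of_skew_symmetric 3 4 A" unfolding PQ(5)
      by (rule product_of_skew_similar[OF B _ PQ(1-4)]) simp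
    then show ?thesis by simp
  qed
  ultimately show ?thesis by (intro certified_detI[of 2 ?f W "0\<^sub>m 1 2"]) simp_all
qed

section \<open>Three factors in dimension five and seven\<close>

lemma sum_lessThan_add:
  fixes f :: "nat \<Rightarrow> complex"
  shows "(\<Sum>j<m + k. f j) = (\<Sum>i<m. f i) + (\<Sum>i<k. f (m + i))"
  by (induction k) (auto simp: add.assoc)

text \<open>A sum of blocks \<open>(0, y; -x, 0)\<close> bordered by one row, which couples the block \<open>i\<close> with weight \<open>a i\<close>. The
  leading part is the matrix \<open>bip\<close> for diagonal \<open>X\<close> and \<open>Y\<close>, which is a product of three skew
  symmetric matrices when the entries of \<open>X\<close> and \<open>Y\<close> pair up, although it is not generic in its own
  dimension. The border provides the missing parameters.\<close>

definition arrow :: "nat \<Rightarrow> (nat \<Rightarrow> complex) \<Rightarrow> (nat \<Rightarrow> complex) \<Rightarrow> (nat \<Rightarrow> complex) \<Rightarrow> complex mat" where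
  "arrow m x y a = pad (m + m) (bip m (dmat m x) (dmat m y)) (mat 1 (m + m) (\<lambda>(_, j). a (if j < m then j else j - m)))"

lemma arrow_carrier [simp]: "arrow m x y a \<in> carrier_mat (Suc (m + m)) (Suc (m + m))"
  unfolding arrow_def by (rule pad_carrier) auto

lemma arrow_dim [simp]: "dim_row (arrow m x y a) = Suc (m + m)" "dim_col (arrow m x y a) = Suc (m + m)"
  using arrow_carrier[of m x y a] by (auto simp del: arrow_carrier)

abbreviation arrow_pencil where
  "arrow_pencil m \<alpha> \<beta> x y a \<equiv> \<alpha> \<cdot>\<^sub>m arrow m x y a + \<beta> \<cdot>\<^sub>m transpose_mat (arrow m x y a)"

lemma arrow_pencil_rows:
  fixes z :: "nat \<Rightarrow> complex"
  shows "i < m \<Longrightarrow> (\<Sum>q<Suc (m + m). arrow_pencil m \<alpha> \<beta> x y a $$ (i, q) * z q) =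
            (\<alpha> * y i - \<beta> * x i) * z (m + i) + \<beta> * a i * z (m + m)"
    and "i < m \<Longrightarrow> (\<Sum>q<Suc (m + m). arrow_pencil m \<alpha> \<beta> x y a $$ (m + i, q) * z q) =
            (\<beta> * y i - \<alpha> * x i) * z i + \<beta> * a i * z (m + m)"
    and "(\<Sum>q<Suc (m + m). arrow_pencil m \<alpha> \<beta> x y a $$ (m + m, q) * z q) = \<alpha> * (\<Sum>i<m. a i * (z i + z (m + i)))"
proof -
  have e: "arrow m x y a $$ (p, q) = (if p < m then (if q = m + p then y p else 0)
     else if p < m + m then (if m + q = p then - x q else 0)
     else if q < m then a q else if q < m + m then a (q - m) else 0)"
    if "p < Suc (m + m)" "q < Suc (m + m)" for p q
    using that by (auto simp: arrow_def pad_def bip_def)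
  define P where "P p q = arrow_pencil m \<alpha> \<beta> x y a $$ (p, q)" for p q
  have M: "P p q = \<alpha> * arrow m x y a $$ (p, q) + \<beta> * arrow m x y a $$ (q, p)"
    if "p < Suc (m + m)" "q < Suc (m + m)" for p q
    using that by (simp add: P_def)
  have split: "(\<Sum>q<Suc (m + m). P p q * z q) =
      (\<Sum>q<m. P p q * z q) + (\<Sum>q<m. P p (m + q) * z (m + q)) + P p (m + m) * z (m + m)" for p
    by (simp add: sum_lessThan_add)
  show "(\<Sum>q<Suc (m + m). arrow_pencil m \<alpha> \<beta> x y a $$ (i, q) * z q) =
            (\<alpha> * y i - \<beta> * x i) * z (m + i) + \<beta> * a i * z (m + m)" if i: "i < m"
  proof -
    have "P i q = 0" if "q < m" for q using i that by (simp add: M e)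
    moreover have "(\<Sum>q<m. P i (m + q) * z (m + q)) =
        (\<Sum>q<m. if q = i then (\<alpha> * y i - \<beta> * x i) * z (m + i) else 0)"
      by (rule sum.cong) (use i in \<open>auto simp: M e\<close>)
    moreover have "P i (m + m) = \<beta> * a i" using i by (simp add: M e)
    ultimately show ?thesis using i unfolding P_def[symmetric] split
      by simp
  qed
  show "(\<Sum>q<Suc (m + m). arrow_pencil m \<alpha> \<beta> x y a $$ (m + i, q) * z q) =
            (\<beta> * y i - \<alpha> * x i) * z i + \<beta> * a i * z (m + m)" if i: "i < m"
  proof -
    have "P (m + i) (m + q) = 0" if "q < m" for q using i that by (simp add: M e)
    moreover have "(\<Sum>q<m. P (m + i) q * z q) =
        (\<Sum>q<m. if q = i then (\<beta> * y i - \<alpha> * x i) * z i else 0)"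
      by (rule sum.cong) (use i in \<open>auto simp: M e\<close>)
    moreover have "P (m + i) (m + m) = \<beta> * a i" using i by (simp add: M e)
    ultimately show ?thesis using i unfolding P_def[symmetric] split
      by simp
  qed
  show "(\<Sum>q<Suc (m + m). arrow_pencil m \<alpha> \<beta> x y a $$ (m + m, q) * z q) = \<alpha> * (\<Sum>i<m. a i * (z i + z (m + i)))"
  proof -
    have "P (m + m) q = \<alpha> * a q" "P (m + m) (m + q) = \<alpha> * a q" if "q < m" for q
      using that by (simp_all add: M e)
    moreover have "P (m + m) (m + m) = 0" by (simp add: M e)
    ultimately show ?thesis unfolding P_def[symmetric] split
      by (simp add: sum_distrib_left sum.distrib algebra_simps)
  qed
qed

lemma less_double_cases:
  assumes "p < Suc (m + m)"
  obtains i where "i < m" "p = i" | i where "i < m" "p = m + i" | "p = m + m"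
  using assms by (metis add_diff_inverse_nat less_Suc_eq nat_add_left_cancel_less)

text \<open>A block with weight zero splits off, and it is singular when one of its two entries vanishes.\<close>

lemma arrow_singular_decoupled:
  assumes i: "i < m" and a: "a i = 0" and gh: "\<alpha> * y i = \<beta> * x i \<or> \<beta> * y i = \<alpha> * x i"
  shows "det (\<alpha> \<cdot>\<^sub>m arrow m x y a + \<beta> \<cdot>\<^sub>m transpose_mat (arrow m x y a)) = 0"
proof -
  let ?M = "\<alpha> \<cdot>\<^sub>m arrow m x y a + \<beta> \<cdot>\<^sub>m transpose_mat (arrow m x y a)"
  have Mc: "?M \<in> carrier_mat (Suc (m + m)) (Suc (m + m))" by simp
  define k where "k = (if \<alpha> * y i = \<beta> * x i then m + i else i)"
  define z where "z q = (if q = k then 1 else 0 :: complex)" for q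
  have k: "k < m + m" using i by (auto simp: k_def)
  show ?thesis
  proof (rule kernel_imp_det_0[OF Mc, of k z])
    fix p assume "p < Suc (m + m)"
    then show "(\<Sum>q<Suc (m + m). ?M $$ (p, q) * z q) = 0"
    proof (cases rule: less_double_cases)
      case (1 j)
      show ?thesis unfolding 1(2) arrow_pencil_rows(1)[OF 1(1)]
        using gh 1 i by (auto simp: z_def k_def)
    next
      case (2 j)
      show ?thesis unfolding 2(2) arrow_pencil_rows(2)[OF 2(1)]
        using gh 2 i by (auto simp: z_def k_def)
    next
      case 3
      have "a j * (z j + z (m + j)) = 0" if "j < m" for j
        using that i a by (auto simp: z_def k_def)
      then have "(\<Sum>j<m. a j * (z j + z (m + j))) = 0" by (intro sum.neutral) blast
      then show ?thesis unfolding 3 arrow_pencil_rows(3) by simp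
    qed
  qed (use k in \<open>auto simp: z_def\<close>)
qed

text \<open>Eliminating the blocks leaves, up to a nonzero factor, the displayed sum as the last pivot.\<close>

lemma arrow_singular_coupled:
  assumes nz: "\<And>i. i < m \<Longrightarrow> \<alpha> * y i - \<beta> * x i \<noteq> 0 \<and> \<beta> * y i - \<alpha> * x i \<noteq> 0"
    and s: "(\<Sum>i<m. a i ^ 2 * (1 / (\<alpha> * y i - \<beta> * x i) + 1 / (\<beta> * y i - \<alpha> * x i))) = 0"
  shows "det (\<alpha> \<cdot>\<^sub>m arrow m x y a + \<beta> \<cdot>\<^sub>m transpose_mat (arrow m x y a)) = 0"
proof -
  let ?M = "\<alpha> \<cdot>\<^sub>m arrow m x y a + \<beta> \<cdot>\<^sub>m transpose_mat (arrow m x y a)"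
  have Mc: "?M \<in> carrier_mat (Suc (m + m)) (Suc (m + m))" by simp
  define z where "z q = (if q < m then - \<beta> * a q / (\<beta> * y q - \<alpha> * x q)
     else if q < m + m then - \<beta> * a (q - m) / (\<alpha> * y (q - m) - \<beta> * x (q - m)) else 1)" for q
  show ?thesis
  proof (rule kernel_imp_det_0[OF Mc, of "m + m" z])
    fix p assume "p < Suc (m + m)"
    then show "(\<Sum>q<Suc (m + m). ?M $$ (p, q) * z q) = 0"
    proof (cases rule: less_double_cases)
      case (1 j)
      show ?thesis unfolding 1(2) arrow_pencil_rows(1)[OF 1(1)]
        using nz[OF 1(1)] 1 by (simp add: z_def)
    next
      case (2 j)
      show ?thesis unfolding 2(2) arrow_pencil_rows(2)[OF 2(1)]
        using nz[OF 2(1)] 2 by (simp add: z_def)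
    next
      case 3
      have "(\<Sum>i<m. a i * (z i + z (m + i))) =
          - \<beta> * (\<Sum>i<m. a i ^ 2 * (1 / (\<alpha> * y i - \<beta> * x i) + 1 / (\<beta> * y i - \<alpha> * x i)))"
        unfolding sum_distrib_left
        by (rule sum.cong) (auto simp: z_def power2_eq_square algebra_simps)
      then show ?thesis unfolding 3 arrow_pencil_rows(3) s by simp
    qed
  qed (auto simp: z_def)
qed

lemma arrow_nonsingular:
  assumes nz: "\<And>i. i < m \<Longrightarrow> \<alpha> * y i - \<beta> * x i \<noteq> 0 \<and> \<beta> * y i - \<alpha> * x i \<noteq> 0"
    and ab: "\<alpha> \<noteq> 0" "\<beta> \<noteq> 0"
    and s: "(\<Sum>i<m. a i ^ 2 * (1 / (\<alpha> * y i - \<beta> * x i) + 1 / (\<beta> * y i - \<alpha> * x i))) \<noteq> 0"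
  shows "det (\<alpha> \<cdot>\<^sub>m arrow m x y a + \<beta> \<cdot>\<^sub>m transpose_mat (arrow m x y a)) \<noteq> 0"
proof
  let ?M = "\<alpha> \<cdot>\<^sub>m arrow m x y a + \<beta> \<cdot>\<^sub>m transpose_mat (arrow m x y a)"
  let ?n = "Suc (m + m)"
  have Mc: "?M \<in> carrier_mat ?n ?n" by simp
  assume "det ?M = 0"
  then obtain v where v: "v \<in> carrier_vec ?n" "v \<noteq> 0\<^sub>v ?n" "?M *\<^sub>v v = 0\<^sub>v ?n"
    using det_0_iff_vec_prod_zero[OF Mc] by blast
  define z where "z q = v $ q" for q
  have row: "(\<Sum>q<?n. ?M $$ (p, q) * z q) = 0" if "p < ?n" for p
  proof -
    have "(?M *\<^sub>v v) $ p = (\<Sum>q<?n. ?M $$ (p, q) * z q)"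
      using that v(1) Mc unfolding z_def
      by (subst index_mult_mat_vec) (auto simp: scalar_prod_def atLeast0LessThan intro!: sum.cong)
    then show ?thesis using v(3) that by simp
  qed
  have f: "z (m + i) = - \<beta> * a i * z (m + m) / (\<alpha> * y i - \<beta> * x i)"
    and e: "z i = - \<beta> * a i * z (m + m) / (\<beta> * y i - \<alpha> * x i)" if i: "i < m" for i
  proof -
    have "(\<alpha> * y i - \<beta> * x i) * z (m + i) = - (\<beta> * a i * z (m + m))"
      using row[of i] arrow_pencil_rows(1)[OF i, where \<alpha> = \<alpha> and \<beta> = \<beta> and x = x and y = y and a = a and z = z] i by (simp add: add_eq_0_iff2)
    then show "z (m + i) = - \<beta> * a i * z (m + m) / (\<alpha> * y i - \<beta> * x i)"
      using nz[OF i] by (simp add: field_simps)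
    have "(\<beta> * y i - \<alpha> * x i) * z i = - (\<beta> * a i * z (m + m))"
      using row[of "m + i"] arrow_pencil_rows(2)[OF i, where \<alpha> = \<alpha> and \<beta> = \<beta> and x = x and y = y and a = a and z = z] i by (simp add: add_eq_0_iff2)
    then show "z i = - \<beta> * a i * z (m + m) / (\<beta> * y i - \<alpha> * x i)"
      using nz[OF i] by (simp add: field_simps)
  qed
  have "0 = \<alpha> * (\<Sum>i<m. a i * (z i + z (m + i)))"
    using row[of "m + m"] arrow_pencil_rows(3)[where m = m and \<alpha> = \<alpha> and \<beta> = \<beta> and x = x and y = y and a = a and z = z] by simp
  also have "(\<Sum>i<m. a i * (z i + z (m + i))) =
      - \<beta> * z (m + m) * (\<Sum>i<m. a i ^ 2 * (1 / (\<alpha> * y i - \<beta> * x i) + 1 / (\<beta> * y i - \<alpha> * x i)))"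
    unfolding sum_distrib_left
  proof (rule sum.cong)
    fix i assume "i \<in> {..<m}"
    then have i: "i < m" by simp
    show "a i * (z i + z (m + i)) = - \<beta> * z (m + m) *
        (a i ^ 2 * (1 / (\<alpha> * y i - \<beta> * x i) + 1 / (\<beta> * y i - \<alpha> * x i)))"
      unfolding e[OF i] f[OF i] by (simp add: power2_eq_square algebra_simps)
  qed simp
  finally have zm: "z (m + m) = 0" using ab s by simp
  have "z p = 0" if "p < ?n" for p
    using that by (cases rule: less_double_cases) (use e f zm in auto)
  then have "v = 0\<^sub>v ?n" using v(1) by (auto simp: vec_eq_iff z_def)
  with v(2) show False by simp
qed

lemma det_skew_odd:
  fixes M :: "complex mat"
  assumes "M \<in> carrier_mat n n" "odd n" "transpose_mat M = (-1) \<cdot>\<^sub>m M"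
  shows "det M = 0"
proof -
  have "det M = det ((-1) \<cdot>\<^sub>m M)" using det_transpose[OF assms(1)] assms(3) by simp
  also have "\<dots> = - det M" using assms(1,2) by simp
  finally show ?thesis by simp
qed

text \<open>A singular \<open>A\<close> has the roots \<open>0\<close> and \<open>\<infinity>\<close> in its pencil \<open>det (A - t A\<^sup>T)\<close>, which puts it outside
  the reach of cosquares. The combination \<open>A + 2 A\<^sup>T\<close> transforms in the same way under congruence,
  is generically invertible, and its pencil is that of \<open>A\<close> after a Moebius change of \<open>t\<close>, which moves
  these two roots to \<open>2\<close> and \<open>1/2\<close>.\<close>

abbreviation shifted :: "complex mat \<Rightarrow> complex mat" where
  "shifted A \<equiv> 1 \<cdot>\<^sub>m A + 2 \<cdot>\<^sub>m transpose_mat A"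

lemma shifted_pencil:
  assumes "A \<in> carrier_mat n n"
  shows "shifted A - s \<cdot>\<^sub>m transpose_mat (shifted A) = (1 - 2 * s) \<cdot>\<^sub>m A + (2 - s) \<cdot>\<^sub>m transpose_mat A"
  using assms by (intro eq_matI) (auto simp: algebra_simps)

text \<open>At \<open>s = 2\<close> and \<open>s = 1/2\<close> the pencil is a multiple of \<open>A\<close> and of \<open>A\<^sup>T\<close>; at \<open>s = 1\<close> it is skew symmetric of odd
  order.\<close>

lemma shifted_special_roots:
  assumes A: "A \<in> carrier_mat n n" "odd n" "det A = 0" and s: "s \<in> {1, 2, 1 / 2}"
  shows "det (shifted A - s \<cdot>\<^sub>m transpose_mat (shifted A)) = 0"
proof -
  have n: "n > 0" using A(2) by (cases n) auto
  consider "s = 1" | "s = 2" | "s = 1 / 2" using s by auto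
  then show ?thesis
  proof cases
    case 1
    show ?thesis unfolding shifted_pencil[OF A(1)] 1
      by (rule det_skew_odd[OF _ A(2)]) (use A(1) in \<open>auto intro!: eq_matI\<close>)
  next
    case 2
    have "(1 - 2 * s) \<cdot>\<^sub>m A + (2 - s) \<cdot>\<^sub>m transpose_mat A = (- 3) \<cdot>\<^sub>m A"
      unfolding 2 using A(1) by (intro eq_matI) auto
    then show ?thesis unfolding shifted_pencil[OF A(1)] using A by simp
  next
    case 3
    have "(1 - 2 * s) \<cdot>\<^sub>m A + (2 - s) \<cdot>\<^sub>m transpose_mat A = (3 / 2) \<cdot>\<^sub>m transpose_mat A"
      unfolding 3 using A(1) by (intro eq_matI) auto
    then show ?thesis unfolding shifted_pencil[OF A(1)] using A det_transpose[OF A(1)] by simp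
  qed
qed

lemma unshift_congruence:
  assumes "A \<in> carrier_mat n n" "B \<in> carrier_mat n n" "P \<in> carrier_mat n n"
    and eq: "shifted A = P * shifted B * transpose_mat P"
  shows "A = P * B * transpose_mat P"
proof -
  let ?T = transpose_mat
  have un: "M = (2 / 3) \<cdot>\<^sub>m ?T (shifted M) + (- (1 / 3)) \<cdot>\<^sub>m shifted M" if "M \<in> carrier_mat n n" for M
    using that by (intro eq_matI) (auto simp: algebra_simps)
  have sB: "shifted B \<in> carrier_mat n n" using assms(2) by simp
  have "?T (P * C * ?T P) = P * ?T C * ?T P" if "C \<in> carrier_mat n n" for C
    using that assms(3) by (simp add: transpose_mult[of _ n n _ n] assoc_mult_mat[of _ n n _ n _ n])
  note tr = this[OF sB]
  have lin: "u \<cdot>\<^sub>m (P * C * ?T P) + w \<cdot>\<^sub>m (P * D * ?T P) = P * (u \<cdot>\<^sub>m C + w \<cdot>\<^sub>m D) * ?T P"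
    if "C \<in> carrier_mat n n" "D \<in> carrier_mat n n" for C D and u w :: complex
    using that assms(3)
    by (simp add: mult_add_distrib_mat[of _ n n _ n] add_mult_distrib_mat[of _ n n _ _ n]
        mult_smult_distrib[of _ n n _ n] mult_smult_assoc_mat[of _ n n _ n] del: assoc_mult_mat)
  have "A = (2 / 3) \<cdot>\<^sub>m (P * ?T (shifted B) * ?T P) + (- (1 / 3)) \<cdot>\<^sub>m (P * shifted B * ?T P)"
    using un[OF assms(1)] unfolding eq tr .
  also have "\<dots> = P * ((2 / 3) \<cdot>\<^sub>m ?T (shifted B) + (- (1 / 3)) \<cdot>\<^sub>m shifted B) * ?T P"
    by (rule lin) (use sB in auto)
  also have "\<dots> = P * B * ?T P" using un[OF assms(2)] by simp
  finally show ?thesis .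
qed

lemma arrow_product_of_three_skew:
  assumes nz: "\<And>i. i < m \<Longrightarrow> x i \<noteq> 0 \<and> y i \<noteq> 0"
    and pair: "\<And>i. i < m + m \<Longrightarrow> \<sigma> i < m + m \<and> \<sigma> i \<noteq> i \<and> \<sigma> (\<sigma> i) = i \<and>
       (if \<sigma> i < m then x (\<sigma> i) else y (\<sigma> i - m)) = (if i < m then x i else y (i - m))"
  shows "product_of_skew_symmetric (Suc (m + m)) 3 (arrow m x y a)"
proof (rule three_skew_from_leading_block)
  have dd: "diagonalized m (dmat m d) d" for d
    by (rule diagonalizedI[of _ _ "1\<^sub>m m" "1\<^sub>m m"]) auto
  have lead: "leading_block (m + m) (arrow m x y a) = bip m (dmat m x) (dmat m y)"
    unfolding arrow_def by (rule leading_block_pad) auto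
  show "det (leading_block (m + m) (arrow m x y a)) \<noteq> 0"
    unfolding lead using nz by (simp add: det_bip det_dmat)
  have "product_of_skew_symmetric (m + m) 2
     (four_block_mat (transpose_mat (dmat m x)) (0\<^sub>m m m) (0\<^sub>m m m) (dmat m y))"
    by (rule diagonalized_product_of_two_skew[OF diagonalized_blocks[OF diagonalized_transpose[OF dd] dd], where \<sigma> = \<sigma>])
       (rule pair)
  from bip_product_of_skew[OF _ _ this]
  show "product_of_skew_symmetric (m + m) 3 (leading_block (m + m) (arrow m x y a))"
    unfolding lead by (simp add: eval_nat_numeral)
  show "det (arrow m x y a) = 0" unfolding arrow_def by (rule det_pad) auto
qed simp

text \<open>Three of the \<open>2m + 1\<close> cosquare eigenvalues of \<open>A + 2 A\<^sup>T\<close> are always \<open>1, 2, 1/2\<close>. The others form \<open>m - 1\<close>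
  reciprocal pairs, so an arrow matrix for each choice of one root per pair provides a matrix congruent
  to \<open>A\<close>.\<close>

lemma certified_det_from_arrow_family:
  assumes m: "m = 2 \<or> m = 3"
    and fam: "\<And>H. finite H \<Longrightarrow> card H = m - 1 \<Longrightarrow> H \<inter> {0, 1, -1, 2, 1 / 2} = {} \<Longrightarrow> \<exists>x y a.
       product_of_skew_symmetric (Suc (m + m)) 3 (arrow m x y a) \<and>
       det (1 \<cdot>\<^sub>m arrow m x y a + 2 \<cdot>\<^sub>m transpose_mat (arrow m x y a)) \<noteq> 0 \<and>
       (\<forall>s\<in>H \<union> inverse ` H.
          det ((1 - 2 * s) \<cdot>\<^sub>m arrow m x y a + (2 - s) \<cdot>\<^sub>m transpose_mat (arrow m x y a)) = 0)"
  shows "certified_det (m + m) 3"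
proof -
  let ?k = "m + m"
  let ?n = "Suc ?k"
  let ?T = transpose_mat
  have odd: "odd ?n" by simp
  let ?f = "\<lambda>A. det (shifted A) * (det (1 \<cdot>\<^sub>m A + 1 \<cdot>\<^sub>m ?T A) * cosquare_discriminant (shifted A))"
  have ps: "polymat ?n ?n (\<lambda>A. shifted A)"
    by (intro polymat_add polymat_smult polymat_transpose polymat_id)
  have "polyfun ?n ?f"
    by (intro polyfun_mult polyfun_det[OF ps] polyfun_cosquare_discriminant[OF ps] polyfun_det[of _ ?n]
        polymat_add polymat_smult polymat_transpose polymat_id)
  \<comment> \<open>The witness has weight only on the first block \<open>(0, 1; 1, 0)\<close>; the blocks \<open>(0, i + 1; 1, 0)\<close> split off.\<close>
  moreover define X where "X = dmat m (\<lambda>i. -1)"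
  moreover define Y where "Y = dmat m (\<lambda>i. of_nat (Suc i))"
  moreover define a :: "nat \<Rightarrow> complex" where "a i = (if i = 0 then 1 else 0)" for i
  moreover define w where "w = mat 1 (m + m) (\<lambda>(_ :: nat, j). a (if j < m then j else j - m))"
  moreover have "bip m X Y \<in> carrier_mat ?k ?k" "w \<in> carrier_mat 1 ?k" by (simp_all add: X_def Y_def w_def)
  moreover have "det (bip m X Y) \<noteq> 0" by (simp add: X_def Y_def det_bip det_dmat del: of_nat_Suc)
  moreover have "?f (pad ?k (bip m X Y) w) \<noteq> 0"
  proof -
    define W where "W = arrow m (\<lambda>i. -1) (\<lambda>i. of_nat (Suc i)) a"
    have W: "pad ?k (bip m X Y) w = W" by (simp add: W_def arrow_def X_def Y_def w_def)
    have Wc: "W \<in> carrier_mat ?n ?n" by (simp add: W_def)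
    have dW: "det W = 0" unfolding W_def arrow_def by (rule det_pad) auto
    have suma: "(\<Sum>i<m. a i ^ 2 * f i) = f 0" for f :: "nat \<Rightarrow> complex"
    proof -
      have "(\<Sum>i<m. a i ^ 2 * f i) = (\<Sum>i<m. if i = 0 then f 0 else 0)"
        by (rule sum.cong) (auto simp: a_def)
      then show ?thesis using m by auto
    qed
    have pos: "of_nat p * of_nat (Suc i) - of_nat q * (- 1) \<noteq> (0 :: complex)" if "q > 0" for p q i
    proof -
      have "of_nat p * of_nat (Suc i) - of_nat q * (- 1) = (of_nat (p * Suc i + q) :: complex)"
        by (simp add: algebra_simps)
      then show ?thesis using that by (metis of_nat_eq_0_iff add_is_0 less_numeral_extra(3))
    qed
    have reg: "det (of_nat p \<cdot>\<^sub>m W + of_nat q \<cdot>\<^sub>m ?T W) \<noteq> 0" if "p > 0" "q > 0" for p q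
      unfolding W_def
    proof (rule arrow_nonsingular)
      show "of_nat p \<noteq> (0 :: complex)" "of_nat q \<noteq> (0 :: complex)" using that by auto
      have "of_nat p + of_nat q \<noteq> (0 :: complex)" using that by (metis of_nat_add of_nat_eq_0_iff add_is_0 less_numeral_extra(3))
      then show "(\<Sum>i<m. a i ^ 2 * (1 / (of_nat p * of_nat (Suc i) - of_nat q * (- 1)) +
          1 / (of_nat q * of_nat (Suc i) - of_nat p * (- 1)))) \<noteq> (0 :: complex)"
        unfolding suma by (simp add: add.commute[of "of_nat q"])
    qed (use pos that in blast)
    have dS: "det (shifted W) \<noteq> 0" using reg[of 1 2] by simp
    moreover have "det (1 \<cdot>\<^sub>m W + 1 \<cdot>\<^sub>m ?T W) \<noteq> 0" using reg[of 1 1] by simp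
    moreover have "cosquare_discriminant (shifted W) \<noteq> 0"
    proof (rule cosquare_discriminant_nonzeroI[OF _ dS])
      \<comment> \<open>After the three constant roots, the block with entry \<open>i + 1\<close> contributes \<open>(i + 3) / (2 i + 3)\<close> and its reciprocal.\<close>
      let ?L = "[1, 2, 1 / 2, 4 / 5, 5 / 4, 5 / 7, 7 / 5] :: complex list"
      have dist: "distinct ?L" by simp
      have n7: "?n \<le> length ?L" using m by auto
      show "inj_on (\<lambda>i. ?L ! i) {..<?n}"
        using dist n7 by (auto simp: inj_on_def nth_eq_iff_index_eq)
      fix i assume i: "i < ?n"
      have block: "det (shifted W - s \<cdot>\<^sub>m ?T (shifted W)) = 0"
        if "j < m" "j > 0" "(1 - 2 * s) * of_nat (Suc j) = (2 - s) * (- 1) \<or> (2 - s) * of_nat (Suc j) = (1 - 2 * s) * (- 1)" for s j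
        unfolding shifted_pencil[OF Wc] unfolding W_def
        by (rule arrow_singular_decoupled[of j]) (use that in \<open>auto simp: a_def\<close>)
      have "i \<in> {0, 1, 2} \<or> i \<in> {3, 4} \<or> i \<in> {5, 6} \<and> m = 3" using i m by auto
      then show "det (shifted W - ?L ! i \<cdot>\<^sub>m ?T (shifted W)) = 0"
      proof (elim disjE conjE)
        assume "i \<in> {0, 1, 2}"
        then show ?thesis by (intro shifted_special_roots[OF Wc odd dW]) auto
      next
        assume "i \<in> {3, 4}" then show ?thesis using m by (intro block[of 1]) auto
      next
        assume "i \<in> {5, 6}" "m = 3" then show ?thesis by (intro block[of 2]) auto
      qed
    qed (use Wc in simp)
    ultimately show ?thesis unfolding W by simp
  qed
  moreover have "product_of_skew_symmetric ?n 3 A" if AD: "A \<in> DET ?n" and fA: "?f A \<noteq> 0" for A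
  proof -
    have A: "A \<in> carrier_mat ?n ?n" "det A = 0" using AD by (auto simp: DET_def)
    define C where "C = shifted A"
    have C: "C \<in> carrier_mat ?n ?n" "det C \<noteq> 0" "cosquare_discriminant C \<noteq> 0" using fA A(1) by (auto simp: C_def)
    have TC: "?T C \<in> carrier_mat ?n ?n" "det (?T C) \<noteq> 0" using C det_transpose[OF C(1)] by auto
    obtain h where h: "inj_on h {..<?n}" "\<And>i. i < ?n \<Longrightarrow> det (C - h i \<cdot>\<^sub>m ?T C) = 0"
      using cosquare_discriminant_nonzero_imp[OF C] by metis
    define R where "R = h ` {..<?n}"
    have R: "t \<in> R \<longleftrightarrow> det (C - t \<cdot>\<^sub>m ?T C) = 0" for t
      using pencil_roots_exhausted[OF C(1) TC h(1,2), of t] h(2) by (auto simp: R_def)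
    have spec: "s \<in> R" if "s \<in> {1, 2, 1 / 2}" for s
      using shifted_special_roots[OF A(1) odd A(2) that] by (simp add: R C_def)
    have "C - 0 \<cdot>\<^sub>m ?T C = C" using C by (intro eq_matI) auto
    then have R0: "0 \<notin> R" using C(2) by (simp add: R)
    have Rm: "-1 \<notin> R"
    proof -
      have "C - (-1) \<cdot>\<^sub>m ?T C = 3 \<cdot>\<^sub>m (1 \<cdot>\<^sub>m A + 1 \<cdot>\<^sub>m ?T A)"
        unfolding C_def using A(1) by (intro eq_matI) (auto simp: algebra_simps)
      then show ?thesis using fA A(1) by (simp add: R)
    qed
    have Rinv: "inverse t \<in> R" if "t \<in> R" for t
    proof -
      have t: "t \<noteq> 0" using R0 that by auto
      have "C - inverse t \<cdot>\<^sub>m ?T C = (- inverse t) \<cdot>\<^sub>m ?T (C - t \<cdot>\<^sub>m ?T C)"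
        using C(1) t by (intro eq_matI) (auto simp: field_simps)
      moreover have "det (?T (C - t \<cdot>\<^sub>m ?T C)) = 0"
        using that C(1) det_transpose[of "C - t \<cdot>\<^sub>m ?T C" ?n] by (simp add: R minus_carrier_mat)
      ultimately show ?thesis by (simp add: R)
    qed
    let ?R' = "R - {1, 2, 1 / 2}"
    have "card R = ?n" using card_image[OF h(1)] by (simp add: R_def)
    moreover have "card {1, 2, 1 / 2 :: complex} = 3" by simp
    ultimately have cR: "card ?R' = 2 * (m - 1)"
      using spec card_Diff_subset[of "{1, 2, 1 / 2}" R] m by auto
    have inv': "inverse t \<in> ?R'" if "t \<in> ?R'" for t
    proof -
      have inv_ne: "inverse t \<noteq> u" if "t \<noteq> inverse u" for u using that by (metis inverse_inverse_eq)
      have "t \<noteq> inverse 1" "t \<noteq> inverse 2" "t \<noteq> inverse (1 / 2)"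
        using that by (simp_all add: inverse_eq_divide)
      then have "inverse t \<noteq> 1" "inverse t \<noteq> 2" "inverse t \<noteq> 1 / 2"
        using inv_ne by blast+
      with Rinv that show ?thesis by auto
    qed
    obtain H where H: "finite H" "card H = m - 1" "0 \<notin> H" "?R' = H \<union> inverse ` H"
      by (rule reciprocal_transversal[of ?R' "m - 1"]) (use cR inv' R0 Rm in \<open>auto simp: R_def\<close>)
    have "H \<subseteq> ?R'" using H(4) by blast
    then have "H \<inter> {0, 1, -1, 2, 1 / 2} = {}" using R0 Rm by blast
    then obtain x y b where B: "product_of_skew_symmetric ?n 3 (arrow m x y b)"
       "det (shifted (arrow m x y b)) \<noteq> 0"
       "\<forall>s\<in>H \<union> inverse ` H. det ((1 - 2 * s) \<cdot>\<^sub>m arrow m x y b + (2 - s) \<cdot>\<^sub>m ?T (arrow m x y b)) = 0"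
      using fam[OF H(1,2)] by blast
    define B where "B = arrow m x y b"
    have Bc: "B \<in> carrier_mat ?n ?n" and sB: "shifted B \<in> carrier_mat ?n ?n" by (simp_all add: B_def)
    have dB: "det B = 0" unfolding B_def arrow_def by (rule det_pad) auto
    have "det (shifted B - h i \<cdot>\<^sub>m ?T (shifted B)) = 0" if "i < ?n" for i
    proof (cases "h i \<in> {1, 2, 1 / 2}")
      case True
      then show ?thesis by (rule shifted_special_roots[OF Bc odd dB])
    next
      case False
      then have "h i \<in> H \<union> inverse ` H" using that H(4) by (auto simp: R_def)
      then show ?thesis unfolding shifted_pencil[OF Bc] using B(3) by (simp add: B_def)
    qed
    then obtain P Q where PQ: "P \<in> carrier_mat ?n ?n" "Q \<in> carrier_mat ?n ?n"
      "P * Q = 1\<^sub>m ?n" "Q * P = 1\<^sub>m ?n" "C = P * shifted B * ?T P"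
      using congruent_if_common_cosquare_spectrum[OF sB _ C(1,2) h(1) _ h(2)] B(2) unfolding B_def by metis
    have "A = P * B * ?T P" by (rule unshift_congruence[OF A(1) Bc PQ(1)]) (use PQ(5) in \<open>simp add: C_def\<close>)
    then show ?thesis using product_of_skew_congruence[OF B(1) _ PQ(1-4)] by (simp add: B_def)
  qed
  ultimately show ?thesis by (intro certified_detI[of ?k ?f "bip m X Y" w])
qed

text \<open>With weight only on the first block the second block splits off, and its entry ratio \<open>t\<close> carries the single
  prescribed root; the first block has the entries of the second in reversed order for the pairing.\<close>

lemma certified_det_4_3: "certified_det 4 3"
proof -
  have "certified_det (2 + 2) 3"
  proof (rule certified_det_from_arrow_family)
    fix H :: "complex set" assume H: "finite H" "card H = 2 - 1" "H \<inter> {0, 1, -1, 2, 1 / 2} = {}"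
    then obtain s where Hs: "H = {s}" by (auto simp: card_1_singleton_iff)
    have s: "s \<noteq> 0" "s \<noteq> 1" "s \<noteq> -1" "s \<noteq> 2" "s \<noteq> 1 / 2" using H(3) Hs by auto
    define t where "t = (1 - 2 * s) / (2 - s)"
    have s2: "2 - s \<noteq> 0" using s by auto
    have t: "t * (2 - s) = 1 - 2 * s" using s2 by (simp add: t_def)
    have "2 * s \<noteq> 1"
    proof
      assume "2 * s = 1"
      then have "s = 1 / 2" by (metis nonzero_mult_div_cancel_left zero_neq_numeral)
      with s show False by simp
    qed
    then have t0: "t \<noteq> 0" using s2 by (simp add: t_def)
    have t1: "t \<noteq> 1"
    proof
      assume "t = 1" with t have "s + 1 = 0" by (simp add: algebra_simps)
      then have "s = -1" by (simp only: eq_neg_iff_add_eq_0)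
      with s show False by simp
    qed
    have t2: "t \<noteq> 2"
    proof
      assume "t = 2" with t show False by (simp add: algebra_simps)
    qed
    have th: "2 * t \<noteq> 1"
    proof
      assume "2 * t = 1"
      then have "2 - s = 2 * (1 - 2 * s)" using t by (metis mult.assoc mult_1)
      then have "3 * s = 0" by (simp add: algebra_simps)
      with s show False by simp
    qed
    define x where "x i = (if i = 0 then 1 else t)" for i :: nat
    define y where "y i = (if i = 0 then t else 1)" for i :: nat
    define a where "a i = (if i = 0 then 1 else 0 :: complex)" for i :: nat
    have "product_of_skew_symmetric (Suc (2 + 2)) 3 (arrow 2 x y a)"
      by (rule arrow_product_of_three_skew[where \<sigma> = "\<lambda>i. 3 - i"])
        (use t0 in \<open>auto simp: x_def y_def less_4_iff\<close>)
    moreover have "det (1 \<cdot>\<^sub>m arrow 2 x y a + 2 \<cdot>\<^sub>m transpose_mat (arrow 2 x y a)) \<noteq> 0"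
    proof (rule arrow_nonsingular)
      have n: "t - 2 \<noteq> 0" "2 * t - 1 \<noteq> 0" "1 - 2 * t \<noteq> 0" "2 - t \<noteq> 0" using t2 th by auto
      show "1 * y i - 2 * x i \<noteq> 0 \<and> 2 * y i - 1 * x i \<noteq> 0" if "i < 2" for i
        using that n by (auto simp: x_def y_def less_2_iff)
      have "1 / (t - 2) + 1 / (2 * t - 1) = 3 * (t - 1) / ((t - 2) * (2 * t - 1))"
        using n by (simp add: field_simps)
      then show "(\<Sum>i<2. a i ^ 2 * (1 / (1 * y i - 2 * x i) + 1 / (2 * y i - 1 * x i))) \<noteq> 0"
        using n t1 by (simp add: set_2 a_def x_def y_def)
    qed auto
    moreover have "det ((1 - 2 * u) \<cdot>\<^sub>m arrow 2 x y a + (2 - u) \<cdot>\<^sub>m transpose_mat (arrow 2 x y a)) = 0"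
      if "u \<in> H \<union> inverse ` H" for u
    proof (rule arrow_singular_decoupled[of 1])
      have "u = s \<or> u = 1 / s" using that Hs by (auto simp: inverse_eq_divide)
      then show "(1 - 2 * u) * y 1 = (2 - u) * x 1 \<or> (2 - u) * y 1 = (1 - 2 * u) * x 1"
      proof
        assume "u = s" then show ?thesis using t by (simp add: x_def y_def mult.commute)
      next
        assume u: "u = 1 / s"
        have e: "2 - u = - (1 - 2 * s) / s" "1 - 2 * u = - (2 - s) / s" using s by (simp_all add: u field_simps)
        have "(2 - u) * y 1 = (1 - 2 * u) * x 1" unfolding e t[symmetric]
          using s(1) by (simp add: x_def y_def field_simps)
        then show ?thesis ..
      qed
    qed (auto simp: a_def)
    ultimately show "\<exists>x y a. product_of_skew_symmetric (Suc (2 + 2)) 3 (arrow 2 x y a) \<and>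
       det (1 \<cdot>\<^sub>m arrow 2 x y a + 2 \<cdot>\<^sub>m transpose_mat (arrow 2 x y a)) \<noteq> 0 \<and>
       (\<forall>s\<in>H \<union> inverse ` H.
          det ((1 - 2 * s) \<cdot>\<^sub>m arrow 2 x y a + (2 - s) \<cdot>\<^sub>m transpose_mat (arrow 2 x y a)) = 0)"
      by blast
  qed simp
  then show ?thesis by simp
qed

text \<open>With \<open>\<rho> = (\<alpha>\<^sup>2 + \<beta>\<^sup>2) / (\<alpha> \<beta>)\<close> and \<open>c = (x\<^sup>2 + y\<^sup>2) / (x y)\<close>, each summand is a simple fraction in \<open>\<rho>\<close>.\<close>

lemma coupling_term:
  fixes \<alpha> \<beta> x y :: complex
  assumes "\<alpha> \<noteq> 0" "\<beta> \<noteq> 0" "x \<noteq> 0" "y \<noteq> 0"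
  defines "\<rho> \<equiv> (\<alpha> ^ 2 + \<beta> ^ 2) / (\<alpha> * \<beta>)" and "c \<equiv> (x ^ 2 + y ^ 2) / (x * y)"
  shows "(\<alpha> * y - \<beta> * x) * (\<beta> * y - \<alpha> * x) = - (x * y * (\<alpha> * \<beta>)) * (\<rho> - c)"
    and "(\<alpha> * y - \<beta> * x \<noteq> 0 \<and> \<beta> * y - \<alpha> * x \<noteq> 0) \<longleftrightarrow> \<rho> \<noteq> c"
    and "\<rho> \<noteq> c \<Longrightarrow> 1 / (\<alpha> * y - \<beta> * x) + 1 / (\<beta> * y - \<alpha> * x) =
       - ((\<alpha> + \<beta>) / (\<alpha> * \<beta>)) * ((y - x) / (x * y) / (\<rho> - c))"
proof -
  show 1: "(\<alpha> * y - \<beta> * x) * (\<beta> * y - \<alpha> * x) = - (x * y * (\<alpha> * \<beta>)) * (\<rho> - c)"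
    unfolding \<rho>_def c_def using assms(1-4) by (simp add: field_simps power2_eq_square)
  show 2: "(\<alpha> * y - \<beta> * x \<noteq> 0 \<and> \<beta> * y - \<alpha> * x \<noteq> 0) \<longleftrightarrow> \<rho> \<noteq> c"
    using 1 assms(1-4) by (metis diff_numeral_special(9) eq_iff_diff_eq_0 mult_eq_0_iff neg_equal_0_iff_equal)
  assume ne: "\<rho> \<noteq> c"
  with 2 have nz: "\<alpha> * y - \<beta> * x \<noteq> 0" "\<beta> * y - \<alpha> * x \<noteq> 0" by auto
  have "1 / (\<alpha> * y - \<beta> * x) + 1 / (\<beta> * y - \<alpha> * x) =
      ((\<alpha> * y - \<beta> * x) + (\<beta> * y - \<alpha> * x)) / ((\<alpha> * y - \<beta> * x) * (\<beta> * y - \<alpha> * x))"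
    using nz by (simp add: add_divide_distrib)
  also have "(\<alpha> * y - \<beta> * x) + (\<beta> * y - \<alpha> * x) = (\<alpha> + \<beta>) * (y - x)" by (simp add: algebra_simps)
  also note 1
  also have "(\<alpha> + \<beta>) * (y - x) / (- (x * y * (\<alpha> * \<beta>)) * (\<rho> - c)) =
     - ((\<alpha> + \<beta>) / (\<alpha> * \<beta>)) * ((y - x) / (x * y) / (\<rho> - c))"
  proof -
    define D where "D = \<rho> - c"
    have "D \<noteq> 0" using ne by (simp add: D_def)
    then show ?thesis unfolding D_def[symmetric] using assms(1-4) by (simp add: field_simps)
  qed
  finally show "1 / (\<alpha> * y - \<beta> * x) + 1 / (\<beta> * y - \<alpha> * x) =
       - ((\<alpha> + \<beta>) / (\<alpha> * \<beta>)) * ((y - x) / (x * y) / (\<rho> - c))" .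
qed

text \<open>Fixed blocks with entry pairs \<open>(3, 1), (4, 3), (1, 4)\<close> satisfy the pairing condition, and the three
  values \<open>c i\<close> are distinct. In terms of \<open>\<rho>\<close> the last pivot is, up to a nonzero factor, \<open>\<Sum> \<kappa> i / (\<rho> - c i)\<close> with \<open>\<kappa> i\<close> at our disposal
  through the weights; taking for \<open>\<kappa> i\<close> the residues of
  \<open>(\<rho> - \<rho> s1) (\<rho> - \<rho> s2) / \<Prod> (\<rho> - c i)\<close> puts its zeros at the prescribed places. As \<open>\<rho>\<close> takes the same value
  at \<open>s\<close> and \<open>1/s\<close>, the reciprocal roots follow.\<close>

lemma certified_det_6_3: "certified_det 6 3"
proof -
  have "certified_det (3 + 3) 3"
  proof (rule certified_det_from_arrow_family)
    fix H :: "complex set" assume H: "finite H" "card H = 3 - 1" "H \<inter> {0, 1, -1, 2, 1 / 2} = {}"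
    then obtain s1 s2 where Hs: "H = {s1, s2}" by (auto simp: card_2_iff)
    have H0: "s \<noteq> 0 \<and> 2 - s \<noteq> 0 \<and> 1 - 2 * s \<noteq> 0" if "s \<in> H" for s
    proof -
      have "s \<noteq> 0" "s \<noteq> 2" "s \<noteq> 1 / 2" using that H(3) by blast+
      moreover have "s = 1 / 2" if "1 - 2 * s = 0"
      proof -
        have "2 * s = 1" using that by simp
        then show ?thesis by (metis nonzero_mult_div_cancel_left zero_neq_numeral)
      qed
      ultimately show ?thesis by (metis eq_iff_diff_eq_0)
    qed
    define \<rho> where "\<rho> s = ((1 - 2 * s) ^ 2 + (2 - s) ^ 2) / ((1 - 2 * s) * (2 - s))" for s :: complex
    define q where "q r = (r - \<rho> s1) * (r - \<rho> s2)" for r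
    define x where "x i = (if i = 0 then 3 else if i = 1 then 4 else 1 :: complex)" for i :: nat
    define y where "y i = (if i = 0 then 1 else if i = 1 then 3 else 4 :: complex)" for i :: nat
    define c where "c i = (if i = 0 then 10 / 3 else if i = 1 then 25 / 12 else 17 / 4 :: complex)" for i :: nat
    \<comment> \<open>The numerical factors are the inverses of \<open>\<Prod> (c i - c j)\<close> over \<open>j \<noteq> i\<close>.\<close>
    define \<kappa> where "\<kappa> i = q (c i) * (if i = 0 then - 48 / 55 else if i = 1 then 24 / 65 else 72 / 143)" for i
    define a where "a i = csqrt (\<kappa> i * (x i * y i / (y i - x i)))" for i
    have xy: "x i \<noteq> 0 \<and> y i \<noteq> 0 \<and> y i - x i \<noteq> 0" for i by (auto simp: x_def y_def)
    have c: "(x i ^ 2 + y i ^ 2) / (x i * y i) = c i" for i by (auto simp: x_def y_def c_def power2_eq_square)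
    have a2: "a i ^ 2 * ((y i - x i) / (x i * y i) / d) = \<kappa> i / d" for i d
      using xy[of i] by (simp add: a_def)
    have interp: "\<kappa> 0 * ((r - c 1) * (r - c 2)) + \<kappa> 1 * ((r - c 0) * (r - c 2)) + \<kappa> 2 * ((r - c 0) * (r - c 1)) = q r" for r
      by (simp add: \<kappa>_def q_def c_def field_simps)
    have sum: "(\<Sum>i<3. a i ^ 2 * (1 / (\<alpha> * y i - \<beta> * x i) + 1 / (\<beta> * y i - \<alpha> * x i))) =
        - ((\<alpha> + \<beta>) / (\<alpha> * \<beta>)) * (q r / ((r - c 0) * (r - c 1) * (r - c 2)))"
      if ab: "\<alpha> \<noteq> 0" "\<beta> \<noteq> 0" and r: "r = (\<alpha> ^ 2 + \<beta> ^ 2) / (\<alpha> * \<beta>)" and ne: "\<And>i. i < 3 \<Longrightarrow> r \<noteq> c i" for \<alpha> \<beta> r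
    proof -
      have summand: "a i ^ 2 * (1 / (\<alpha> * y i - \<beta> * x i) + 1 / (\<beta> * y i - \<alpha> * x i)) =
          - ((\<alpha> + \<beta>) / (\<alpha> * \<beta>)) * (\<kappa> i / (r - c i))" if "i < 3" for i
      proof -
        have e: "1 / (\<alpha> * y i - \<beta> * x i) + 1 / (\<beta> * y i - \<alpha> * x i) =
            - ((\<alpha> + \<beta>) / (\<alpha> * \<beta>)) * ((y i - x i) / (x i * y i) / (r - c i))"
          using coupling_term(3)[OF ab, of "x i" "y i"] xy[of i] ne[OF that] unfolding c r[symmetric] by blast
        show ?thesis unfolding e by (subst a2[symmetric]) (simp only: mult_ac)
      qed
      have nz: "r - c 0 \<noteq> 0" "r - c 1 \<noteq> 0" "r - c 2 \<noteq> 0" using ne[of 0] ne[of 1] ne[of 2] by auto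
      have "(\<Sum>i<3. a i ^ 2 * (1 / (\<alpha> * y i - \<beta> * x i) + 1 / (\<beta> * y i - \<alpha> * x i))) =
          (\<Sum>i<3. - ((\<alpha> + \<beta>) / (\<alpha> * \<beta>)) * (\<kappa> i / (r - c i)))"
        by (rule sum.cong) (use summand in auto)
      also have "\<dots> = - ((\<alpha> + \<beta>) / (\<alpha> * \<beta>)) * (\<kappa> 0 / (r - c 0) + \<kappa> 1 / (r - c 1) + \<kappa> 2 / (r - c 2))"
        unfolding set_3 by (simp add: algebra_simps)
      also have "\<kappa> 0 / (r - c 0) + \<kappa> 1 / (r - c 1) + \<kappa> 2 / (r - c 2) =
          (\<kappa> 0 * ((r - c 1) * (r - c 2)) + \<kappa> 1 * ((r - c 0) * (r - c 2)) + \<kappa> 2 * ((r - c 0) * (r - c 1))) /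
          ((r - c 0) * (r - c 1) * (r - c 2))"
        using nz by (simp add: add_divide_distrib)
      also note interp
      finally show ?thesis .
    qed
    have "product_of_skew_symmetric (Suc (3 + 3)) 3 (arrow 3 x y a)"
      by (rule arrow_product_of_three_skew[where \<sigma> = "\<lambda>i. if i = 0 then 4 else if i = 4 then 0 else
           if i = 1 then 5 else if i = 5 then 1 else if i = 2 then 3 else 2"])
        (use xy in \<open>auto simp: x_def y_def less_6_iff\<close>)
    moreover have "det (arrow_pencil 3 1 2 x y a) \<noteq> 0"
    proof (rule arrow_nonsingular)
      \<comment> \<open>\<open>5/2\<close> is the value of \<open>\<rho>\<close> at \<open>s = 0\<close>, where the pencil is \<open>A + 2 A\<^sup>T\<close> itself.\<close>
      have q0: "5 / 2 \<noteq> \<rho> s" if "s \<in> H" for s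
      proof
        have s: "s \<noteq> 0" "2 - s \<noteq> 0" "1 - 2 * s \<noteq> 0" using H0[OF that] by auto
        assume "5 / 2 = \<rho> s"
        moreover have "5 * d = 2 * k" if "5 / 2 = k / d" "d \<noteq> 0" for k d :: complex
          using that by (simp add: field_simps)
        ultimately have "5 * ((1 - 2 * s) * (2 - s)) = 2 * ((1 - 2 * s) ^ 2 + (2 - s) ^ 2)"
          unfolding \<rho>_def using s(2,3) by (metis mult_eq_0_iff)
        then have "9 * s = 0" by (simp add: algebra_simps power2_eq_square)
        with s show False by simp
      qed
      have "- ((1 + 2) / (1 * 2)) * (q (5 / 2) / ((5 / 2 - c 0) * (5 / 2 - c 1) * (5 / 2 - c 2))) \<noteq> 0"
        using q0 Hs by (simp add: q_def c_def)
      then show "(\<Sum>i<3. a i ^ 2 * (1 / (1 * y i - 2 * x i) + 1 / (2 * y i - 1 * x i))) \<noteq> 0"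
        by (subst sum[of 1 2 "5 / 2"]) (auto simp: c_def)
      show "1 * y i - 2 * x i \<noteq> 0 \<and> 2 * y i - 1 * x i \<noteq> 0" if "i < 3" for i
        by (auto simp: x_def y_def)
    qed auto
    moreover have "det (arrow_pencil 3 (1 - 2 * u) (2 - u) x y a) = 0" if u: "u \<in> H \<union> inverse ` H" for u
    proof -
      from u obtain s where s: "s \<in> H" "u = s \<or> u = 1 / s" by (auto simp: inverse_eq_divide)
      have s0: "s \<noteq> 0" "2 - s \<noteq> 0" "1 - 2 * s \<noteq> 0" using H0[OF s(1)] by auto
      have inv: "2 - 1 / s = - (1 - 2 * s) / s" "1 - 2 * (1 / s) = - (2 - s) / s" using s0 by (simp_all add: field_simps)
      have u0: "1 - 2 * u \<noteq> 0" "2 - u \<noteq> 0"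
        using s(2) s0 inv by (metis divide_eq_0_iff neg_equal_0_iff_equal)+
      have "((- d / s) ^ 2 + (- k / s) ^ 2) / (- d / s * (- k / s)) = (k ^ 2 + d ^ 2) / (k * d)"
        if "k \<noteq> 0" "d \<noteq> 0" for k d
        using that s0(1) by (simp add: field_simps power2_eq_square)
      from this[OF s0(3,2)] have "\<rho> (1 / s) = \<rho> s" unfolding \<rho>_def inv .
      then have "\<rho> u = \<rho> s" using s(2) by auto
      then have q0: "q (\<rho> u) = 0" using s(1) Hs by (auto simp: q_def)
      have ru: "\<rho> u = ((1 - 2 * u) ^ 2 + (2 - u) ^ 2) / ((1 - 2 * u) * (2 - u))" by (simp add: \<rho>_def)
      show ?thesis
      proof (cases "\<exists>i<3. \<rho> u = c i")
        case True
        then obtain i where i: "i < 3" "\<rho> u = c i" by auto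
        then have "a i = 0" using q0 by (simp add: a_def \<kappa>_def)
        moreover have "(1 - 2 * u) * y i = (2 - u) * x i \<or> (2 - u) * y i = (1 - 2 * u) * x i"
          using coupling_term(2)[OF u0, of "x i" "y i"] xy[of i] i(2) unfolding c ru[symmetric] by auto
        ultimately show ?thesis by (intro arrow_singular_decoupled[OF i(1)])
      next
        case False
        show ?thesis
        proof (rule arrow_singular_coupled)
          show "(1 - 2 * u) * y i - (2 - u) * x i \<noteq> 0 \<and> (2 - u) * y i - (1 - 2 * u) * x i \<noteq> 0" if "i < 3" for i
            using coupling_term(2)[OF u0, of "x i" "y i"] xy[of i] False that unfolding c ru[symmetric] by auto
          show "(\<Sum>i<3. a i ^ 2 * (1 / ((1 - 2 * u) * y i - (2 - u) * x i) + 1 / ((2 - u) * y i - (1 - 2 * u) * x i))) = 0"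
            using False by (subst sum[OF u0 ru]) (auto simp: q0)
        qed
      qed
    qed
    ultimately show "\<exists>x y a. product_of_skew_symmetric (Suc (3 + 3)) 3 (arrow 3 x y a) \<and>
       det (1 \<cdot>\<^sub>m arrow 3 x y a + 2 \<cdot>\<^sub>m transpose_mat (arrow 3 x y a)) \<noteq> 0 \<and>
       (\<forall>s\<in>H \<union> inverse ` H.
          det ((1 - 2 * s) \<cdot>\<^sub>m arrow 3 x y a + (2 - s) \<cdot>\<^sub>m transpose_mat (arrow 3 x y a)) = 0)"
      by blast
  qed simp
  then show ?thesis by simp
qed

section \<open>The generic factorization theorem\<close>

theorem proposition5p5:
  fixes n r :: nat
  assumes "n > 0" and "r > 0"
  shows "(even n \<and> ((n \<ge> 8 \<and> r \<ge> 3) \<or> (n = 6 \<and> r \<ge> 4) \<or> (n = 4 \<and> r \<ge> 5))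
            \<longrightarrow> holds_generically n (carrier_mat n n) (product_of_skew_symmetric n r)) \<and>
         (odd n \<and> ((n \<ge> 5 \<and> r \<ge> 3) \<or> (n = 3 \<and> r \<ge> 4))
            \<longrightarrow> holds_generically n (DET n) (product_of_skew_symmetric n r))"
proof (intro conjI impI)
  assume "even n \<and> ((n \<ge> 8 \<and> r \<ge> 3) \<or> (n = 6 \<and> r \<ge> 4) \<or> (n = 4 \<and> r \<ge> 5))"
  then have ev: "even n" and "(n \<ge> 8 \<and> r \<ge> 3) \<or> (n = 6 \<and> r \<ge> 4) \<or> (n = 4 \<and> r \<ge> 5)" by auto
  then consider "n \<ge> 8" "r \<ge> 3" | "n = 6" "r \<ge> 4" | "n = 4" "r \<ge> 5" by auto
  then have "certified n r"
  proof cases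
    case 1
    obtain m where "n = m + m" using ev by (metis evenE mult_2)
    with 1 show ?thesis using certified_mono[OF 1(2) certified_three[of m]] ev by auto
  next
    case 2
    then show ?thesis using certified_mono[OF 2(2) certified_6_4] by simp
  next
    case 3
    then show ?thesis using certified_mono[OF 3(2) certified_4_5] by simp
  qed
  then show "holds_generically n (carrier_mat n n) (product_of_skew_symmetric n r)"
    by (rule certified_imp_generic)
next
  assume "odd n \<and> ((n \<ge> 5 \<and> r \<ge> 3) \<or> (n = 3 \<and> r \<ge> 4))"
  then have od: "odd n" and cases: "(n \<ge> 5 \<and> r \<ge> 3) \<or> (n = 3 \<and> r \<ge> 4)" by auto
  obtain m where n: "n = Suc (m + m)" using od by (metis oddE mult_2 Suc_eq_plus1)
  from cases n consider "m \<ge> 4" "r \<ge> 3" | "m = 3" "r \<ge> 3" | "m = 2" "r \<ge> 3" | "m = 1" "r \<ge> 4" by fastforce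
  then have "certified_det (m + m) r"
  proof cases
    case 1
    show ?thesis
      using certified_det_mono[OF 1(2) certified_three_imp_certified_det[OF certified_three[OF 1(1)]]] by simp
  next
    case 2
    then show ?thesis using certified_det_mono[OF 2(2) certified_det_6_3] by simp
  next
    case 3
    then show ?thesis using certified_det_mono[OF 3(2) certified_det_4_3] by simp
  next
    case 4
    then show ?thesis using certified_det_mono[OF 4(2) certified_det_2_4] by (simp add: numeral_2_eq_2)
  qed
  then show "holds_generically n (DET n) (product_of_skew_symmetric n r)"
    unfolding n by (rule certified_det_imp_generic)
qed

end
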